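(* Let $\mathbb{P}$ be a number field with ring of integers $\mathcal{O}_{\mathbb{P}}$, let $m=|\mathbb{P}:\mathbb{Q}|$, let $n$ be a positive integer, and let $G$ be a finitely generated subgroup of $\mathrm{GL}(n,\mathbb{P})$. Suppose that $G\leq \mathrm{GL}(n,\mathcal{O}_{\mathbb{P}})$ and that $G$ is solvable-by-finite. Then $$\mathrm{h}(G)\leq \frac{nm(nm+1)}{2}\qquad\text{and}\qquad \mathrm{rk}(G)\leq \frac{nm(2nm+3)}{2}.$$
   Context: A group is solvable-by-finite if it has a solvable normal subgroup of finite index. A group $G$ has finite Prüfer rank $\mathrm{rk}(G)$ if each finitely generated subgroup of $G$ can be generated by $\mathrm{rk}(G)$ elements, and $\mathrm{rk}(G)$ is the least such integer. A group has finite torsion-free rank if it has a subnormal series of finite length whose factors are either periodic (torsion) or infinite cyclic; the number $\mathrm{h}(G)$ of infinite cyclic factors in such a series is the Hirsch number, or torsion-free rank, of $G$ (independent of the series). *)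

theory Defs
  imports
    "HOL-Algebra.Solvable_Groups"
    "HOL-Algebra.Elementary_Groups"
    "HOL-Computational_Algebra.Polynomial"
    "Jordan_Normal_Form.Matrix"
begin

text \<open>
  A number field is represented by a type of characteristic zero that has finite dimension over
  the rationals. The assumption \<^term>\<open>number_field TYPE('a)\<close> below must accompany every use of
  \<open>number_field_degree\<close>, since the library's \<open>dim\<close> is \<open>0\<close> for infinite-dimensional spaces.
\<close>

global_interpretation over_rat:
  vector_space "\<lambda>(q :: rat) (x :: 'a :: field_char_0). of_rat q * x"
  by unfold_locales (simp_all add: algebra_simps of_rat_add of_rat_mult)

definition number_field :: "'a :: field_char_0 itself \<Rightarrow> bool" where
  "number_field TYPE('a) \<longleftrightarrow> (\<exists>B :: 'a set. finite B \<and> over_rat.span B = UNIV)"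

definition number_field_degree :: "'a :: field_char_0 itself \<Rightarrow> nat" where
  "number_field_degree TYPE('a) = over_rat.dim (UNIV :: 'a set)"

definition ring_of_integers :: "'a :: field_char_0 set" where
  "ring_of_integers = {x. algebraic_int x}"

text \<open>
  \<open>GL n R\<close> is the unit group of the ring of \<open>n \<times> n\<close> matrices with entries in the subring \<open>R\<close>,
  so the inverse of a matrix in \<open>GL n R\<close> also has its entries in \<open>R\<close>.
\<close>

definition GL :: "nat \<Rightarrow> 'a :: comm_ring_1 set \<Rightarrow> 'a mat monoid" where
  "GL n R = units_of
     ((ring_mat TYPE('a) n ()) \<lparr>carrier := {A \<in> carrier_mat n n. elements_mat A \<subseteq> R}\<rparr>)"

definition generated_by_at_most :: "('g, 'b) monoid_scheme \<Rightarrow> nat \<Rightarrow> bool" where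
  "generated_by_at_most G r \<longleftrightarrow>
     (\<exists>S. S \<subseteq> carrier G \<and> finite S \<and> card S \<le> r \<and> generate G S = carrier G)"

definition finitely_generated :: "('g, 'b) monoid_scheme \<Rightarrow> bool" where
  "finitely_generated G \<longleftrightarrow> (\<exists>S. S \<subseteq> carrier G \<and> finite S \<and> generate G S = carrier G)"

definition solvable_by_finite :: "('g, 'b) monoid_scheme \<Rightarrow> bool" where
  "solvable_by_finite G \<longleftrightarrow>
     (\<exists>N. N \<lhd> G \<and> solvable (G\<lparr>carrier := N\<rparr>) \<and> finite (rcosets\<^bsub>G\<^esub> N))"

definition prufer_rank_at_most :: "('g, 'b) monoid_scheme \<Rightarrow> nat \<Rightarrow> bool" where
  "prufer_rank_at_most G r \<longleftrightarrow>
     (\<forall>H. subgroup H G \<and> finitely_generated (G\<lparr>carrier := H\<rparr>)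
        \<longrightarrow> generated_by_at_most (G\<lparr>carrier := H\<rparr>) r)"

definition has_finite_prufer_rank :: "('g, 'b) monoid_scheme \<Rightarrow> bool" where
  "has_finite_prufer_rank G \<longleftrightarrow> (\<exists>r. prufer_rank_at_most G r)"

definition prufer_rank :: "('g, 'b) monoid_scheme \<Rightarrow> nat" where
  "prufer_rank G = (LEAST r. prufer_rank_at_most G r)"

definition periodic_group :: "('g, 'b) monoid_scheme \<Rightarrow> bool" where
  "periodic_group G \<longleftrightarrow> (\<forall>x \<in> carrier G. \<exists>k > 0. x [^]\<^bsub>G\<^esub> (k :: nat) = \<one>\<^bsub>G\<^esub>)"

definition infinite_cyclic_group :: "('g, 'b) monoid_scheme \<Rightarrow> bool" where
  "infinite_cyclic_group G \<longleftrightarrow> G \<cong> integer_group"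

text \<open>Subnormal series are written in ascending order \<open>1 = H 0 \<lhd> H 1 \<lhd> \<dots> \<lhd> H l = G\<close>.\<close>

definition subnormal_series :: "('g, 'b) monoid_scheme \<Rightarrow> nat \<Rightarrow> (nat \<Rightarrow> 'g set) \<Rightarrow> bool" where
  "subnormal_series G l H \<longleftrightarrow>
     H 0 = {\<one>\<^bsub>G\<^esub>} \<and> H l = carrier G \<and> (\<forall>i \<le> l. subgroup (H i) G) \<and>
     (\<forall>i < l. H i \<lhd> (G\<lparr>carrier := H (Suc i)\<rparr>))"

definition series_factor :: "('g, 'b) monoid_scheme \<Rightarrow> (nat \<Rightarrow> 'g set) \<Rightarrow> nat \<Rightarrow> 'g set monoid" where
  "series_factor G H i = (G\<lparr>carrier := H (Suc i)\<rparr>) Mod H i"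

definition torsion_free_rank_series ::
    "('g, 'b) monoid_scheme \<Rightarrow> nat \<Rightarrow> (nat \<Rightarrow> 'g set) \<Rightarrow> bool" where
  "torsion_free_rank_series G l H \<longleftrightarrow> subnormal_series G l H \<and>
     (\<forall>i < l. periodic_group (series_factor G H i) \<or> infinite_cyclic_group (series_factor G H i))"

definition has_finite_torsion_free_rank :: "('g, 'b) monoid_scheme \<Rightarrow> bool" where
  "has_finite_torsion_free_rank G \<longleftrightarrow> (\<exists>l H. torsion_free_rank_series G l H)"

text \<open>
  The description is well defined on groups of finite torsion-free rank, because the number of
  infinite cyclic factors does not depend on the series.
\<close>

definition hirsch_number :: "('g, 'b) monoid_scheme \<Rightarrow> nat" where
  "hirsch_number G = (THE h. \<exists>l H. torsion_free_rank_series G l H \<and>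
     h = card {i. i < l \<and> infinite_cyclic_group (series_factor G H i)})"

end

(*
Restriction of scalars embeds G into GL(d, Q), d = nm, with bounded denominators, because G is finitely
generated with algebraic integer entries.  Such a representation preserves a lattice, so it may be taken
over Z.  Induct on d.  If the representation is reducible, both diagonal blocks are covered by induction
and the unipotent block adds a free abelian group of rank at most ab; for the Hirsch number use
a(a + 1)/2 + b(b + 1)/2 + ab = (a + b)(a + b + 1)/2.

In an irreducible representation every normal subgroup with a nonzero fixed vector is trivial.  Distinct
eigenvalues of an element of the congruence subgroup of level 3 never have a root of unity as quotient, and
this forces a solvable-by-finite congruence subgroup to be abelian.  For let M be an abelian normal subgroup.
Only finitely many characters of M occur, so a power of each g fixes a given character chi; an
eigenvector of that power in the weight space of chi is an eigenvector of g, hence g fixes chi and [g, M]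
fixes the weight space.  An abelian congruence subgroup is embedded as a discrete group by the logarithms
of its at most d characters, as in Dirichlet's unit theorem.  The remaining finite quotient embeds in
GL(d, F_3), whose order has at most d^2 + floor(d/2) prime factors.
*)

theory Submission
  imports
    Defs
    "HOL-Algebra.Multiplicative_Group"
    "HOL-Computational_Algebra.Primes"
    "HOL-Library.Function_Algebras"
    "Jordan_Normal_Form.Char_Poly"
begin

section \<open>Relative rank and series in a group\<close>

text \<open>Rank and Hirsch number are bounded relative to a pair of subgroups, because relative
  bounds add up along a chain of kernels inside one fixed group. A block of degree \<open>d\<close>
  costs \<open>d\<close> for the lattice of logarithms and \<open>d * d + d div 2\<close> for the
  quotient modulo 3. This sum, d * d + (3 * d) div 2, survives block decomposition since a * a + b *
  b + a * b is at most (a + b) * (a + b). Level 2 would not do: -1 is congruent to 1 modulo 2, and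
  the congruence subgroup must be free of roots of unity. From one abelian normal subgroup to the
  whole congruence subgroup two steps lead. Along the derived series, a commutator of elements of
  the next layer acts on a weight space as a scalar; multiplication by its inverse permutes the
  finitely many eigenvalues of one of the two elements, so it is a root of unity and hence 1. At the
  periodic top, eigenvectors of powers are eigenvectors. Everything is tested on a single
  eigenvector, because a conjugation-invariant set that fixes one nonzero vector acts
  trivially.\<close>

context group
begin

text \<open>All subgroups are quantified over, finitely generated or not: in
  \<open>relgen_trans\<close> the intersection of a finitely generated \<open>H\<close> with the
  middle group may fail to be finitely generated. For trivial \<open>A\<close> this bounds the
  Pruefer rank.\<close>

definition relgen :: "'a set \<Rightarrow> 'a set \<Rightarrow> nat \<Rightarrow> bool" where
  "relgen A B r \<longleftrightarrow> (\<forall>H. subgroup H G \<and> H \<subseteq> B \<longrightarrow>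
     (\<exists>S. S \<subseteq> H \<and> finite S \<and> card S \<le> r \<and> H \<subseteq> generate G ((H \<inter> A) \<union> S)))"

text \<open>Factors are described by elements: a periodic one by powers falling into the smaller
  group, an infinite cyclic one by a homomorphism \<open>\<epsilon>\<close> on \<open>C\<close> onto
  the integers with the smaller group as kernel. The index counts the infinite cyclic factors, and
  an arbitrary bottom \<open>A\<close> lets series be composed.\<close>

inductive ser :: "'a set \<Rightarrow> 'a set \<Rightarrow> nat \<Rightarrow> bool" where
  base: "subgroup A G \<Longrightarrow> ser A A 0"
| per: "\<lbrakk>ser A B h; subgroup C G; B \<subseteq> C;
         \<And>c b. c \<in> C \<Longrightarrow> b \<in> B \<Longrightarrow> c \<otimes> b \<otimes> inv c \<in> B;
         \<And>c. c \<in> C \<Longrightarrow> \<exists>k>0. c [^] (k::nat) \<in> B\<rbrakk> \<Longrightarrow> ser A C h"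
| cyc: "\<lbrakk>ser A B h; subgroup C G;
         \<And>x y. x \<in> C \<Longrightarrow> y \<in> C \<Longrightarrow> \<epsilon> (x \<otimes> y) = \<epsilon> x + (\<epsilon> y :: int);
         B = {x \<in> C. \<epsilon> x = 0}; t \<in> C; \<epsilon> t = 1\<rbrakk> \<Longrightarrow> ser A C (Suc h)"

lemma ser_subgroup: "ser A B h \<Longrightarrow> subgroup A G \<and> subgroup B G \<and> A \<subseteq> B"
  by (induction rule: ser.induct) auto

lemma ser_trans: "ser B C k \<Longrightarrow> ser A B h \<Longrightarrow> ser A C (h + k)"
proof (induction arbitrary: h rule: ser.induct)
  case (per A' B k C)
  show ?case by (rule ser.per[OF per.IH[OF per.prems] per.hyps(2,3)]) (use per.hyps in auto)
next
  case (cyc A' B k C \<epsilon> t)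
  have "ser A C (Suc (h + k))"
    by (rule ser.cyc[OF cyc.IH[OF cyc.prems] cyc.hyps(2), where \<epsilon>=\<epsilon> and t=t]) (use cyc.hyps in auto)
  then show ?case by simp
qed simp

lemma relgen_mono: "relgen A B r \<Longrightarrow> r \<le> s \<Longrightarrow> relgen A B s"
  unfolding relgen_def by (meson le_trans)

lemma relgen_refl: "relgen A A r"
  unfolding relgen_def
proof (intro allI impI)
  fix H assume H: "subgroup H G \<and> H \<subseteq> A"
  have "H \<subseteq> generate G (H \<inter> A \<union> {})" using H by (auto intro: generate.incl)
  then show "\<exists>S\<subseteq>H. finite S \<and> card S \<le> r \<and> H \<subseteq> generate G (H \<inter> A \<union> S)"
    by (intro exI[of _ "{}"]) auto
qed

text \<open>Generators of \<open>H\<close> modulo \<open>H \<inter> B\<close> and of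
  \<open>H \<inter> B\<close> modulo \<open>A\<close> together generate \<open>H\<close> modulo
  \<open>A\<close>.\<close>

lemma relgen_trans:
  assumes "relgen A B r" "relgen B C s" "subgroup B G"
  shows "relgen A C (r + s)"
  unfolding relgen_def
proof (intro allI impI)
  fix H assume H: "subgroup H G \<and> H \<subseteq> C"
  obtain S where S: "S \<subseteq> H" "finite S" "card S \<le> s" "H \<subseteq> generate G (H \<inter> B \<union> S)"
    using assms(2) H unfolding relgen_def by meson
  have "subgroup (H \<inter> B) G" using H assms(3) by (simp add: subgroups_Inter_pair)
  then obtain T where T: "T \<subseteq> H \<inter> B" "finite T" "card T \<le> r" "H \<inter> B \<subseteq> generate G (H \<inter> B \<inter> A \<union> T)"
    using assms(1) unfolding relgen_def by (meson inf_le2)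
  have HG: "H \<subseteq> carrier G" using H subgroup.subset by blast
  let ?X = "H \<inter> A \<union> (T \<union> S)"
  have X: "?X \<subseteq> carrier G" using HG T(1) S(1) by auto
  have sg: "subgroup (generate G ?X) G" by (rule generate_is_subgroup[OF X])
  have "generate G (H \<inter> B \<inter> A \<union> T) \<subseteq> generate G ?X" by (rule mono_generate) auto
  then have 1: "H \<inter> B \<subseteq> generate G ?X" using T(4) by auto
  have "S \<subseteq> generate G ?X" by (auto intro: generate.incl)
  with 1 have "generate G (H \<inter> B \<union> S) \<subseteq> generate G ?X"
    by (intro generate_subgroup_incl[OF _ sg]) auto
  then have "H \<subseteq> generate G ?X" using S(4) by auto
  moreover have "card (T \<union> S) \<le> r + s" using card_Un_le[of T S] T(3) S(3) by linarith
  ultimately show "\<exists>S\<subseteq>H. finite S \<and> card S \<le> r + s \<and> H \<subseteq> generate G (H \<inter> A \<union> S)"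
    using T S by (intro exI[of _ "T \<union> S"]) auto
qed

lemma generate_eq_of_subset:
  assumes "subgroup H G" "X \<subseteq> H" "H \<subseteq> generate G X" shows "generate G X = H"
  using generate_subgroup_incl[OF assms(2,1)] assms(3) by auto

lemma relgen_prufer:
  assumes "relgen {\<one>} (carrier G) r"
  shows "prufer_rank_at_most G r"
  unfolding prufer_rank_at_most_def
proof (intro allI impI)
  fix H assume H: "subgroup H G \<and> finitely_generated (G\<lparr>carrier := H\<rparr>)"
  then have HG: "subgroup H G" "H \<subseteq> carrier G" using subgroup.subset by auto
  obtain S where S: "S \<subseteq> H" "finite S" "card S \<le> r" "H \<subseteq> generate G (H \<inter> {\<one>} \<union> S)"
    using assms HG unfolding relgen_def by meson
  have SG: "S \<subseteq> carrier G" using S HG by auto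
  have "generate G (H \<inter> {\<one>} \<union> S) \<subseteq> generate G S"
    by (rule generate_subgroup_incl[OF _ generate_is_subgroup[OF SG]])
      (auto intro: generate.incl generate.one)
  then have "generate G S = H" using S generate_eq_of_subset[OF HG(1) S(1)] by auto
  then have "generate (G\<lparr>carrier := H\<rparr>) S = H"
    using generate_consistent[OF S(1) HG(1)] by simp
  then show "generated_by_at_most (G\<lparr>carrier := H\<rparr>) r"
    unfolding generated_by_at_most_def using S by auto
qed

end

section \<open>Finite groups: number of generators and prime factors of the order\<close>

lemma card_prime_factorization_dvd_mono:
  fixes a b :: nat
  assumes "a dvd b" "b \<noteq> 0"
  shows "size (prime_factorization a) \<le> size (prime_factorization b)"
proof -
  obtain c where c: "b = a * c" using assms by blast
  with assms have "a \<noteq> 0" "c \<noteq> 0" by auto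
  then show ?thesis using c by (simp add: prime_factorization_mult)
qed

lemma (in group) subgroup_dvd_subgroup:
  assumes "subgroup K G" "subgroup H G" "K \<subseteq> H" "finite H"
  shows "card K dvd card H"
proof -
  interpret H: group "G\<lparr>carrier := H\<rparr>" by (rule subgroup_imp_group[OF assms(2)])
  have "subgroup K (G\<lparr>carrier := H\<rparr>)" using assms subgroup_incl by blast
  then have "card (rcosets\<^bsub>G\<lparr>carrier := H\<rparr>\<^esub> K) * card K = Coset.order (G\<lparr>carrier := H\<rparr>)"
    using H.lagrange by blast
  then show ?thesis unfolding Coset.order_def by (auto intro: dvdI[of _ _ "card (rcosets\<^bsub>G\<lparr>carrier := H\<rparr>\<^esub> K)"] simp: mult.commute)
qed

text \<open>Each new generator enlarges the current subgroup, and by Lagrange its order gains at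
  least one prime factor.\<close>

lemma (in group) finite_generated_by_prime_factors:
  assumes "subgroup H G" "finite H"
  shows "\<exists>S. S \<subseteq> H \<and> finite S \<and> card S \<le> size (prime_factorization (card H)) \<and> generate G S = H"
proof -
  have HG: "H \<subseteq> carrier G" using assms(1) subgroup.subset by blast
  \<comment> \<open>Invariant: the prime factors still missing from \<open>card K\<close> pay for
    the generators still to be added to \<open>T\<close>.\<close>
  have "\<exists>S. S \<subseteq> H \<and> finite S \<and> generate G S = H \<and> 
      card S + size (prime_factorization (card K)) \<le> size (prime_factorization (card H)) + card T"
    if "T \<subseteq> H" "K = generate G T" "finite T" for K T
    using that
  proof (induction "card H - card K" arbitrary: K T rule: less_induct)
    case less
    have KH: "K \<subseteq> H" using less.prems generate_subgroup_incl[OF _ assms(1)] by auto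
    have sK: "subgroup K G" using less.prems HG generate_is_subgroup by auto
    have fK: "finite K" using KH assms(2) finite_subset by auto
    show ?case
    proof (cases "K = H")
      case True then show ?thesis using less.prems by (intro exI[of _ T]) auto
    next
      case False
      then obtain x where x: "x \<in> H" "x \<notin> K" using KH by auto
      define L where "L = generate G (insert x T)"
      have iT: "insert x T \<subseteq> H" using x less.prems by auto
      have sL: "subgroup L G" using generate_is_subgroup[of "insert x T"] iT HG unfolding L_def by blast
      have LH: "L \<subseteq> H" using generate_subgroup_incl[OF iT assms(1)] unfolding L_def by auto
      have KL: "K \<subset> L" using x(2) mono_generate[of T "insert x T"] less.prems(2) L_def
        by (auto intro: generate.incl)
      have fL: "finite L" using LH assms(2) finite_subset by auto
      have c: "card K < card L" "card L \<le> card H" using KL fL LH assms(2) by (auto intro: psubset_card_mono card_mono)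
      have L0: "card L \<noteq> 0" "card K \<noteq> 0" using c sK fK subgroup.one_closed[OF sK] by auto
      obtain S where S: "S \<subseteq> H" "finite S" "generate G S = H" 
        "card S + size (prime_factorization (card L)) \<le> size (prime_factorization (card H)) + card (insert x T)"
        using less.hyps[OF _ iT L_def] c less.prems by (metis diff_less_mono2 finite_insert order_less_le_trans)
      obtain d where d: "card L = card K * d" using subgroup_dvd_subgroup[OF sK sL _ fL] KL by auto
      then have "d \<noteq> 0" "d \<noteq> 1" using c L0 by auto
      then have "prime_factorization d \<noteq> {#}" by (simp add: prime_factorization_empty_iff)
      then have "size (prime_factorization d) \<ge> 1" by (simp add: Suc_leI nonempty_has_size)
      moreover have "size (prime_factorization (card L)) = size (prime_factorization (card K)) + size (prime_factorization d)"
        using d L0 \<open>d \<noteq> 0\<close> by (simp add: prime_factorization_mult)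
      moreover have "card (insert x T) \<le> Suc (card T)" using less.prems(3) by (simp add: card_insert_if)
      ultimately show ?thesis using S by (intro exI[of _ S]) auto
    qed
  qed
  from this[of "{}" "generate G {}"] obtain S where S: "S \<subseteq> H" "finite S" "generate G S = H"
      "card S + size (prime_factorization (card (generate G {}))) \<le> size (prime_factorization (card H))"
    by auto
  then have "card S \<le> size (prime_factorization (card H))" by linarith
  with S show ?thesis by blast
qed

text \<open>The image of \<open>H\<close> in \<open>X\<close> has few generators; preimages of them
  in \<open>H\<close>, together with the kernel part \<open>H \<inter> A\<close>, generate
  \<open>H\<close>. The bound is uniform in \<open>H\<close> because the order of the image divides
  that of \<open>X\<close>.\<close>

lemma (in group) relgen_finite:
  assumes X: "group X" "finite (carrier X)" and B: "subgroup B G"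
    and hom: "f \<in> hom (G\<lparr>carrier := B\<rparr>) X" and A: "A = {b \<in> B. f b = \<one>\<^bsub>X\<^esub>}"
  shows "relgen A B (size (prime_factorization (Coset.order X)))"
  unfolding relgen_def
proof (intro allI impI)
  fix H assume H: "subgroup H G \<and> H \<subseteq> B"
  interpret X: group X by fact
  interpret B: group "G\<lparr>carrier := B\<rparr>" by (rule subgroup_imp_group[OF B])
  interpret f: group_hom "G\<lparr>carrier := B\<rparr>" X f using hom by unfold_locales
  have HG: "H \<subseteq> carrier G" using H subgroup.subset by blast
  have sH: "subgroup H (G\<lparr>carrier := B\<rparr>)" using H B subgroup_incl by blast
  then have sf: "subgroup (f ` H) X" using f.subgroup_img_is_subgroup by blast
  then have ff: "finite (f ` H)" using X subgroup.subset finite_subset by metis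
  obtain T where T: "T \<subseteq> f ` H" "finite T" "card T \<le> size (prime_factorization (card (f ` H)))" "generate X T = f ` H"
    using X.finite_generated_by_prime_factors[OF sf ff] by blast
  have "card (f ` H) dvd Coset.order X" using X.subgroup_dvd_subgroup[OF sf X.subgroup_self] X(2) sf subgroup.subset
    unfolding Coset.order_def by blast
  moreover have "Coset.order X \<noteq> 0" using X(2) X.order_gt_0_iff_finite by blast
  ultimately have cT: "card T \<le> size (prime_factorization (Coset.order X))"
    using T(3) card_prime_factorization_dvd_mono le_trans by blast
  obtain S where S0: "S \<subseteq> H" "inj_on f S" "f ` S = T"
    using T(1) unfolding subset_image_inj by auto
  then have S: "S \<subseteq> H" "finite S" "f ` S = T" "card S = card T"
    using T(2) finite_imageD[of f S] card_image[OF S0(2)] by simp_all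
  have gS: "generate X T = f ` generate G S"
  proof -
    have "generate X (f ` S) = f ` generate (G\<lparr>carrier := B\<rparr>) S"
      using f.generate_img[of S] S(1) H by auto
    moreover have "generate (G\<lparr>carrier := B\<rparr>) S = generate G S"
      using generate_consistent[OF _ B, of S] S(1) H by blast
    ultimately show ?thesis using S(3) by simp
  qed
  let ?Y = "generate G (H \<inter> A \<union> S)"
  have Y: "H \<inter> A \<union> S \<subseteq> carrier G" using S HG by auto
  have sY: "subgroup ?Y G" by (rule generate_is_subgroup[OF Y])
  have SH: "generate G S \<subseteq> H" using generate_subgroup_incl[OF S(1)] H by auto
  have "h \<in> ?Y" if h: "h \<in> H" for h
  proof -
    have "f h \<in> f ` generate G S" using T(4) gS h by auto
    then obtain s where s: "s \<in> generate G S" "f h = f s" by auto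
    have sH': "s \<in> H" using s SH by auto
    have "s \<in> ?Y" using s mono_generate[of S "H \<inter> A \<union> S"] by auto
    have hs: "h \<otimes> inv s \<in> H" using H h sH' by (meson subgroup.m_closed subgroup.m_inv_closed)
    have hB: "h \<in> B" "s \<in> B" using H h sH' by auto
    have "f (h \<otimes> inv s) = f h \<otimes>\<^bsub>X\<^esub> inv\<^bsub>X\<^esub> (f s)"
      using f.hom_mult[of h "inv s"] f.hom_inv[of s] hB m_inv_consistent[OF B]
      by (simp add: B subgroup.m_inv_closed)
    also have "\<dots> = \<one>\<^bsub>X\<^esub>" using s(2) hB f.hom_closed[of s] by simp
    finally have "h \<otimes> inv s \<in> A" using A hs H by auto
    then have "h \<otimes> inv s \<in> ?Y" using hs by (auto intro: generate.incl)
    then have "(h \<otimes> inv s) \<otimes> s \<in> ?Y" by (rule subgroup.m_closed[OF sY _ \<open>s \<in> ?Y\<close>])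
    moreover have "(h \<otimes> inv s) \<otimes> s = h" using h sH' subsetD[OF HG] by (simp add: m_assoc)
    ultimately show ?thesis by simp
  qed
  then show "\<exists>S\<subseteq>H. finite S \<and> card S \<le> size (prime_factorization (Coset.order X)) \<and> H \<subseteq> generate G (H \<inter> A \<union> S)"
    using S(1,2,4) cT by (intro exI[of _ S]) auto
qed

section \<open>Factors of a series described by elements\<close>

lemma (in normal) periodic_factor_iff:
  "periodic_group (G Mod H) \<longleftrightarrow> (\<forall>x \<in> carrier G. \<exists>k>0. x [^] (k::nat) \<in> H)"
proof -
  have eq: "(H #> x) [^]\<^bsub>G Mod H\<^esub> k = H \<longleftrightarrow> x [^] k \<in> H" if "x \<in> carrier G" for x and k :: nat
  proof -
    have "(H #> x) [^]\<^bsub>G Mod H\<^esub> k = H #> (x [^] k)" using FactGroup_pow[OF that] .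
    moreover have "H #> (x [^] k) = H \<longleftrightarrow> x [^] k \<in> H"
      using nat_pow_closed[OF that] coset_join1[OF _ _ subgroup_axioms] coset_join2[OF _ subgroup_axioms] by metis
    ultimately show ?thesis by simp
  qed
  have "periodic_group (G Mod H) \<longleftrightarrow> (\<forall>x \<in> carrier G. \<exists>k>0. (H #> x) [^]\<^bsub>G Mod H\<^esub> (k::nat) = H)"
    unfolding periodic_group_def carrier_FactGroup by simp
  also have "\<dots> \<longleftrightarrow> (\<forall>x \<in> carrier G. \<exists>k>0. x [^] (k::nat) \<in> H)" using eq by simp
  finally show ?thesis .
qed

text \<open>\<open>\<epsilon>\<close> is the quotient map followed by an isomorphism onto the
  integers, and \<open>t\<close> is a preimage of 1.\<close>

lemma (in normal) infinite_cyclic_factorD: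
  assumes "infinite_cyclic_group (G Mod H)"
  shows "\<exists>\<epsilon> :: 'a \<Rightarrow> int. \<exists>t. (\<forall>x\<in>carrier G. \<forall>y\<in>carrier G. \<epsilon> (x \<otimes> y) = \<epsilon> x + \<epsilon> y) \<and>
    H = {x \<in> carrier G. \<epsilon> x = 0} \<and> t \<in> carrier G \<and> \<epsilon> t = 1"
proof -
  from assms have "\<exists>f. f \<in> iso (G Mod H) integer_group"
    unfolding infinite_cyclic_group_def is_iso_def ex_in_conv .
  then obtain f where f: "f \<in> iso (G Mod H) integer_group" ..
  have hom: "f \<in> hom (G Mod H) integer_group" using f by (simp add: Group.iso_def)
  let ?e = "\<lambda>x. f (H #> x)"
  have 1: "?e (x \<otimes> y) = ?e x + ?e y" if "x \<in> carrier G" "y \<in> carrier G" for x y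
  proof -
    have a: "H #> x \<in> carrier (G Mod H)" "H #> y \<in> carrier (G Mod H)"
      unfolding carrier_FactGroup using that by auto
    from hom_mult[OF hom a] show ?thesis unfolding mult_FactGroup rcos_sum[OF that] by simp
  qed
  have 2: "?e x = 0 \<longleftrightarrow> x \<in> H" if x: "x \<in> carrier G" for x
  proof -
    have inj: "inj_on f (carrier (G Mod H))" using f by (simp add: Group.iso_def bij_betw_def)
    have mem: "H #> x \<in> carrier (G Mod H)" "H \<in> carrier (G Mod H)"
      using imageI[OF x, of "(#>) H"] imageI[OF one_closed, of "(#>) H"] coset_mult_one[OF subset]
      unfolding carrier_FactGroup by simp_all
    have "f H = 0" using hom_one[OF hom factorgroup_is_group group_integer_group] by simp
    then have "?e x = 0 \<longleftrightarrow> H #> x = H" using inj_on_eq_iff[OF inj mem] by simp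
    also have "\<dots> \<longleftrightarrow> x \<in> H"
      using x coset_join1[OF _ _ subgroup_axioms] coset_join2[OF _ subgroup_axioms] by metis
    finally show ?thesis .
  qed
  have "(1::int) \<in> f ` carrier (G Mod H)" using f by (simp add: Group.iso_def bij_betw_def)
  then obtain t where t: "t \<in> carrier G" "?e t = 1" unfolding carrier_FactGroup by (metis (no_types, lifting) imageE)
  have "H = {x \<in> carrier G. ?e x = 0}" using 2 subset by auto
  with 1 t show ?thesis by (intro exI[of _ ?e] exI[of _ t]) simp
qed

lemma (in normal) infinite_cyclic_factorI:
  fixes \<epsilon> :: "'a \<Rightarrow> int"
  assumes e: "\<And>x y. x \<in> carrier G \<Longrightarrow> y \<in> carrier G \<Longrightarrow> \<epsilon> (x \<otimes> y) = \<epsilon> x + \<epsilon> y"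
    and H: "H = {x \<in> carrier G. \<epsilon> x = 0}" and t: "t \<in> carrier G" "\<epsilon> t = 1"
  shows "infinite_cyclic_group (G Mod H)"
proof -
  have e: "group_hom G integer_group \<epsilon>"
    by (rule group_hom.intro[OF is_group group_integer_group group_hom_axioms.intro]) (simp add: hom_def e)
  have "i \<in> \<epsilon> ` carrier G" for i
  proof -
    have "\<epsilon> (t [^] i) = i" using group_hom.hom_int_pow[OF e t(1), of i] t(2) by simp
    then show ?thesis using t(1) by (metis image_eqI int_pow_closed)
  qed
  then have "\<epsilon> ` carrier G = carrier integer_group" by auto
  from group_hom.FactGroup_iso_set[OF e this] have "G Mod (kernel G integer_group \<epsilon>) \<cong> integer_group"
    by (rule is_isoI)
  then show ?thesis
    unfolding infinite_cyclic_group_def kernel_def H by simp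
qed

lemma chain_mono:
  fixes K :: "nat \<Rightarrow> 'a set"
  assumes "\<And>j. j < r \<Longrightarrow> K j \<subseteq> K (Suc j)" "i \<le> j" "j \<le> r"
  shows "K i \<subseteq> K j"
  using assms(2,3)
proof (induction j)
  case (Suc j)
  then show ?case using assms(1)[of j] by (cases "i = Suc j") auto
qed simp

context group
begin

lemma subgroup_nat_pow_closed: "subgroup C G \<Longrightarrow> x \<in> C \<Longrightarrow> x [^] (n::nat) \<in> C"
  using subgroup_int_pow_closed[of C x "int n"] by (simp add: int_pow_int)

context
  fixes C and f :: "'a \<Rightarrow> 'r :: ring_1"
  assumes C: "subgroup C G" and f: "\<And>x y. x \<in> C \<Longrightarrow> y \<in> C \<Longrightarrow> f (x \<otimes> y) = f x + f y"
begin

lemma additive_one: "f \<one> = 0"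
  using f[of \<one> \<one>] subgroup.one_closed[OF C] by simp

lemma additive_inv: "x \<in> C \<Longrightarrow> f (inv x) = - f x"
  using f[of x "inv x"] additive_one subgroup.m_inv_closed[OF C] subgroup.mem_carrier[OF C]
  by (simp add: eq_neg_iff_add_eq_0 add.commute)

lemma additive_nat_pow: "x \<in> C \<Longrightarrow> f (x [^] (n::nat)) = of_nat n * f x"
proof (induction n)
  case (Suc n)
  then have "x [^] n \<in> C" using C by (simp add: subgroup_nat_pow_closed)
  with Suc f show ?case by (simp add: algebra_simps)
qed (simp add: additive_one)

lemma additive_int_pow: "x \<in> C \<Longrightarrow> f (x [^] (n::int)) = of_int n * f x"
  using additive_inv[of "x [^] (nat \<bar>n\<bar>)"] additive_nat_pow[of x] subgroup_nat_pow_closed[OF C, of x]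
    subgroup.mem_carrier[OF C, of x]
  by (cases n rule: int_cases2) (auto simp: int_pow_int int_pow_neg_int)

end

lemma mult_inv_cancel:
  assumes "x \<in> carrier G" "y \<in> carrier G"
  shows "x \<otimes> (inv x \<otimes> y) = y" "inv x \<otimes> (x \<otimes> y) = y"
  using assms by (simp_all flip: m_assoc)

text \<open>Modulo the normal subgroup \<open>N\<close> the elements \<open>u\<close> and
  \<open>u \<otimes> n\<close> agree, hence so do their powers; the factors from \<open>N\<close>
  are collected on the right by conjugation.\<close>

lemma nat_pow_mod_normal:
  assumes M: "subgroup M G" and N: "subgroup N G" "N \<subseteq> M"
    and conj: "\<And>c b. c \<in> M \<Longrightarrow> b \<in> N \<Longrightarrow> c \<otimes> b \<otimes> inv c \<in> N"
    and u: "u \<in> M" and n: "n \<in> N" and un: "(u \<otimes> n) [^] (k::nat) \<in> N"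
  shows "u [^] k \<in> N"
proof -
  have uG: "u \<in> carrier G" and MG: "M \<subseteq> carrier G" using u M subgroup.subset by auto
  have NG: "N \<subseteq> carrier G" using N MG by auto
  have "\<exists>n' \<in> N. (u \<otimes> n) [^] k = u [^] k \<otimes> n'" for k :: nat
  proof (induction k)
    case 0 show ?case by (rule bexI[OF _ subgroup.one_closed[OF N(1)]]) simp
  next
    case (Suc k)
    then obtain n' where n': "n' \<in> N" "(u \<otimes> n) [^] k = u [^] k \<otimes> n'" by auto
    \<comment> \<open>Moving \<open>n'\<close> to the right past \<open>u\<close> conjugates it by
      \<open>inv u\<close>; the double inverse matches the shape of \<open>conj\<close>.\<close>
    let ?m = "inv u \<otimes> n' \<otimes> inv (inv u) \<otimes> n"
    have "inv u \<in> M" using u M by (simp add: subgroup.m_inv_closed)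
    then have m: "?m \<in> N" using conj n' n N(1) subgroup.m_closed by metis
    have c: "n \<in> carrier G" "n' \<in> carrier G" using n n' NG by auto
    have "u [^] Suc k \<otimes> ?m = u [^] k \<otimes> n' \<otimes> (u \<otimes> n)"
      using uG c by (simp add: m_assoc mult_inv_cancel)
    also have "\<dots> = (u \<otimes> n) [^] Suc k" using n' by simp
    finally show ?case using m by metis
  qed
  then obtain n' where n': "n' \<in> N" "(u \<otimes> n) [^] k = u [^] k \<otimes> n'" by blast
  have "u [^] k = (u \<otimes> n) [^] k \<otimes> inv n'"
    using n' NG uG by (simp add: m_assoc subset_iff)
  then show ?thesis using subgroup.m_closed[OF N(1) un subgroup.m_inv_closed[OF N(1) n'(1)]] by simp
qed

text \<open>Induction down the series, intersecting the chain with the next lower term. Across a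
  periodic factor no non-periodic index is lost, since elements may be replaced by powers; across an
  infinite cyclic factor at most one is lost. This inequality is behind the independence of the
  Hirsch number from the series.\<close>

lemma ser_chain_bound:
  assumes "ser A B h" and "\<And>j. j \<le> r \<Longrightarrow> subgroup (K j) G" and "A \<subseteq> K 0" and "K r \<subseteq> B"
    and "\<And>j. j < r \<Longrightarrow> K j \<subseteq> K (Suc j)"
    and "\<And>j c b. j < r \<Longrightarrow> c \<in> K (Suc j) \<Longrightarrow> b \<in> K j \<Longrightarrow> c \<otimes> b \<otimes> inv c \<in> K j"
  shows "card {j. j < r \<and> (\<exists>y \<in> K (Suc j). \<forall>k>0. y [^] (k::nat) \<notin> K j)} \<le> h"
  using assms
proof (induction arbitrary: K rule: ser.induct)
  case (base A)
  have mono: "K i \<subseteq> K j" if "i \<le> j" "j \<le> r" for i j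
    by (rule chain_mono[where K=K, OF base.prems(4) that])
  have "\<exists>k>0. y [^] (k::nat) \<in> K j" if "j < r" "y \<in> K (Suc j)" for j y
  proof -
    have "y \<in> K j" using mono[of "Suc j" r] mono[of 0 j] that base.prems(2,3) by auto
    moreover have "y \<in> carrier G" using that base.prems(1)[of "Suc j"] subgroup.mem_carrier by force
    ultimately show ?thesis by (intro exI[of _ 1]) simp
  qed
  then have "{j. j < r \<and> (\<exists>y \<in> K (Suc j). \<forall>k>0. y [^] (k::nat) \<notin> K j)} = {}" by blast
  then show ?case by simp
next
  case (per A B h C)
  note sg = per.prems(1)
  have B: "subgroup B G" "A \<subseteq> B" using ser_subgroup[OF per.hyps(1)] by auto
  let ?K = "\<lambda>j. K j \<inter> B"
  have mono: "K i \<subseteq> K j" if "i \<le> j" "j \<le> r" for i j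
    by (rule chain_mono[where K=K, OF per.prems(4) that])
  have bd: "card {j. j < r \<and> (\<exists>y \<in> ?K (Suc j). \<forall>k>0. y [^] (k::nat) \<notin> ?K j)} \<le> h"
  proof (rule per.IH)
    show "subgroup (?K j) G" if "j \<le> r" for j using sg[OF that] B by (simp add: subgroups_Inter_pair)
    show "c \<otimes> b \<otimes> inv c \<in> ?K j" if "j < r" "c \<in> ?K (Suc j)" "b \<in> ?K j" for j c b
      using that per.prems(5)[OF that(1)] B(1) by (auto intro!: subgroup.m_closed subgroup.m_inv_closed)
    show "A \<subseteq> ?K 0" using per.prems(2) B by blast
    show "?K r \<subseteq> B" by blast
    show "?K j \<subseteq> ?K (Suc j)" if "j < r" for j using per.prems(4)[OF that] by blast
  qed
  have "{j. j < r \<and> (\<exists>y \<in> K (Suc j). \<forall>k>0. y [^] (k::nat) \<notin> K j)} \<subseteq>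
     {j. j < r \<and> (\<exists>y \<in> ?K (Suc j). \<forall>k>0. y [^] (k::nat) \<notin> ?K j)}"
  proof clarsimp
    fix j y assume j: "j < r" and y: "y \<in> K (Suc j)" "\<forall>k>0. y [^] (k::nat) \<notin> K j"
    have "y \<in> C" using y mono[of "Suc j" r] j per.prems(3) by auto
    then obtain m where m: "m > 0" "y [^] (m::nat) \<in> B" using per.hyps(5) by metis
    have yG: "y \<in> carrier G" by (rule subgroup.mem_carrier[OF per.hyps(2) \<open>y \<in> C\<close>])
    have "(y [^] m) [^] k \<notin> K j" if "k > 0" for k :: nat
      using y(2) that m yG by (simp add: nat_pow_pow)
    moreover have "y [^] m \<in> K (Suc j)" using y sg[of "Suc j"] j by (simp add: subgroup_nat_pow_closed)
    ultimately show "\<exists>y\<in>K (Suc j) \<inter> B. \<forall>k>0. y [^] (k::nat) \<in> K j \<longrightarrow> y [^] k \<notin> B" using m by blast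
  qed
  from card_mono[OF _ this] show ?case by (rule le_trans[OF _ bd]) simp
next
  case (cyc A B h C \<epsilon> t)
  note sg = cyc.prems(1) and conj = cyc.prems(5)
  have B: "subgroup B G" "A \<subseteq> B" using ser_subgroup[OF cyc.hyps(1)] by auto
  let ?K = "\<lambda>j. K j \<inter> B"
  have mono: "K i \<subseteq> K j" if "i \<le> j" "j \<le> r" for i j
    by (rule chain_mono[where K=K, OF cyc.prems(4) that])
  let ?S = "{j. j < r \<and> (\<exists>y \<in> K (Suc j). \<forall>k>0. y [^] (k::nat) \<notin> K j)}"
  let ?T = "{j. j < r \<and> (\<exists>y \<in> ?K (Suc j). \<forall>k>0. y [^] (k::nat) \<notin> ?K j)}"
  have bd: "card ?T \<le> h"
  proof (rule cyc.IH)
    show "subgroup (?K j) G" if "j \<le> r" for j using sg[OF that] B by (simp add: subgroups_Inter_pair)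
    show "c \<otimes> b \<otimes> inv c \<in> ?K j" if "j < r" "c \<in> ?K (Suc j)" "b \<in> ?K j" for j c b
      using that cyc.prems(5)[OF that(1)] B(1) by (auto intro!: subgroup.m_closed subgroup.m_inv_closed)
    show "A \<subseteq> ?K 0" using cyc.prems(2) B by blast
    show "?K r \<subseteq> B" by blast
    show "?K j \<subseteq> ?K (Suc j)" if "j < r" for j using cyc.prems(4)[OF that] by blast
  qed
  \<comment> \<open>Two lost indices would yield two elements that are independent modulo the chain,
    although a cyclic factor has room for only one.\<close>
  have False if ij: "i < j" "i \<in> ?S - ?T" "j \<in> ?S - ?T" for i j
  proof -
    obtain y where y: "i < r" "y \<in> K (Suc i)" "\<forall>k>0. y [^] (k::nat) \<notin> K i" using ij(2) by blast
    obtain z where z: "j < r" "z \<in> K (Suc j)" "\<forall>k>0. z [^] (k::nat) \<notin> K j" using ij(3) by blast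
    have yz: "y \<in> C" "z \<in> C" using y z mono[of "Suc i" r] mono[of "Suc j" r] cyc.prems(3) by auto
    have yzG: "y \<in> carrier G" "z \<in> carrier G" using yz subgroup.mem_carrier[OF cyc.hyps(2)] by simp_all
    have "y \<notin> B"
    proof
      assume "y \<in> B"
      then have "i \<in> ?T" using y by blast
      then show False using ij by blast
    qed
    then have a: "\<epsilon> y \<noteq> 0" using yz cyc.hyps(4) by auto
    have "y \<in> K j" using y(2) mono[of "Suc i" j] ij z(1) by auto
    \<comment> \<open>The exponents are chosen so that
      \<open>\<epsilon> (u \<otimes> n) = 0\<close>, and \<open>n\<close> is trivial modulo
      \<open>K j\<close> because i < j. So a power of \<open>z\<close> falls into
      \<open>K j\<close>.\<close>
    define n where "n = y [^] (- \<epsilon> z)"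
    define u where "u = z [^] (\<epsilon> y)"
    have n: "n \<in> K j" unfolding n_def using \<open>y \<in> K j\<close> sg[of j] z(1)
      by (simp add: subgroup_int_pow_closed)
    have u: "u \<in> K (Suc j)" unfolding u_def using z sg[of "Suc j"] by (simp add: subgroup_int_pow_closed)
    have nC: "n \<in> C" "u \<in> C" unfolding n_def u_def using yz cyc.hyps(2)
      by (simp_all add: subgroup_int_pow_closed)
    have "\<epsilon> n = - \<epsilon> z * \<epsilon> y" "\<epsilon> u = \<epsilon> y * \<epsilon> z"
      unfolding n_def u_def using additive_int_pow[OF cyc.hyps(2,3)] yz by auto
    then have "\<epsilon> (u \<otimes> n) = 0" using cyc.hyps(3)[OF nC(2,1)] by simp
    then have unB: "u \<otimes> n \<in> B" using cyc.hyps(2,4) nC by (simp add: subgroup.m_closed)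
    have "u \<otimes> n \<in> K (Suc j)" using u n sg[of "Suc j"] cyc.prems(4)[of j] z(1)
      by (auto intro!: subgroup.m_closed)
    then obtain k where k: "k > 0" "(u \<otimes> n) [^] (k::nat) \<in> K j" using unB ij(3) z(1) by blast
    have "u [^] k \<in> K j"
      by (rule nat_pow_mod_normal[OF sg[of "Suc j"] sg[of j] _ conj[of j] u n k(2)])
        (use z(1) cyc.prems(4) in auto)
    then have w: "z [^] (\<epsilon> y * int k) \<in> K j"
      unfolding u_def using yzG by (simp add: int_pow_pow flip: int_pow_int)
    have "z [^] (nat \<bar>\<epsilon> y * int k\<bar>) \<in> K j"
    proof (cases "\<epsilon> y * int k \<ge> 0")
      case True then show ?thesis using w by (simp flip: int_pow_int)
    next
      case False
      have "inv (z [^] (\<epsilon> y * int k)) \<in> K j" using w sg[of j] z(1) by (simp add: subgroup.m_inv_closed)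
      then show ?thesis using False yzG by (simp add: int_pow_neg[symmetric] flip: int_pow_int)
    qed
    moreover have "nat \<bar>\<epsilon> y * int k\<bar> > 0" using a k by simp
    ultimately show False using z(3) by blast
  qed
  then have "i = j" if "i \<in> ?S - ?T" "j \<in> ?S - ?T" for i j
    using that by (cases i j rule: linorder_cases) simp_all
  then have "card (?S - ?T) \<le> Suc 0" by (subst card_le_Suc0_iff_eq) simp_all
  moreover have "card ?S \<le> card (?S - ?T) + card ?T"
    using diff_card_le_card_Diff[of ?T ?S] by simp
  ultimately show ?case using bd by simp
qed

end

lemma (in normal) not_periodic_and_infinite_cyclic:
  assumes "periodic_group (G Mod H)" "infinite_cyclic_group (G Mod H)"
  shows False
proof -
  obtain \<epsilon> :: "'a \<Rightarrow> int" and t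
    where e: "\<forall>x\<in>carrier G. \<forall>y\<in>carrier G. \<epsilon> (x \<otimes> y) = \<epsilon> x + \<epsilon> y"
      and H: "H = {x \<in> carrier G. \<epsilon> x = 0}" and t: "t \<in> carrier G" "\<epsilon> t = 1"
    using infinite_cyclic_factorD[OF assms(2)] by (elim exE conjE) (rule that)
  obtain k where k: "k > 0" "t [^] (k::nat) \<in> H" using assms(1) t(1) unfolding periodic_factor_iff by metis
  have "\<epsilon> (t [^] k) = of_nat k * \<epsilon> t" by (rule additive_nat_pow[OF subgroup_self _ t(1)]) (simp add: e)
  moreover have "\<epsilon> (t [^] k) = 0" using k(2) by (subst (asm) H) simp
  ultimately show False using k(1) t(2) by simp
qed

context group
begin

lemma normal_in_subgroup_iff:
  assumes C: "subgroup C G" and B: "subgroup B G"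
  shows "B \<lhd> G\<lparr>carrier := C\<rparr> \<longleftrightarrow> B \<subseteq> C \<and> (\<forall>c\<in>C. \<forall>b\<in>B. c \<otimes> b \<otimes> inv c \<in> B)"
proof -
  interpret C: group "G\<lparr>carrier := C\<rparr>" by (rule subgroup_imp_group[OF C])
  have "B \<lhd> G\<lparr>carrier := C\<rparr> \<longleftrightarrow> subgroup B (G\<lparr>carrier := C\<rparr>) \<and> (\<forall>c\<in>C. \<forall>b\<in>B. c \<otimes> b \<otimes> inv c \<in> B)"
    unfolding C.normal_inv_iff using m_inv_consistent[OF C] by simp
  also have "subgroup B (G\<lparr>carrier := C\<rparr>) \<longleftrightarrow> B \<subseteq> C"
    using subgroup_incl[OF B C] subgroup.subset[of B "G\<lparr>carrier := C\<rparr>"] by auto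
  finally show ?thesis .
qed

lemma periodic_factor_subgroup_iff:
  assumes "subgroup C G" "B \<lhd> G\<lparr>carrier := C\<rparr>"
  shows "periodic_group (G\<lparr>carrier := C\<rparr> Mod B) \<longleftrightarrow> (\<forall>c\<in>C. \<exists>k>0. c [^] (k::nat) \<in> B)"
  using normal.periodic_factor_iff[OF assms(2)] by (simp add: nat_pow_consistent[symmetric])

text \<open>The top term is left free, so that a chain can be lengthened one factor at a
  time.\<close>

definition finite_rank_chain :: "nat \<Rightarrow> (nat \<Rightarrow> 'a set) \<Rightarrow> bool" where
  "finite_rank_chain l H \<longleftrightarrow> H 0 = {\<one>} \<and> (\<forall>i\<le>l. subgroup (H i) G) \<and>
     (\<forall>i<l. H i \<lhd> G\<lparr>carrier := H (Suc i)\<rparr> \<and>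
        (periodic_group (series_factor G H i) \<or> infinite_cyclic_group (series_factor G H i)))"

lemma finite_rank_chain_snoc:
  assumes H: "finite_rank_chain l H" and C: "subgroup C G" "H l \<lhd> G\<lparr>carrier := C\<rparr>"
    and f: "periodic_group (G\<lparr>carrier := C\<rparr> Mod H l) \<or> infinite_cyclic_group (G\<lparr>carrier := C\<rparr> Mod H l)"
  shows "finite_rank_chain (Suc l) (H(Suc l := C))"
    and "card {i. i < Suc l \<and> infinite_cyclic_group (series_factor G (H(Suc l := C)) i)} =
      card {i. i < l \<and> infinite_cyclic_group (series_factor G H i)} +
      (if infinite_cyclic_group (G\<lparr>carrier := C\<rparr> Mod H l) then 1 else 0)"
proof -
  let ?H = "H(Suc l := C)"
  have sf: "series_factor G ?H i = series_factor G H i" if "i < l" for i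
    using that unfolding series_factor_def by simp
  have sfl: "series_factor G ?H l = G\<lparr>carrier := C\<rparr> Mod H l" unfolding series_factor_def by simp
  show "finite_rank_chain (Suc l) ?H"
    using H C f sf sfl unfolding finite_rank_chain_def by (auto simp: less_Suc_eq le_Suc_eq)
  have "{i. i < Suc l \<and> infinite_cyclic_group (series_factor G ?H i)} =
     {i. i < l \<and> infinite_cyclic_group (series_factor G H i)} \<union>
     (if infinite_cyclic_group (G\<lparr>carrier := C\<rparr> Mod H l) then {l} else {})"
    using sf sfl by (auto simp: less_Suc_eq)
  then show "card {i. i < Suc l \<and> infinite_cyclic_group (series_factor G ?H i)} =
      card {i. i < l \<and> infinite_cyclic_group (series_factor G H i)} +
      (if infinite_cyclic_group (G\<lparr>carrier := C\<rparr> Mod H l) then 1 else 0)"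
    by (subst \<open>_ = _ \<union> _\<close>) (simp add: card_Un_disjoint)
qed

lemma ser_imp_chain:
  assumes "ser A B h" "A = {\<one>}"
  shows "\<exists>l H. finite_rank_chain l H \<and> H l = B \<and>
     card {i. i < l \<and> infinite_cyclic_group (series_factor G H i)} \<le> h"
  using assms
proof (induction rule: ser.induct)
  case (base A)
  have "finite_rank_chain 0 (\<lambda>_. A)" using base unfolding finite_rank_chain_def by simp
  then show ?case by (intro exI[of _ 0] exI[of _ "\<lambda>_. A"]) simp
next
  case (per A B h C)
  then obtain l H where H: "finite_rank_chain l H" "H l = B"
    "card {i. i < l \<and> infinite_cyclic_group (series_factor G H i)} \<le> h" by metis
  have B: "subgroup B G" using H(1,2) unfolding finite_rank_chain_def by auto
  have n: "B \<lhd> G\<lparr>carrier := C\<rparr>" unfolding normal_in_subgroup_iff[OF per.hyps(2) B] using per.hyps(3,4) by simp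
  have p: "periodic_group (G\<lparr>carrier := C\<rparr> Mod B)"
    unfolding periodic_factor_subgroup_iff[OF per.hyps(2) n] using per.hyps(5) by simp
  then have np: "\<not> infinite_cyclic_group (G\<lparr>carrier := C\<rparr> Mod B)"
    using normal.not_periodic_and_infinite_cyclic[OF n] by metis
  show ?case using finite_rank_chain_snoc[OF H(1) per.hyps(2)] n p np H(2,3)
    by (intro exI[of _ "Suc l"] exI[of _ "H(Suc l := C)"]) (simp del: fun_upd_apply add: fun_upd_same)
next
  case (cyc A B h C \<epsilon> t)
  then obtain l H where H: "finite_rank_chain l H" "H l = B"
    "card {i. i < l \<and> infinite_cyclic_group (series_factor G H i)} \<le> h" by metis
  have B: "subgroup B G" using H(1,2) unfolding finite_rank_chain_def by auto
  have eC: "\<epsilon> (c \<otimes> b \<otimes> inv c) = \<epsilon> b" if "c \<in> C" "b \<in> C" for c b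
    using that cyc.hyps(3) additive_inv[OF cyc.hyps(2,3)] subgroup.m_closed[OF cyc.hyps(2)]
      subgroup.m_inv_closed[OF cyc.hyps(2)] by simp
  have n: "B \<lhd> G\<lparr>carrier := C\<rparr>" unfolding normal_in_subgroup_iff[OF cyc.hyps(2) B]
    using cyc.hyps(4) eC subgroup.m_closed[OF cyc.hyps(2)] subgroup.m_inv_closed[OF cyc.hyps(2)] by simp
  have p: "infinite_cyclic_group (G\<lparr>carrier := C\<rparr> Mod B)"
    by (rule normal.infinite_cyclic_factorI[OF n, where \<epsilon> = \<epsilon> and t = t]) (use cyc.hyps in simp_all)
  show ?case using finite_rank_chain_snoc[OF H(1) cyc.hyps(2)] n p H(2,3)
    by (intro exI[of _ "Suc l"] exI[of _ "H(Suc l := C)"]) (simp del: fun_upd_apply add: fun_upd_same)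
qed

lemma chain_imp_ser:
  assumes "finite_rank_chain l H" "i \<le> l"
  shows "ser {\<one>} (H i) (card {j. j < i \<and> infinite_cyclic_group (series_factor G H j)})"
  using assms(2)
proof (induction i)
  case 0
  have "ser {\<one>} {\<one>} 0" by (rule ser.base[OF triv_subgroup])
  then show ?case using assms(1) unfolding finite_rank_chain_def by simp
next
  case (Suc i)
  let ?c = "\<lambda>i. card {j. j < i \<and> infinite_cyclic_group (series_factor G H j)}"
  let ?Q = "series_factor G H i"
  have sg: "subgroup (H (Suc i)) G" "subgroup (H i) G" and n: "H i \<lhd> G\<lparr>carrier := H (Suc i)\<rparr>"
    and f: "periodic_group ?Q \<or> infinite_cyclic_group ?Q"
    using assms(1) Suc.prems unfolding finite_rank_chain_def by auto
  have IH: "ser {\<one>} (H i) (?c i)" using Suc by simp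
  have "{j. j < Suc i \<and> infinite_cyclic_group (series_factor G H j)} =
     {j. j < i \<and> infinite_cyclic_group (series_factor G H j)} \<union> (if infinite_cyclic_group ?Q then {i} else {})"
    by (auto simp: less_Suc_eq)
  then have c: "?c (Suc i) = ?c i + (if infinite_cyclic_group ?Q then 1 else 0)"
    by (simp add: card_Un_disjoint)
  have Q: "?Q = G\<lparr>carrier := H (Suc i)\<rparr> Mod H i" unfolding series_factor_def ..
  have sub: "H i \<subseteq> H (Suc i)" and conj: "\<And>c b. c \<in> H (Suc i) \<Longrightarrow> b \<in> H i \<Longrightarrow> c \<otimes> b \<otimes> inv c \<in> H i"
    using n unfolding normal_in_subgroup_iff[OF sg] by auto
  show ?case
  proof (cases "infinite_cyclic_group ?Q")
    case True
    then obtain \<epsilon> :: "'a \<Rightarrow> int" and t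
      where e: "\<forall>x\<in>H (Suc i). \<forall>y\<in>H (Suc i). \<epsilon> (x \<otimes> y) = \<epsilon> x + \<epsilon> y"
        and Hi: "H i = {x \<in> H (Suc i). \<epsilon> x = 0}" and t: "t \<in> H (Suc i)" "\<epsilon> t = 1"
      using normal.infinite_cyclic_factorD[OF n] unfolding Q partial_object.simps monoid.simps by auto
    have "ser {\<one>} (H (Suc i)) (Suc (?c i))" by (rule ser.cyc[OF IH sg(1) _ Hi t]) (simp add: e)
    then show ?thesis using c True by simp
  next
    case False
    then have "periodic_group ?Q" using f by simp
    then have "\<And>c. c \<in> H (Suc i) \<Longrightarrow> \<exists>k>0. c [^] (k::nat) \<in> H i"
      unfolding Q periodic_factor_subgroup_iff[OF sg(1) n] by simp
    from ser.per[OF IH sg(1) sub conj this] show ?thesis using c False by simp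
  qed
qed

text \<open>An infinite cyclic factor is not periodic, so its index is among those counted in
  \<open>ser_chain_bound\<close>.\<close>

lemma chain_count_le:
  assumes S: "ser {\<one>} (carrier G) h" and H: "finite_rank_chain l H" "H l = carrier G"
  shows "card {j. j < l \<and> infinite_cyclic_group (series_factor G H j)} \<le> h"
proof -
  have sg: "subgroup (H i) G" if "i \<le> l" for i using H that unfolding finite_rank_chain_def by simp
  have n: "H i \<lhd> G\<lparr>carrier := H (Suc i)\<rparr>" if "i < l" for i using H that unfolding finite_rank_chain_def by simp
  have n': "H i \<subseteq> H (Suc i)" "\<And>c b. c \<in> H (Suc i) \<Longrightarrow> b \<in> H i \<Longrightarrow> c \<otimes> b \<otimes> inv c \<in> H i" if "i < l" for i
    using n[OF that] unfolding normal_in_subgroup_iff[OF sg[OF Suc_leI[OF that]] sg[OF less_imp_le[OF that]]]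
    by simp_all
  have "{j. j < l \<and> infinite_cyclic_group (series_factor G H j)} \<subseteq>
    {j. j < l \<and> (\<exists>y \<in> H (Suc j). \<forall>k>0. y [^] (k::nat) \<notin> H j)}"
  proof clarify
    fix j assume j: "j < l" "infinite_cyclic_group (series_factor G H j)"
    then have "\<not> periodic_group (series_factor G H j)"
      using normal.not_periodic_and_infinite_cyclic[OF n[OF j(1)]] unfolding series_factor_def by metis
    then show "\<exists>y \<in> H (Suc j). \<forall>k>0. y [^] (k::nat) \<notin> H j"
      unfolding series_factor_def periodic_factor_subgroup_iff[OF sg[OF Suc_leI[OF j(1)]] n[OF j(1)]] by metis
  qed
  then have "card {j. j < l \<and> infinite_cyclic_group (series_factor G H j)} \<le>
    card {j. j < l \<and> (\<exists>y \<in> H (Suc j). \<forall>k>0. y [^] (k::nat) \<notin> H j)}"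
    by (rule card_mono[rotated]) simp
  also have "\<dots> \<le> h"
    by (rule ser_chain_bound[OF S sg]) (use H n' in \<open>auto simp: finite_rank_chain_def\<close>)
  finally show ?thesis .
qed

lemma torsion_free_rank_series_iff:
  "torsion_free_rank_series G l H \<longleftrightarrow> finite_rank_chain l H \<and> H l = carrier G"
  unfolding torsion_free_rank_series_def subnormal_series_def finite_rank_chain_def by auto

text \<open>\<open>THE\<close> demands that all series have the same count.
  \<open>chain_imp_ser\<close> turns a series into a \<open>ser\<close> with exactly its own count,
  and \<open>chain_count_le\<close> then compares two series in both directions.\<close>

theorem hirsch_number_le:
  assumes "ser {\<one>} (carrier G) h"
  shows "has_finite_torsion_free_rank G" "hirsch_number G \<le> h"
proof -
  obtain l H where H: "finite_rank_chain l H" "H l = carrier G"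
    "card {i. i < l \<and> infinite_cyclic_group (series_factor G H i)} \<le> h"
    using ser_imp_chain[OF assms] by auto
  then show "has_finite_torsion_free_rank G"
    unfolding has_finite_torsion_free_rank_def torsion_free_rank_series_iff by auto
  let ?c = "card {i. i < l \<and> infinite_cyclic_group (series_factor G H i)}"
  have "ser {\<one>} (carrier G) ?c" using chain_imp_ser[OF H(1), of l] H(2) by simp
  note le1 = chain_count_le[OF this]
  have "hirsch_number G = ?c" unfolding hirsch_number_def torsion_free_rank_series_iff
  proof (rule the_equality)
    show "\<exists>l' H'. (finite_rank_chain l' H' \<and> H' l' = carrier G) \<and>
       ?c = card {i. i < l' \<and> infinite_cyclic_group (series_factor G H' i)}"
      using H(1,2) by metis
  next
    fix h' assume "\<exists>l' H'. (finite_rank_chain l' H' \<and> H' l' = carrier G) \<and>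
       h' = card {i. i < l' \<and> infinite_cyclic_group (series_factor G H' i)}"
    then obtain l' H' where H': "finite_rank_chain l' H'" "H' l' = carrier G"
       "h' = card {i. i < l' \<and> infinite_cyclic_group (series_factor G H' i)}" by metis
    have "ser {\<one>} (carrier G) h'" using chain_imp_ser[OF H'(1), of l'] H'(2,3) by simp
    from chain_count_le[OF this H(1,2)] le1[OF H'(1,2)] H'(3) show "h' = ?c" by simp
  qed
  then show "hirsch_number G \<le> h" using H(3) by simp
qed

end

section \<open>Discrete abelian factors\<close>

context group
begin

text \<open>All powers of \<open>x\<close> lie in the box of radius 0, so two of them share a label
  \<open>\<kappa>\<close> and a positive power of \<open>x\<close> lies in \<open>A\<close>; by
  \<open>tf\<close> so does \<open>x\<close>.\<close>

lemma discrete_kernel: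
  fixes \<phi> :: "nat \<Rightarrow> 'a \<Rightarrow> real" and \<kappa> :: "'a \<Rightarrow> 'k"
  assumes B: "subgroup B G" and A: "subgroup A G"
    and add: "\<And>i x y. i < s \<Longrightarrow> x \<in> B \<Longrightarrow> y \<in> B \<Longrightarrow> \<phi> i (x \<otimes> y) = \<phi> i x + \<phi> i y"
    and tf: "\<And>x k. x \<in> B \<Longrightarrow> k > 0 \<Longrightarrow> x [^] (k::nat) \<in> A \<Longrightarrow> x \<in> A"
    and \<kappa>: "\<And>x y. x \<in> B \<Longrightarrow> y \<in> B \<Longrightarrow> \<kappa> x = \<kappa> y \<Longrightarrow> x \<otimes> inv y \<in> A"
    and fin: "\<And>c. finite (\<kappa> ` {x \<in> B. \<forall>i<s. \<bar>\<phi> i x\<bar> \<le> c})"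
    and x: "x \<in> B" "\<And>i. i < s \<Longrightarrow> \<phi> i x = 0"
  shows "x \<in> A"
proof -
  have xG: "x \<in> carrier G" using x B subgroup.mem_carrier by metis
  have pB: "x [^] k \<in> B" for k :: nat by (rule subgroup_nat_pow_closed[OF B x(1)])
  have "\<phi> i (x [^] k) = 0" if "i < s" for i and k :: nat
    using additive_nat_pow[OF B add[OF that] x(1), of k] x(2)[OF that] by simp
  then have "range (\<lambda>k::nat. \<kappa> (x [^] k)) \<subseteq> \<kappa> ` {x \<in> B. \<forall>i<s. \<bar>\<phi> i x\<bar> \<le> 0}"
    using pB by auto
  then have "finite (range (\<lambda>k::nat. \<kappa> (x [^] k)))" by (rule finite_subset[OF _ fin])
  then have "\<not> inj (\<lambda>k::nat. \<kappa> (x [^] k))" using range_inj_infinite[of "\<lambda>k::nat. \<kappa> (x [^] k)"] by (rule_tac notI) simp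
  then obtain i j :: nat where ij: "\<kappa> (x [^] i) = \<kappa> (x [^] j)" "i \<noteq> j" unfolding inj_def by auto
  then have "\<exists>i j :: nat. i < j \<and> \<kappa> (x [^] j) = \<kappa> (x [^] i)"
    by (metis linorder_neqE_nat)
  then obtain i j :: nat where ij: "i < j" "\<kappa> (x [^] j) = \<kappa> (x [^] i)" by blast
  have "x [^] j \<otimes> inv (x [^] i) \<in> A" by (rule \<kappa>[OF pB pB ij(2)])
  moreover have "x [^] j = x [^] (j - i) \<otimes> x [^] i" using ij(1) xG by (simp add: nat_pow_mult)
  ultimately have "x [^] (j - i) \<in> A" using xG by (simp add: m_assoc)
  then show "x \<in> A" using tf[OF x(1), of "j - i"] ij(1) by simp
qed

text \<open>Presents \<open>B\<close> modulo \<open>A\<close> as a torsion-free discrete subgroup of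
  real \<open>s\<close>-space: \<open>\<phi>\<close> gives coordinates, \<open>\<kappa>\<close>
  labels that determine the coset of \<open>A\<close>, and each box meets finitely many labels.
  Coordinates and labels are separate because logarithms of absolute values forget
  arguments.\<close>

definition discrete_mod :: "nat \<Rightarrow> 'a set \<Rightarrow> 'a set \<Rightarrow> (nat \<Rightarrow> 'a \<Rightarrow> real) \<Rightarrow> ('a \<Rightarrow> 'k) \<Rightarrow> bool" where
  "discrete_mod s A B \<phi> \<kappa> \<longleftrightarrow> subgroup A G \<and> A \<subseteq> B \<and>
     (\<forall>i<s. \<forall>x\<in>B. \<forall>y\<in>B. \<phi> i (x \<otimes> y) = \<phi> i x + \<phi> i y) \<and>
     (\<forall>i<s. \<forall>x\<in>A. \<phi> i x = 0) \<and>
     (\<forall>x\<in>B. \<forall>k>0. x [^] (k::nat) \<in> A \<longrightarrow> x \<in> A) \<and>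
     (\<forall>x\<in>B. \<forall>y\<in>B. \<kappa> x = \<kappa> y \<longrightarrow> x \<otimes> inv y \<in> A) \<and>
     (\<forall>c. finite (\<kappa> ` {x \<in> B. \<forall>i<s. \<bar>\<phi> i x\<bar> \<le> c}))"

lemma discrete_modD:
  assumes "discrete_mod s A B \<phi> \<kappa>"
  shows "subgroup A G" "A \<subseteq> B"
    "\<And>i x y. i < s \<Longrightarrow> x \<in> B \<Longrightarrow> y \<in> B \<Longrightarrow> \<phi> i (x \<otimes> y) = \<phi> i x + \<phi> i y"
    "\<And>i x. i < s \<Longrightarrow> x \<in> A \<Longrightarrow> \<phi> i x = 0"
    "\<And>x k. x \<in> B \<Longrightarrow> k > 0 \<Longrightarrow> x [^] (k::nat) \<in> A \<Longrightarrow> x \<in> A"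
    "\<And>x y. x \<in> B \<Longrightarrow> y \<in> B \<Longrightarrow> \<kappa> x = \<kappa> y \<Longrightarrow> x \<otimes> inv y \<in> A"
    "\<And>c. finite (\<kappa> ` {x \<in> B. \<forall>i<s. \<bar>\<phi> i x\<bar> \<le> c})"
  using assms unfolding discrete_mod_def by simp_all

text \<open>Splits off the line through the image of \<open>a\<close>. The elements mapped into this
  line form \<open>A'\<close>, which is infinite cyclic modulo \<open>A\<close>, and what remains
  above \<open>A'\<close> is discrete in one dimension less.\<close>

lemma discrete_rank_step:
  fixes \<phi> :: "nat \<Rightarrow> 'a \<Rightarrow> real" and \<kappa> :: "'a \<Rightarrow> 'k"
  assumes B: "subgroup B G" and D: "discrete_mod (Suc s) A B \<phi> \<kappa>" and a: "a \<in> B" "\<phi> s a \<noteq> 0"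
  shows "\<exists>A' \<psi>. \<exists>\<kappa>' :: 'a \<Rightarrow> 'k. \<exists>t. ser A A' 1 \<and> t \<in> B \<and> A' \<subseteq> generate G (insert t A) \<and> discrete_mod s A' B \<psi> \<kappa>'"
proof -
  note A = discrete_modD(1)[OF D] and AB = discrete_modD(2)[OF D] and add = discrete_modD(3)[OF D]
    and ker = discrete_modD(4)[OF D] and tf = discrete_modD(5)[OF D] and \<kappa> = discrete_modD(6)[OF D]
    and fin = discrete_modD(7)[OF D]
  note mB = subgroup.m_closed[OF B] and iB = subgroup.m_inv_closed[OF B] and pB = subgroup_int_pow_closed[OF B]
  \<comment> \<open>Slopes of the projection along the image of \<open>a\<close>: with them
    \<open>\<psi> i a = 0\<close>, and the last coordinate is eliminated.\<close>
  define r where "r i = \<phi> i a / \<phi> s a" for i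
  define \<psi> where "\<psi> i x = \<phi> i x - r i * \<phi> s x" for i x
  define A' where "A' = {x \<in> B. \<forall>i<s. \<psi> i x = 0}"
  define R where "R = (\<Sum>i<Suc s. \<bar>r i\<bar>)"
  have rR: "\<bar>r i\<bar> \<le> R" if "i < Suc s" for i
    unfolding R_def using that by (intro member_le_sum) auto
  have R0: "0 \<le> R" unfolding R_def by (simp add: sum_nonneg)
  have \<psi>add: "\<psi> i (x \<otimes> y) = \<psi> i x + \<psi> i y" if "i < s" "x \<in> B" "y \<in> B" for i x y
    using that add[of i x y] add[of s x y] unfolding \<psi>_def by (simp add: algebra_simps)
  have \<psi>inv: "\<psi> i (inv x) = - \<psi> i x" if "i < s" "x \<in> B" for i x
    by (rule additive_inv[OF B \<psi>add[OF that(1)] that(2)])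
  have \<phi>inv: "\<phi> i (inv x) = - \<phi> i x" if "i < Suc s" "x \<in> B" for i x
    by (rule additive_inv[OF B add[OF that(1)] that(2)])
  have \<phi>pow: "\<phi> i (x [^] (n::int)) = of_int n * \<phi> i x" if "i < Suc s" "x \<in> B" for i x n
    by (rule additive_int_pow[OF B add[OF that(1)] that(2)])
  have \<psi>pow: "\<psi> i (x [^] (n::int)) = of_int n * \<psi> i x" if "i < s" "x \<in> B" for i x n
    by (rule additive_int_pow[OF B \<psi>add[OF that(1)] that(2)])
  have one: "\<one> \<in> B" "\<And>i. i < s \<Longrightarrow> \<psi> i \<one> = 0"
    using subgroup.one_closed[OF B] additive_one[OF B, of "\<psi> _"] \<psi>add by auto
  have A'B: "A' \<subseteq> B" unfolding A'_def by auto
  have sA': "subgroup A' G"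
  proof (rule subgroupI)
    show "A' \<subseteq> carrier G" using A'B subgroup.subset[OF B] by simp
    show "A' \<noteq> {}" using one unfolding A'_def by auto
  qed (auto simp: A'_def mB iB \<psi>add \<psi>inv)
  have AA': "A \<subseteq> A'" using AB ker unfolding A'_def \<psi>_def by auto
  have aA': "a \<in> A'" using a unfolding A'_def \<psi>_def r_def by auto
  have A'\<phi>: "\<phi> i x = r i * \<phi> s x" if "x \<in> A'" "i < Suc s" for x i
    using that a(2) unfolding A'_def \<psi>_def r_def by (cases "i = s") auto
  define M where "M = \<bar>\<phi> s a\<bar>"
  have M0: "M > 0" using a unfolding M_def by simp
  \<comment> \<open>\<open>P\<close> contains \<open>a\<close> or its inverse. On \<open>A'\<close>
    the last coordinate controls all others through \<open>r\<close>, so \<open>P\<close> lies in a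
    box and its last coordinates form a finite set, which has a minimum.\<close>
  define P where "P = {x \<in> A'. 0 < \<phi> s x \<and> \<phi> s x \<le> M}"
  have PB: "P \<subseteq> {x \<in> B. \<forall>i<Suc s. \<bar>\<phi> i x\<bar> \<le> R * M}"
  proof
    fix x assume x: "x \<in> P"
    have "\<bar>\<phi> i x\<bar> \<le> R * M" if "i < Suc s" for i
    proof -
      have "\<bar>\<phi> i x\<bar> = \<bar>r i\<bar> * \<bar>\<phi> s x\<bar>" using A'\<phi>[OF _ that, of x] x unfolding P_def by (simp add: abs_mult)
      also have "\<dots> \<le> R * M" using rR[OF that] R0 x unfolding P_def by (intro mult_mono) auto
      finally show ?thesis .
    qed
    then show "x \<in> {x \<in> B. \<forall>i<Suc s. \<bar>\<phi> i x\<bar> \<le> R * M}" using x A'B unfolding P_def by auto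
  qed
  have "finite (\<kappa> ` P)" by (rule finite_subset[OF image_mono[OF PB] fin])
  moreover have same: "\<phi> i x = \<phi> i y" if "x \<in> B" "y \<in> B" "\<kappa> x = \<kappa> y" "i < Suc s" for i x y
    using ker[OF that(4) \<kappa>[OF that(1-3)]] add[OF that(4) that(1) iB[OF that(2)]] \<phi>inv[OF that(4,2)] by simp
  have "\<phi> s ` P \<subseteq> (\<lambda>k. \<phi> s (SOME y. y \<in> P \<and> \<kappa> y = k)) ` (\<kappa> ` P)"
  proof (rule image_subsetI)
    fix x assume x: "x \<in> P"
    let ?y = "SOME y. y \<in> P \<and> \<kappa> y = \<kappa> x"
    have "?y \<in> P \<and> \<kappa> ?y = \<kappa> x" by (rule someI[of "\<lambda>y. y \<in> P \<and> \<kappa> y = \<kappa> x" x]) (use x in simp)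
    then have "\<phi> s x = \<phi> s ?y" using same[of x ?y s] x PB by auto
    then show "\<phi> s x \<in> (\<lambda>k. \<phi> s (SOME y. y \<in> P \<and> \<kappa> y = k)) ` (\<kappa> ` P)" using x by auto
  qed
  ultimately have finP: "finite (\<phi> s ` P)" using finite_surj by blast
  have "a \<in> P \<or> inv a \<in> P"
    using aA' a subgroup.m_inv_closed[OF sA' aA'] \<phi>inv[of s a] unfolding P_def M_def by auto
  then have "\<phi> s ` P \<noteq> {}" by auto
  then obtain t where t: "t \<in> P" "\<phi> s t = Min (\<phi> s ` P)" using Min_in[OF finP] by force
  define g where "g = \<phi> s t"
  have g0: "g > 0" and gM: "g \<le> M" and tA': "t \<in> A'" using t unfolding g_def P_def by auto
  have tB: "t \<in> B" using tA' A'B by auto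
  have gmin: "\<phi> s x \<ge> g" if "x \<in> A'" "\<phi> s x > 0" for x
    using that gM Min_le[OF finP, of "\<phi> s x"] t(2) unfolding P_def g_def by (cases "\<phi> s x \<le> M") auto
  define n where "n x = \<lfloor>\<phi> s x / g\<rfloor>" for x
  \<comment> \<open>Removes the power of \<open>t\<close> that brings the last coordinate into the
    interval from 0 (included) to \<open>g\<close> (excluded); on \<open>A'\<close> the minimality
    of \<open>g\<close> then forces it to be 0.\<close>
  define red where "red x = x \<otimes> t [^] (- n x)" for x
  have redB: "red x \<in> B" if "x \<in> B" for x unfolding red_def using that mB pB[OF tB] by simp
  have red\<phi>: "\<phi> i (red x) = \<phi> i x - of_int (n x) * \<phi> i t" if "x \<in> B" "i < Suc s" for x i
    unfolding red_def using add[OF that(2,1) pB[OF tB]] \<phi>pow[OF that(2) tB] by simp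
  have red\<psi>: "\<psi> i (red x) = \<psi> i x" if "x \<in> B" "i < s" for x i
    unfolding red_def using \<psi>add[OF that(2,1) pB[OF tB]] \<psi>pow[OF that(2) tB] tA' that(2) unfolding A'_def by simp
  have redb: "0 \<le> \<phi> s (red x) \<and> \<phi> s (red x) < g" if "x \<in> B" for x
  proof -
    have "of_int (n x) \<le> \<phi> s x / g" "\<phi> s x / g < of_int (n x) + 1" unfolding n_def by linarith+
    then have "of_int (n x) * g \<le> \<phi> s x" "\<phi> s x < (of_int (n x) + 1) * g"
      using g0 by (simp_all add: pos_le_divide_eq pos_divide_less_eq)
    then show ?thesis using red\<phi>[OF that, of s] unfolding g_def by (simp add: algebra_simps)
  qed
  have redA': "red x \<in> A'" if "x \<in> A'" for x
    using that redB red\<psi> unfolding A'_def by auto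
  have red0: "\<phi> s (red x) = 0" if "x \<in> A'" for x
    using gmin[OF redA'[OF that]] redb[of x] that A'B by force
  have redA: "red x \<in> A" if "x \<in> A'" for x
  proof (rule discrete_kernel[OF B A add tf \<kappa> fin])
    show "red x \<in> B" using that redB A'B by auto
    show "\<phi> i (red x) = 0" if "i < Suc s" for i using A'\<phi>[OF redA' that] red0 \<open>x \<in> A'\<close> by simp
  qed
  have n\<phi>: "\<phi> s x = of_int (n x) * g" if "x \<in> A'" for x
    using red0[OF that] red\<phi>[of x s] that A'B unfolding g_def by auto
  have nadd: "n (x \<otimes> y) = n x + n y" if "x \<in> A'" "y \<in> A'" for x y
  proof -
    have "of_int (n (x \<otimes> y)) * g = of_int (n x + n y) * g"
      using n\<phi>[OF that(1)] n\<phi>[OF that(2)] n\<phi>[OF subgroup.m_closed[OF sA' that]] add[of s x y] that A'B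
      by (auto simp: algebra_simps)
    then show ?thesis using g0 by (simp del: of_int_add)
  qed
  have tG: "t \<in> carrier G" using tB subgroup.mem_carrier[OF B] by simp
  have xred: "x = red x \<otimes> t [^] (n x)" if "x \<in> B" for x
    using subgroup.mem_carrier[OF B that] tG unfolding red_def by (simp add: m_assoc int_pow_neg)
  have "ser A A' (Suc 0)"
  proof (rule ser.cyc[OF ser.base[OF A] sA', where \<epsilon> = n and t = t])
    show "A = {x \<in> A'. n x = 0}"
    proof (intro equalityI subsetI)
      fix x assume "x \<in> A" then show "x \<in> {x \<in> A'. n x = 0}" using ker[of s x] AA' unfolding n_def by auto
    next
      fix x assume x: "x \<in> {x \<in> A'. n x = 0}"
      then have "x = red x" using xred[of x] A'B subgroup.mem_carrier[OF B redB, of x] by auto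
      then show "x \<in> A" using redA[of x] x by simp
    qed
    show "n t = 1" unfolding n_def g_def[symmetric] using g0 by simp
  qed (use nadd tA' in auto)
  then have ser: "ser A A' 1" by simp
  have gen: "A' \<subseteq> generate G (insert t A)"
  proof
    fix x assume x: "x \<in> A'"
    have "insert t A \<subseteq> carrier G" using tG subgroup.subset[OF A] by simp
    then have sg: "subgroup (generate G (insert t A)) G" by (rule generate_is_subgroup)
    have "t [^] n x \<in> generate G (insert t A)"
      by (rule subgroup_int_pow_closed[OF sg]) (simp add: generate.incl)
    moreover have "red x \<in> generate G (insert t A)" using redA[OF x] by (simp add: generate.incl)
    ultimately have "red x \<otimes> t [^] n x \<in> generate G (insert t A)" using subgroup.m_closed[OF sg] by simp
    then show "x \<in> generate G (insert t A)" using xred[of x] x A'B by auto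
  qed
  have tf': "x \<in> A'" if "x \<in> B" "k > 0" "x [^] (k::nat) \<in> A'" for x k
  proof -
    have "\<psi> i x = 0" if i: "i < s" for i
      using additive_nat_pow[OF B \<psi>add[OF i] \<open>x \<in> B\<close>, of k] \<open>x [^] k \<in> A'\<close> \<open>k > 0\<close> i unfolding A'_def by simp
    then show ?thesis using that unfolding A'_def by simp
  qed
  have \<kappa>': "x \<otimes> inv y \<in> A'" if "x \<in> B" "y \<in> B" "\<kappa> (red x) = \<kappa> (red y)" for x y
  proof -
    have "\<psi> i (red x) = \<psi> i (red y)" if i: "i < s" for i
      using same[OF redB redB, of x y i] same[OF redB redB, of x y s] i \<open>x \<in> B\<close> \<open>y \<in> B\<close> \<open>\<kappa> (red x) = _\<close>
      unfolding \<psi>_def by simp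
    then show ?thesis using that red\<psi> \<psi>add \<psi>inv mB iB unfolding A'_def by simp
  qed
  \<comment> \<open>The new label is that of the reduced element: its last coordinate is below
    \<open>g\<close>, so a box for \<open>\<psi>\<close> bounds all coordinates
    \<open>\<phi>\<close> of the reduced element.\<close>
  have fin': "finite ((\<lambda>x. \<kappa> (red x)) ` {x \<in> B. \<forall>i<s. \<bar>\<psi> i x\<bar> \<le> c})" for c
  proof (rule finite_subset[OF _ fin])
    show "(\<lambda>x. \<kappa> (red x)) ` {x \<in> B. \<forall>i<s. \<bar>\<psi> i x\<bar> \<le> c} \<subseteq>
       \<kappa> ` {x \<in> B. \<forall>i<Suc s. \<bar>\<phi> i x\<bar> \<le> \<bar>c\<bar> + R * g + g}"
    proof (rule image_subsetI)
      fix x assume x: "x \<in> {x \<in> B. \<forall>i<s. \<bar>\<psi> i x\<bar> \<le> c}"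
      then have xB: "x \<in> B" by simp
      have "\<bar>\<phi> i (red x)\<bar> \<le> \<bar>c\<bar> + R * g + g" if i: "i < Suc s" for i
      proof (cases "i = s")
        case True
        have "0 \<le> R * g" using R0 g0 by simp
        then show ?thesis unfolding True using redb[OF xB] g0 abs_ge_zero[of c] by linarith
      next
        case False
        then have lt: "i < s" using i by simp
        have "\<phi> i (red x) = \<psi> i x + r i * \<phi> s (red x)" using red\<psi>[OF xB lt] unfolding \<psi>_def by simp
        moreover have "\<bar>r i * \<phi> s (red x)\<bar> \<le> R * g"
          unfolding abs_mult using rR[OF i] redb[OF xB] R0 by (intro mult_mono) auto
        moreover have "\<bar>\<psi> i x\<bar> \<le> \<bar>c\<bar>" using x lt by force
        ultimately show ?thesis using g0 by linarith
      qed
      then show "\<kappa> (red x) \<in> \<kappa> ` {x \<in> B. \<forall>i<Suc s. \<bar>\<phi> i x\<bar> \<le> \<bar>c\<bar> + R * g + g}"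
        using redB[OF xB] by blast
    qed
  qed
  have "discrete_mod s A' B \<psi> (\<lambda>x. \<kappa> (red x))"
    unfolding discrete_mod_def
  proof (intro conjI allI ballI impI)
    show "\<psi> i x = 0" if "i < s" "x \<in> A'" for i x using that unfolding A'_def by simp
  qed (fact sA' A'B fin' | rule \<psi>add tf' \<kappa>'; assumption)+
  with ser tB gen show ?thesis by (intro exI[of _ A'] exI[of _ \<psi>] exI[of _ "\<lambda>x. \<kappa> (red x)"] exI[of _ t]) simp
qed

text \<open>Induction on the number of coordinates: a last coordinate that is somewhere nonzero
  yields one infinite cyclic factor, one that vanishes on \<open>B\<close> is dropped without
  any.\<close>

lemma discrete_rank:
  fixes \<phi> :: "nat \<Rightarrow> 'a \<Rightarrow> real" and \<kappa> :: "'a \<Rightarrow> 'k"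
  assumes B: "subgroup B G" and D: "discrete_mod s A B \<phi> \<kappa>"
  shows "(\<exists>h\<le>s. ser A B h) \<and> (\<exists>S. S \<subseteq> B \<and> finite S \<and> card S \<le> s \<and> B \<subseteq> generate G (A \<union> S))"
  using D
proof (induction s arbitrary: A \<phi> \<kappa>)
  case 0
  note D = discrete_modD[OF 0]
  have "x \<in> A" if "x \<in> B" for x
    by (rule discrete_kernel[OF B D(1,3,5,6,7)]) (use that in auto)
  then have AB: "A = B" using D(2) by auto
  then have "ser A B 0" using ser.base[OF B] by simp
  moreover have "B \<subseteq> generate G (A \<union> {})" using AB by (auto intro: generate.incl)
  ultimately show ?case by (intro conjI exI[of _ "0::nat"] exI[of _ "{}"]) auto
next
  case (Suc s)
  note D = discrete_modD[OF Suc.prems]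
  show ?case
  proof (cases "\<exists>a\<in>B. \<phi> s a \<noteq> 0")
    case True
    then obtain a where a: "a \<in> B" "\<phi> s a \<noteq> 0" by auto
    from discrete_rank_step[OF B Suc.prems a]
    obtain A' \<psi> and \<kappa>' :: "'a \<Rightarrow> 'k" and t where A': "ser A A' 1" "t \<in> B" "A' \<subseteq> generate G (insert t A)"
      and D': "discrete_mod s A' B \<psi> \<kappa>'"
      by (elim exE conjE) (rule that)
    obtain h S where h: "h \<le> s" "ser A' B h" and S: "S \<subseteq> B" "finite S" "card S \<le> s" "B \<subseteq> generate G (A' \<union> S)"
      using Suc.IH[OF D'] by (elim exE conjE) (rule that)
    have "ser A B (1 + h)" by (rule ser_trans[OF h(2) A'(1)])
    then have "\<exists>h\<le>Suc s. ser A B h" using h(1) by (intro exI[of _ "1 + h"]) simp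
    moreover have "B \<subseteq> generate G (A \<union> insert t S)"
    proof -
      have "A \<union> insert t S \<subseteq> carrier G" using D(2) A'(2) S(1) subgroup.subset[OF B] by auto
      then have sg: "subgroup (generate G (A \<union> insert t S)) G" by (rule generate_is_subgroup)
      have "generate G (insert t A) \<subseteq> generate G (A \<union> insert t S)" by (rule mono_generate) auto
      then have "A' \<union> S \<subseteq> generate G (A \<union> insert t S)" using A'(3) by (auto intro: generate.incl)
      from generate_subgroup_incl[OF this sg] S(4) show ?thesis by simp
    qed
    moreover have "card (insert t S) \<le> Suc s" using S by (simp add: card_insert_if)
    ultimately show ?thesis using S A'(2) by (intro conjI exI[of _ "insert t S"]) auto
  next
    case False
    have eq: "{x \<in> B. \<forall>i<s. \<bar>\<phi> i x\<bar> \<le> c} \<subseteq> {x \<in> B. \<forall>i<Suc s. \<bar>\<phi> i x\<bar> \<le> \<bar>c\<bar>}" for c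
      using False by (force simp: less_Suc_eq)
    have "finite (\<kappa> ` {x \<in> B. \<forall>i<s. \<bar>\<phi> i x\<bar> \<le> c})" for c
      by (rule finite_subset[OF image_mono[OF eq] D(7)])
    then have "discrete_mod s A B \<phi> \<kappa>" using D(1-6) unfolding discrete_mod_def by simp
    then have "(\<exists>h\<le>s. ser A B h) \<and> (\<exists>S. S \<subseteq> B \<and> finite S \<and> card S \<le> s \<and> B \<subseteq> generate G (A \<union> S))"
      by (rule Suc.IH)
    then show ?thesis by (meson le_Suc_eq)
  qed
qed

text \<open>Discreteness is inherited by \<open>H\<close> modulo \<open>H \<inter> A\<close> for
  every subgroup \<open>H\<close> of \<open>B\<close>, so the number of generators found for
  \<open>B\<close> bounds the relative rank.\<close>

lemma discrete_relgen:
  fixes \<phi> :: "nat \<Rightarrow> 'a \<Rightarrow> real" and \<kappa> :: "'a \<Rightarrow> 'k"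
  assumes B: "subgroup B G" and D: "discrete_mod s A B \<phi> \<kappa>"
  shows "relgen A B s"
  unfolding relgen_def
proof (intro allI impI)
  fix H assume H: "subgroup H G \<and> H \<subseteq> B"
  then have H: "subgroup H G" and HB: "\<And>x. x \<in> H \<Longrightarrow> x \<in> B" by auto
  note D' = discrete_modD[OF D]
  have sHA: "subgroup (H \<inter> A) G" by (rule subgroups_Inter_pair[OF H D'(1)])
  have fin': "finite (\<kappa> ` {x \<in> H. \<forall>i<s. \<bar>\<phi> i x\<bar> \<le> c})" for c
    by (rule finite_subset[OF _ D'(7)[of c]]) (use HB in auto)
  have "discrete_mod s (H \<inter> A) H \<phi> \<kappa>"
    unfolding discrete_mod_def
  proof (intro conjI allI ballI impI)
    show "x \<otimes> inv y \<in> H \<inter> A" if "x \<in> H" "y \<in> H" "\<kappa> x = \<kappa> y" for x y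
      using D'(6)[OF HB[OF that(1)] HB[OF that(2)] that(3)]
        subgroup.m_closed[OF H that(1) subgroup.m_inv_closed[OF H that(2)]] by simp
    show "x \<in> H \<inter> A" if "x \<in> H" "0 < k" "x [^] (k::nat) \<in> H \<inter> A" for x k
      using D'(5)[OF HB[OF that(1)] that(2)] that by simp
    show "\<phi> i (x \<otimes> y) = \<phi> i x + \<phi> i y" if "i < s" "x \<in> H" "y \<in> H" for i x y
      by (rule D'(3)[OF that(1) HB[OF that(2)] HB[OF that(3)]])
    show "\<phi> i x = 0" if "i < s" "x \<in> H \<inter> A" for i x using D'(4) that by simp
  qed (use sHA fin' in simp_all)
  from discrete_rank[OF H this, THEN conjunct2]
  show "\<exists>S\<subseteq>H. finite S \<and> card S \<le> s \<and> H \<subseteq> generate G (H \<inter> A \<union> S)" .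
qed

end

section \<open>The order of the general linear group over three elements\<close>

lemma size_prime_factorization_mult:
  fixes a b :: nat
  assumes "a \<noteq> 0" "b \<noteq> 0"
  shows "size (prime_factorization (a * b)) = size (prime_factorization a) + size (prime_factorization b)"
  using assms by (simp add: prime_factorization_mult)

lemma power_size_prime_factorization_le:
  fixes n c :: nat
  assumes "n \<noteq> 0" "\<And>p. prime p \<Longrightarrow> p dvd n \<Longrightarrow> c \<le> p"
  shows "c ^ size (prime_factorization n) \<le> n"
proof -
  have "c ^ size A \<le> prod_mset A" if "\<And>p. p \<in># A \<Longrightarrow> c \<le> p" for A :: "nat multiset"
    using that by (induction A) (auto intro!: mult_mono)
  from this[of "prime_factorization n"] show ?thesis using assms
    by (simp add: prod_mset_prime_factorization_nat in_prime_factors_iff)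
qed

lemma prime_factors_ge_5:
  fixes n p :: nat
  assumes "odd n" "\<not> 3 dvd n" "prime p" "p dvd n"
  shows "5 \<le> p"
proof (rule ccontr)
  assume "\<not> 5 \<le> p"
  then have "p \<in> {0, 1, 2, 3, 4}" by auto
  moreover have "\<not> prime (4::nat)" using prime_nat_iff[of 4] by (auto intro!: exI[of _ 2])
  ultimately show False using assms by auto
qed

lemma size_prime_factorization_less:
  fixes n j :: nat
  assumes "odd n" "\<not> 3 dvd n" "n < 5 ^ j"
  shows "size (prime_factorization n) < j"
proof -
  have "n \<noteq> 0" using assms(1) by (cases n) auto
  then have "5 ^ size (prime_factorization n) \<le> n"
    by (rule power_size_prime_factorization_le) (use prime_factors_ge_5 assms in blast)
  then have "(5::nat) ^ size (prime_factorization n) < 5 ^ j" using assms(3) by linarith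
  then show ?thesis by simp
qed

lemma size_prime_factorization_two_power_mult:
  fixes b :: nat
  assumes "b \<noteq> 0"
  shows "size (prime_factorization (2 ^ k * b)) = k + size (prime_factorization b)"
  using assms by (simp add: size_prime_factorization_mult prime_factorization_prime_power)

lemma three_power_mod_8: "(3::nat) ^ j mod 8 = (if even j then 1 else 3)"
proof (induction j)
  case (Suc j)
  have "(3::nat) ^ Suc j mod 8 = 3 * (3 ^ j mod 8) mod 8" by (simp add: mod_mult_right_eq)
  then show ?case using Suc by simp
qed simp

text \<open>Once the powers of 2 are split off, all remaining primes are at least 5, and a number
  below 5 ^ j has fewer than j of those. Residues modulo 8 give the exact power of 2: one factor in
  3 ^ i - 1 for odd i, and one or two in 3 ^ j + 1 for even or odd j. Even exponents are halved by
  (3 ^ j - 1) * (3 ^ j + 1).\<close>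

lemma size_prime_factorization_three_power_diff:
  assumes "i > 0"
  shows "size (prime_factorization (3 ^ i - 1 :: nat)) \<le> i + (if even i then 1 else 0)"
  using assms
proof (induction i rule: less_induct)
  case (less i)
  have lt: "(3::nat) ^ j < 5 ^ j" if "j > 0" for j using that by (simp add: power_strict_mono)
  have n3: "\<not> 3 dvd (3 ^ j + 1 :: nat)" if "j > 0" for j
    using that by (metis One_nat_def dvd_add_right_iff dvd_power nat_dvd_1_iff_1 numeral_eq_one_iff semiring_norm(86))
  have plus: "size (prime_factorization (3 ^ j + 1 :: nat)) \<le> j + (if even j then 0 else 1)" if "j > 0" for j
  proof (cases "even j")
    case True
    have "(3 ^ j + 1 :: nat) mod 8 = 2" using three_power_mod_8[of j] True by presburger
    then obtain b :: nat where b: "3 ^ j + 1 = 2 ^ 1 * b" "odd b"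
      by (intro that[of "(3 ^ j + 1) div 2"]) (simp, presburger+)
    have "\<not> 3 dvd b" using n3[OF that] b(1) by (metis dvd_mult)
    moreover have "b < 5 ^ j" using lt[OF that] b(1) by simp
    ultimately have "size (prime_factorization b) < j" using size_prime_factorization_less b(2) by blast
    moreover have "b \<noteq> 0" using b(2) by (cases b) auto
    ultimately show ?thesis unfolding b(1) by (subst size_prime_factorization_two_power_mult) (use True in auto)
  next
    case False
    have "(3 ^ j + 1 :: nat) mod 8 = 4" using three_power_mod_8[of j] False by presburger
    then obtain b :: nat where b: "3 ^ j + 1 = 2 ^ 2 * b" "odd b"
      by (intro that[of "(3 ^ j + 1) div 4"]) (simp, presburger+)
    have "\<not> 3 dvd b" using n3[OF that] b(1) by (metis dvd_mult)
    moreover have "b < 5 ^ j" using lt[OF that] b(1) by simp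
    ultimately have "size (prime_factorization b) < j" using size_prime_factorization_less b(2) by blast
    moreover have "b \<noteq> 0" using b(2) by (cases b) auto
    ultimately show ?thesis unfolding b(1) by (subst size_prime_factorization_two_power_mult) (use False in auto)
  qed
  show ?case
  proof (cases "even i")
    case False
    have "(3 ^ i :: nat) mod 8 = 3" using three_power_mod_8[of i] False by simp
    moreover have pos: "(3 ^ i :: nat) \<ge> 3" using less.prems by (metis One_nat_def Suc_leI one_le_numeral power_increasing power_one_right)
    ultimately obtain b :: nat where b: "3 ^ i - 1 = 2 ^ 1 * b" "odd b"
      by (intro that[of "(3 ^ i - 1) div 2"]) (simp, presburger+)
    have "3 ^ i = 2 * b + 1" using b pos by simp
    have "\<not> 3 dvd b"
    proof
      assume "3 dvd b"
      then have "3 dvd 2 * b + 1" using \<open>3 ^ i = 2 * b + 1\<close>[symmetric] less.prems by (simp add: dvd_power)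
      then show False using \<open>3 dvd b\<close> by presburger
    qed
    moreover have "b < 5 ^ i" using lt[OF less.prems] \<open>3 ^ i = 2 * b + 1\<close> by simp
    ultimately have "size (prime_factorization b) < i" using size_prime_factorization_less b(2) by blast
    moreover have "b \<noteq> 0" using b(2) by (cases b) auto
    ultimately show ?thesis unfolding b(1) by (subst size_prime_factorization_two_power_mult) auto
  next
    case True
    then obtain j where j: "i = 2 * j" by auto
    then have j0: "0 < j" "j < i" using less.prems by auto
    have "(3 ^ i - 1 :: nat) = (3 ^ j - 1) * (3 ^ j + 1)"
      unfolding j by (simp add: algebra_simps power_mult power2_eq_square power_mult_distrib)
    moreover have "(3 ^ j - 1 :: nat) \<noteq> 0" using j0 one_less_power[of "3::nat" j] by simp
    ultimately have "size (prime_factorization (3 ^ i - 1 :: nat)) =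
       size (prime_factorization (3 ^ j - 1 :: nat)) + size (prime_factorization (3 ^ j + 1 :: nat))"
      by (simp only:) (rule size_prime_factorization_mult, simp_all)
    \<comment> \<open>Exactly one of the two parity terms is 1, whatever the parity of
      \<open>j\<close>.\<close>
    also have "\<dots> \<le> (j + (if even j then 1 else 0)) + (j + (if even j then 0 else 1))"
      by (rule add_mono[OF less.IH[OF j0(2,1)] plus[OF j0(1)]])
    finally show ?thesis using True j by (simp split: if_splits)
  qed
qed

text \<open>The product for \<open>Suc e\<close> is (3 ^ Suc e - 1) * 3 ^ e times the product for
  \<open>e\<close>. The extra prime factor is conceded only when \<open>Suc e\<close> is even, which
  produces the term \<open>e div 2\<close>.\<close>

lemma size_prime_factorization_GL3:
  "size (prime_factorization (\<Prod>i<e. 3 ^ e - 3 ^ i :: nat)) \<le> e * e + e div 2 \<and> (\<Prod>i<e. 3 ^ e - 3 ^ i :: nat) \<noteq> 0"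
proof (induction e)
  case (Suc e)
  let ?P = "\<lambda>e. (\<Prod>i<e. 3 ^ e - 3 ^ i :: nat)"
  have "?P (Suc e) = (3 ^ Suc e - 1) * (\<Prod>i<e. 3 ^ Suc e - 3 ^ Suc i)"
    by (subst prod.lessThan_Suc_shift) simp
  also have "(\<Prod>i<e. 3 ^ Suc e - 3 ^ Suc i :: nat) = (\<Prod>i<e. 3 * (3 ^ e - 3 ^ i))"
    by (intro prod.cong) (simp_all add: diff_mult_distrib2)
  also have "\<dots> = 3 ^ e * ?P e" by (simp add: prod.distrib)
  finally have eq: "?P (Suc e) = (3 ^ Suc e - 1) * (3 ^ e * ?P e)" .
  have nz: "(3 ^ Suc e - 1 :: nat) \<noteq> 0" using one_less_power[of "3::nat" "Suc e"] by simp
  have "size (prime_factorization (?P (Suc e))) =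
      size (prime_factorization (3 ^ Suc e - 1 :: nat)) + (e + size (prime_factorization (?P e)))"
    unfolding eq using nz Suc by (simp add: size_prime_factorization_mult prime_factorization_prime_power)
  also have "\<dots> \<le> (Suc e + (if even (Suc e) then 1 else 0)) + (e + (e * e + e div 2))"
    using size_prime_factorization_three_power_diff[of "Suc e"] Suc by (intro add_mono) auto
  also have "\<dots> = Suc e * Suc e + Suc e div 2" by (auto elim!: evenE oddE)
  finally show ?case unfolding eq using nz Suc by simp
qed simp

text \<open>A concrete field of order three: its axioms are finite case checks, and every nonzero
  element is its own inverse.\<close>

datatype f3 = F0 | F1 | F2

lemma UNIV_f3: "(UNIV :: f3 set) = {F0, F1, F2}"
  using f3.exhaust by auto

instantiation f3 :: "{field, finite}"
begin
definition "zero_f3 = F0"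
definition "one_f3 = F1"
fun plus_f3 where
  "F0 + x = (x :: f3)" | "x + F0 = x" | "F1 + F1 = F2" | "F1 + F2 = F0" | "F2 + F1 = F0" | "F2 + F2 = F1"
fun uminus_f3 where "- F0 = F0" | "- F1 = F2" | "- F2 = F1"
definition "minus_f3 (x :: f3) y = x + - y"
fun times_f3 where
  "F0 * x = F0" | "F1 * x = (x :: f3)" | "F2 * F0 = F0" | "F2 * F1 = F2" | "F2 * F2 = F1"
definition "inverse_f3 (x :: f3) = x"
definition "divide_f3 (x :: f3) y = x * y"
instance
proof
  fix a b c :: f3
  show "a * b * c = a * (b * c)" by (cases a; cases b; cases c) simp_all
  show "a * b = b * a" by (cases a; cases b) simp_all
  show "a + b + c = a + (b + c)" by (cases a; cases b; cases c) simp_all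
  show "a + b = b + a" by (cases a; cases b) simp_all
  show "(a + b) * c = a * c + b * c" by (cases a; cases b; cases c) simp_all
  show "1 * a = a" "0 + a = a" "- a + a = 0" unfolding one_f3_def zero_f3_def by (cases a; simp)+
  show "a - b = a + - b" by (simp add: minus_f3_def)
  show "a \<noteq> 0 \<Longrightarrow> inverse a * a = 1" unfolding one_f3_def zero_f3_def inverse_f3_def by (cases a) simp_all
  show "a div b = a * inverse b" by (simp add: divide_f3_def inverse_f3_def)
  show "inverse (0::f3) = 0" by (simp add: inverse_f3_def)
  show "(0::f3) \<noteq> 1" by (simp add: zero_f3_def one_f3_def)
  show "finite (UNIV :: f3 set)" unfolding UNIV_f3 by simp
qed
end

lemma card_f3: "card (UNIV :: f3 set) = 3"
  unfolding UNIV_f3 by simp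

lemma of_int_f3_eq_0_iff: "(of_int x :: f3) = 0 \<longleftrightarrow> 3 dvd x"
proof -
  have 2: "(1 :: f3) + 1 \<noteq> 0" and "(1 :: f3) + 1 + 1 = 0" unfolding one_f3_def zero_f3_def by simp_all
  then have 3: "(of_int 3 :: f3) = 0" by simp
  have "x = 3 * (x div 3) + x mod 3" by simp
  then have "(of_int x :: f3) = of_int 3 * of_int (x div 3) + of_int (x mod 3)" by (metis of_int_add of_int_mult)
  then have eq: "(of_int x :: f3) = of_int (x mod 3)" unfolding 3 by simp
  have "x mod 3 = 0 \<or> x mod 3 = 1 \<or> x mod 3 = 2" by presburger
  moreover have "(of_int 2 :: f3) \<noteq> 0" using 2 by simp
  ultimately show ?thesis unfolding eq dvd_eq_mod_eq_0 by auto
qed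

section \<open>Counting invertible matrices over a finite field\<close>

lemma mat_of_cols_Cons_mult_vCons:
  fixes v :: "'f :: comm_ring_1 vec"
  assumes "v \<in> carrier_vec n" "w \<in> carrier_vec (length vs)"
  shows "mat_of_cols n (v # vs) *\<^sub>v vCons a w = a \<cdot>\<^sub>v v + mat_of_cols n vs *\<^sub>v w"
proof (rule eq_vecI)
  fix i assume "i < dim_vec (a \<cdot>\<^sub>v v + mat_of_cols n vs *\<^sub>v w)"
  then have i: "i < n" by simp
  have "row (mat_of_cols n (v # vs)) i = vCons (v $ i) (row (mat_of_cols n vs) i)"
    by (rule eq_vecI) (auto simp: vec_index_vCons mat_of_cols_index i)
  then show "(mat_of_cols n (v # vs) *\<^sub>v vCons a w) $ i = (a \<cdot>\<^sub>v v + mat_of_cols n vs *\<^sub>v w) $ i"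
    using i assms by (simp add: mult.commute)
qed (use assms in simp)

lemma card_carrier_vec: "card (carrier_vec n :: 'f :: finite vec set) = card (UNIV :: 'f set) ^ n"
proof -
  have "bij_betw list_of_vec (carrier_vec n) {xs :: 'f list. set xs \<subseteq> UNIV \<and> length xs = n}"
    by (rule bij_betwI[where g = vec_of_list]) (auto simp: vec_list list_vec intro: carrier_vecI)
  then show ?thesis using bij_betw_same_card card_lists_length_eq[of "UNIV :: 'f set" n] by fastforce
qed

lemma finite_carrier_vec: "finite (carrier_vec n :: 'f :: finite vec set)"
proof (rule card_ge_0_finite)
  show "0 < card (carrier_vec n :: 'f vec set)" unfolding card_carrier_vec by (simp add: card_gt_0_iff)
qed

text \<open>Linear independence of columns, phrased as a trivial kernel so that it matches the
  criterion for a nonzero determinant.\<close>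

definition col_indep :: "nat \<Rightarrow> 'f :: field vec list \<Rightarrow> bool" where
  "col_indep n xs \<longleftrightarrow> (\<forall>w \<in> carrier_vec (length xs). mat_of_cols n xs *\<^sub>v w = 0\<^sub>v n \<longrightarrow> w = 0\<^sub>v (length xs))"

lemma col_indep_Cons:
  fixes x :: "'f :: field vec"
  assumes x: "x \<in> carrier_vec n"
  shows "col_indep n (x # xs) \<longleftrightarrow> col_indep n xs \<and> x \<notin> (\<lambda>w. mat_of_cols n xs *\<^sub>v w) ` carrier_vec (length xs)"
    (is "_ \<longleftrightarrow> _ \<and> x \<notin> ?M ` ?V")
proof -
  have M: "?M w \<in> carrier_vec n" if "w \<in> ?V" for w using mult_mat_vec_carrier[OF mat_of_cols_carrier(1) that] .
  have cons: "mat_of_cols n (x # xs) *\<^sub>v vCons a w = a \<cdot>\<^sub>v x + ?M w" if "w \<in> ?V" for a w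
    using mat_of_cols_Cons_mult_vCons[OF x that] .
  show ?thesis
  proof
    assume I: "col_indep n (x # xs)"
    have I': "a = 0 \<and> w = 0\<^sub>v (length xs)" if "w \<in> ?V" "a \<cdot>\<^sub>v x + ?M w = 0\<^sub>v n" for a w
    proof -
      have "mat_of_cols n (x # xs) *\<^sub>v vCons a w = 0\<^sub>v n" using cons[OF that(1), of a] that(2) by simp
      moreover have "vCons a w \<in> carrier_vec (length (x # xs))" using that(1) by simp
      ultimately have "vCons a w = 0\<^sub>v (length (x # xs))" using I unfolding col_indep_def by blast
      then show ?thesis by (simp add: zero_vec_Suc)
    qed
    have "col_indep n xs" unfolding col_indep_def
    proof (intro ballI impI)
      fix w assume w: "w \<in> ?V" "?M w = 0\<^sub>v n"
      then have "0 \<cdot>\<^sub>v x + ?M w = 0\<^sub>v n" using x by auto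
      then show "w = 0\<^sub>v (length xs)" using I' w by blast
    qed
    moreover have "x \<notin> ?M ` ?V"
    proof
      assume "x \<in> ?M ` ?V"
      then obtain w where w: "w \<in> ?V" "x = ?M w" by auto
      have "(-1) \<cdot>\<^sub>v x + ?M w = 0\<^sub>v n" unfolding w(2)[symmetric] using x by (intro eq_vecI) auto
      then show False using I'[OF w(1)] by force
    qed
    ultimately show "col_indep n xs \<and> x \<notin> ?M ` ?V" by simp
  next
    assume I: "col_indep n xs \<and> x \<notin> ?M ` ?V"
    show "col_indep n (x # xs)" unfolding col_indep_def
    proof (intro ballI impI)
      fix u assume u: "u \<in> carrier_vec (length (x # xs))" "mat_of_cols n (x # xs) *\<^sub>v u = 0\<^sub>v n"
      obtain a w where aw: "u = vCons a w" using u(1) by (cases u) auto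
      then have w: "w \<in> ?V" using u(1) by simp
      have 0: "a \<cdot>\<^sub>v x + ?M w = 0\<^sub>v n" using u(2) cons[OF w] aw by simp
      have "a = 0"
      proof (rule ccontr)
        assume a: "a \<noteq> 0"
        have x_eq: "x = ?M ((- inverse a) \<cdot>\<^sub>v w)"
        proof -
          have "?M ((- inverse a) \<cdot>\<^sub>v w) = (- inverse a) \<cdot>\<^sub>v ?M w" using w by (intro mult_mat_vec) auto
          also have "\<dots> = x"
          proof (rule eq_vecI)
            fix i assume i: "i < dim_vec x"
            have "(a \<cdot>\<^sub>v x + ?M w) $ i = 0" using 0 i x by simp
            then have "?M w $ i = - (a * x $ i)" using i x by (simp add: eq_neg_iff_add_eq_0 add.commute)
            moreover have "((- inverse a) \<cdot>\<^sub>v ?M w) $ i = (- inverse a) * (?M w $ i)"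
              using i x by (subst index_smult_vec) auto
            ultimately show "((- inverse a) \<cdot>\<^sub>v ?M w) $ i = x $ i" using a by simp
          qed (use x in auto)
          finally show ?thesis by simp
        qed
        have "x \<in> ?M ` ?V" by (rule image_eqI[where f = ?M, OF x_eq]) (use w in simp)
        then show False using I by simp
      qed
      moreover have "0 \<cdot>\<^sub>v x = 0\<^sub>v n" using x by (intro eq_vecI) auto
      ultimately have "?M w = 0\<^sub>v n" using 0 M[OF w] by simp
      then have "w = 0\<^sub>v (length xs)" using I w unfolding col_indep_def by blast
      then show "u = 0\<^sub>v (length (x # xs))" using aw \<open>a = 0\<close> by (simp add: zero_vec_Suc)
    qed
  qed
qed

lemma card_col_range:
  fixes xs :: "'f :: {field, finite} vec list"
  assumes "col_indep n xs"
  shows "card ((\<lambda>w. mat_of_cols n xs *\<^sub>v w) ` carrier_vec (length xs)) = card (UNIV :: 'f set) ^ length xs"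
proof -
  have "inj_on (\<lambda>w. mat_of_cols n xs *\<^sub>v w) (carrier_vec (length xs))"
  proof (rule inj_onI)
    fix u w :: "'f vec" assume u: "u \<in> carrier_vec (length xs)" and w: "w \<in> carrier_vec (length xs)"
      and eq: "mat_of_cols n xs *\<^sub>v u = mat_of_cols n xs *\<^sub>v w"
    have "mat_of_cols n xs *\<^sub>v (u - w) = 0\<^sub>v n"
      using eq u w by (subst mult_minus_distrib_mat_vec[of _ n "length xs"]) auto
    then have "u - w = 0\<^sub>v (length xs)" using assms u w unfolding col_indep_def by auto
    then have "(u - w) $ i = 0" if "i < length xs" for i using that by simp
    then show "u = w" using u w by (intro eq_vecI) auto
  qed
  then show ?thesis by (simp add: card_image card_carrier_vec)
qed

text \<open>The columns are chosen one by one: the next one must avoid the span of the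
  \<open>k\<close> earlier ones, which by independence has exactly \<open>card UNIV ^ k\<close>
  elements.\<close>

lemma card_col_indep:
  assumes "k \<le> n"
  shows "card {xs :: 'f :: {field, finite} vec list. set xs \<subseteq> carrier_vec n \<and> length xs = k \<and> col_indep n xs} =
     (\<Prod>i<k. card (UNIV :: 'f set) ^ n - card (UNIV :: 'f set) ^ i)"
  using assms
proof (induction k)
  case 0
  have "col_indep n ([] :: 'f vec list)" unfolding col_indep_def by auto
  then have "{xs :: 'f vec list. set xs \<subseteq> carrier_vec n \<and> length xs = 0 \<and> col_indep n xs} = {[]}" by auto
  then show ?case by simp
next
  case (Suc k)
  let ?T = "\<lambda>k. {xs :: 'f vec list. set xs \<subseteq> carrier_vec n \<and> length xs = k \<and> col_indep n xs}"
  let ?R = "\<lambda>xs :: 'f vec list. (\<lambda>w. mat_of_cols n xs *\<^sub>v w) ` carrier_vec (length xs)"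
  have fin: "finite (?T k)" for k
    by (rule finite_subset[OF _ finite_lists_length_eq[OF finite_carrier_vec, of n k]]) auto
  have RV: "?R xs \<subseteq> carrier_vec n" for xs
    using mult_mat_vec_carrier[OF mat_of_cols_carrier(1)] by blast
  have "?T (Suc k) = (\<lambda>(xs, x). x # xs) ` (SIGMA xs:?T k. carrier_vec n - ?R xs)"
  proof (intro equalityI subsetI)
    fix ys assume ys: "ys \<in> ?T (Suc k)"
    then obtain x xs where y: "ys = x # xs" by (cases ys) auto
    then have "(xs, x) \<in> (SIGMA xs:?T k. carrier_vec n - ?R xs)" using ys by (auto simp: col_indep_Cons)
    then show "ys \<in> (\<lambda>(xs, x). x # xs) ` (SIGMA xs:?T k. carrier_vec n - ?R xs)" using y by force
  qed (auto simp: col_indep_Cons)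
  then have "card (?T (Suc k)) = card (SIGMA xs:?T k. carrier_vec n - ?R xs)"
    by (simp add: card_image inj_on_def)
  also have "\<dots> = (\<Sum>xs\<in>?T k. card (carrier_vec n - ?R xs))"
    using fin finite_carrier_vec by (intro card_SigmaI) auto
  also have "\<dots> = (\<Sum>xs\<in>?T k. card (UNIV :: 'f set) ^ n - card (UNIV :: 'f set) ^ k)"
  proof (rule sum.cong[OF refl])
    fix xs assume "xs \<in> ?T k"
    then have "card (?R xs) = card (UNIV :: 'f set) ^ k" using card_col_range[of n xs] by simp
    then show "card (carrier_vec n - ?R xs) = card (UNIV :: 'f set) ^ n - card (UNIV :: 'f set) ^ k"
      using card_Diff_subset[OF finite_subset[OF RV finite_carrier_vec] RV, of xs] by (simp add: card_carrier_vec)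
  qed
  also have "\<dots> = (\<Prod>i<Suc k. card (UNIV :: 'f set) ^ n - card (UNIV :: 'f set) ^ i)" using Suc by simp
  finally show ?case .
qed

lemma card_invertible_mat:
  "card {A \<in> carrier_mat n n. det A \<noteq> (0 :: 'f :: {field, finite})} = (\<Prod>i<n. card (UNIV :: 'f set) ^ n - card (UNIV :: 'f set) ^ i)"
proof -
  have eq: "col_indep n (cols A) \<longleftrightarrow> det A \<noteq> 0" if "A \<in> carrier_mat n n" for A :: "'f mat"
    unfolding col_indep_def det_0_iff_vec_prod_zero_field[OF that] using that mat_of_cols_cols[of A] by auto
  have "bij_betw cols {A \<in> carrier_mat n n. det A \<noteq> (0 :: 'f)}
      {xs. set xs \<subseteq> carrier_vec n \<and> length xs = n \<and> col_indep n xs}"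
  proof (rule bij_betwI[where g = "mat_of_cols n"])
    show "mat_of_cols n \<in> {xs. set xs \<subseteq> carrier_vec n \<and> length xs = n \<and> col_indep n xs} \<rightarrow>
       {A \<in> carrier_mat n n. det A \<noteq> (0 :: 'f)}"
    proof (rule funcsetI)
      fix xs :: "'f vec list" assume xs: "xs \<in> {xs. set xs \<subseteq> carrier_vec n \<and> length xs = n \<and> col_indep n xs}"
      then have A: "mat_of_cols n xs \<in> carrier_mat n n" "cols (mat_of_cols n xs) = xs" by auto
      then show "mat_of_cols n xs \<in> {A \<in> carrier_mat n n. det A \<noteq> 0}" using eq[OF A(1)] xs by simp
    qed
    show "cols \<in> {A \<in> carrier_mat n n. det A \<noteq> (0 :: 'f)} \<rightarrow>
       {xs. set xs \<subseteq> carrier_vec n \<and> length xs = n \<and> col_indep n xs}"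
      using eq cols_dim by (intro funcsetI) fastforce
  qed auto
  then show ?thesis using bij_betw_same_card card_col_indep[OF order_refl, of n, where 'f='f] by fastforce
qed

section \<open>General linear groups as unit groups\<close>

lemma GL_UNIV_eq: "GL n (UNIV :: 'k :: comm_ring_1 set) = units_of (ring_mat TYPE('k) n ())"
proof -
  have "ring_mat TYPE('k) n () \<lparr>carrier := {A \<in> carrier_mat n n. elements_mat A \<subseteq> UNIV}\<rparr> = ring_mat TYPE('k) n ()"
    by (simp add: ring_mat_def)
  then show ?thesis unfolding GL_def by simp
qed

lemma GL_group: "group (GL n (UNIV :: 'k :: comm_ring_1 set))"
proof -
  interpret ring "ring_mat TYPE('k) n ()" by (rule ring_mat)
  show ?thesis unfolding GL_UNIV_eq by (rule units_group)
qed

lemma GL_mult [simp]: "x \<otimes>\<^bsub>GL n R\<^esub> y = x * y"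
  unfolding GL_def units_of_def ring_mat_def by simp

lemma GL_one [simp]: "\<one>\<^bsub>GL n R\<^esub> = 1\<^sub>m n"
  unfolding GL_def units_of_def ring_mat_def by simp

lemma GL_carrier_mat: "A \<in> carrier (GL n R) \<Longrightarrow> A \<in> carrier_mat n n \<and> elements_mat A \<subseteq> R"
  unfolding GL_def units_of_def Units_def ring_mat_def by simp

lemma GL_UNIV_I:
  assumes "A \<in> carrier_mat n n" "B \<in> carrier_mat n n" "A * B = 1\<^sub>m n" "B * A = 1\<^sub>m n"
  shows "A \<in> carrier (GL n (UNIV :: 'k :: comm_ring_1 set))"
  unfolding GL_UNIV_eq units_of_def Units_def ring_mat_def using assms by auto

lemma GL_field_carrier: "carrier (GL n (UNIV :: 'k :: field set)) = {A \<in> carrier_mat n n. det A \<noteq> 0}"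
proof -
  have "A \<in> carrier_mat n n \<and> det A \<noteq> 0" if "A \<in> Units (ring_mat TYPE('k) n ())" for A
    using that unit_imp_det_non_zero[OF that] unfolding Units_def ring_mat_def by simp
  then show ?thesis unfolding GL_UNIV_eq units_of_def
    using det_non_zero_imp_unit[of _ n, where 'a='k and b = "()"] by auto
qed

lemma GL_f3_finite: "finite (carrier (GL n (UNIV :: f3 set)))"
proof (rule finite_subset)
  show "carrier (GL n (UNIV :: f3 set)) \<subseteq> (\<lambda>xs. mat_of_cols n xs) ` {xs. set xs \<subseteq> carrier_vec n \<and> length xs = n}"
  proof
    fix A assume "A \<in> carrier (GL n (UNIV :: f3 set))"
    then have A: "A \<in> carrier_mat n n" using GL_carrier_mat by blast
    have "A = mat_of_cols n (cols A)" using A mat_of_cols_cols[of A] by auto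
    moreover have "set (cols A) \<subseteq> carrier_vec n" "length (cols A) = n" using A cols_dim[of A] by auto
    ultimately show "A \<in> (\<lambda>xs. mat_of_cols n xs) ` {xs. set xs \<subseteq> carrier_vec n \<and> length xs = n}" by blast
  qed
  show "finite ((\<lambda>xs. mat_of_cols n xs) ` {xs :: f3 vec list. set xs \<subseteq> carrier_vec n \<and> length xs = n})"
    by (intro finite_imageI finite_lists_length_eq finite_carrier_vec)
qed

lemma GL_f3_order: "size (prime_factorization (Coset.order (GL n (UNIV :: f3 set)))) \<le> n * n + n div 2"
proof -
  have "Coset.order (GL n (UNIV :: f3 set)) = (\<Prod>i<n. 3 ^ n - 3 ^ i)"
    unfolding Coset.order_def GL_field_carrier card_invertible_mat card_f3 ..
  then show ?thesis using size_prime_factorization_GL3[of n] by simp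
qed

section \<open>Finitely generated rings of algebraic integers\<close>

inductive_set zspan :: "'a :: ab_group_add set \<Rightarrow> 'a set" for F where
  zero: "0 \<in> zspan F"
| add: "y \<in> zspan F \<Longrightarrow> f \<in> F \<Longrightarrow> y + f \<in> zspan F"
| diff: "y \<in> zspan F \<Longrightarrow> f \<in> F \<Longrightarrow> y - f \<in> zspan F"

lemma zspan_add: "x \<in> zspan F \<Longrightarrow> y \<in> zspan F \<Longrightarrow> y + x \<in> zspan F"
proof (induction rule: zspan.induct)
  case (add x f) then show ?case using zspan.add[of "y + x" F f] by (simp add: add.assoc)
next
  case (diff x f) then show ?case using zspan.diff[of "y + x" F f] by (simp add: add_diff_eq)
qed simp

lemma zspan_sum: "(\<And>i. i \<in> I \<Longrightarrow> f i \<in> zspan F) \<Longrightarrow> sum f I \<in> zspan F"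
  by (induction I rule: infinite_finite_induct) (auto intro: zspan.zero zspan_add)

text \<open>A subring inside a finitely generated additive group. It serves as a common ring of
  integers for finitely many algebraic integers, and on it rational coordinates have bounded
  denominators.\<close>

definition fin_ring :: "'a :: field_char_0 set \<Rightarrow> bool" where
  "fin_ring R \<longleftrightarrow> 1 \<in> R \<and> (\<forall>x\<in>R. \<forall>y\<in>R. x - y \<in> R \<and> x * y \<in> R) \<and> (\<exists>F. finite F \<and> R \<subseteq> zspan F)"

lemma fin_ring_closed:
  assumes "fin_ring R"
  shows fin_ring_zero: "0 \<in> R" and fin_ring_one: "1 \<in> R"
    and fin_ring_diff: "\<And>x y. x \<in> R \<Longrightarrow> y \<in> R \<Longrightarrow> x - y \<in> R"
    and fin_ring_mult: "\<And>x y. x \<in> R \<Longrightarrow> y \<in> R \<Longrightarrow> x * y \<in> R"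
    and fin_ring_uminus: "\<And>x. x \<in> R \<Longrightarrow> - x \<in> R"
    and fin_ring_add: "\<And>x y. x \<in> R \<Longrightarrow> y \<in> R \<Longrightarrow> x + y \<in> R"
proof -
  note R = assms[unfolded fin_ring_def]
  show one: "1 \<in> R" and diff: "\<And>x y. x \<in> R \<Longrightarrow> y \<in> R \<Longrightarrow> x - y \<in> R"
    and "\<And>x y. x \<in> R \<Longrightarrow> y \<in> R \<Longrightarrow> x * y \<in> R" using R by auto
  show zero: "0 \<in> R" using diff[OF one one] by simp
  show um: "- x \<in> R" if "x \<in> R" for x using diff[OF zero that] by simp
  show "x + y \<in> R" if "x \<in> R" "y \<in> R" for x y using diff[OF that(1) um[OF that(2)]] by simp
qed

lemma fin_ring_sum: "fin_ring R \<Longrightarrow> (\<And>i. i \<in> I \<Longrightarrow> f i \<in> R) \<Longrightarrow> sum f I \<in> R"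
  by (induction I rule: infinite_finite_induct) (auto intro: fin_ring_zero fin_ring_add)

lemma fin_ring_of_nat: "fin_ring R \<Longrightarrow> of_nat k \<in> R"
  by (induction k) (auto intro: fin_ring_zero fin_ring_one fin_ring_add)

lemma fin_ring_of_int: "fin_ring R \<Longrightarrow> of_int k \<in> R"
  by (cases k rule: int_cases2) (auto intro: fin_ring_of_nat fin_ring_uminus)

lemma fin_ring_power: "fin_ring R \<Longrightarrow> x \<in> R \<Longrightarrow> x ^ k \<in> R"
  by (induction k) (auto intro: fin_ring_one fin_ring_mult)

lemma fin_ring_Ints: "fin_ring (\<int> :: 'a :: field_char_0 set)"
proof -
  have "of_int k \<in> zspan {1 :: 'a}" for k
  proof (induction k rule: int_induct[where k = 0])
    case (step1 i) then show ?case using zspan.add[of "of_int i" "{1}" 1] by simp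
  next
    case (step2 i) then show ?case using zspan.diff[of "of_int i" "{1}" 1] by simp
  qed (simp add: zspan.zero)
  then have "\<int> \<subseteq> zspan {1 :: 'a}" by (auto elim: Ints_cases)
  then show ?thesis unfolding fin_ring_def by (auto intro: exI[of _ "{1}"])
qed

text \<open>The new ring consists of the combinations of 1, x, ..., x ^ (n - 1) over
  \<open>R\<close>. The monic equation of degree \<open>n\<close> expresses x ^ n through them and
  so gives closure under products; additive generators are the old ones times these powers.\<close>

lemma fin_ring_adjoin:
  fixes x :: "'a :: field_char_0"
  assumes R: "fin_ring R" and x: "algebraic_int x"
  obtains R' where "fin_ring R'" "R \<subseteq> R'" "x \<in> R'"
proof -
  obtain p :: "'a poly" where p: "lead_coeff p = 1" "\<forall>i. Polynomial.coeff p i \<in> \<int>" "poly p x = 0"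
    using x by (auto elim: algebraic_int.cases)
  define n where "n = degree p"
  have n0: "n > 0"
  proof (rule ccontr)
    assume "\<not> n > 0"
    then have "p = 1" using p(1) unfolding n_def by (auto elim: degree_eq_zeroE)
    then show False using p(3) by simp
  qed
  have "(\<Sum>i\<le>n. Polynomial.coeff p i * x ^ i) = 0" using p(3) unfolding poly_altdef n_def .
  moreover have "{..n} = insert n {..<n}" by auto
  ultimately have xn: "x ^ n = (\<Sum>i<n. - Polynomial.coeff p i * x ^ i)"
    using p(1) unfolding n_def by (simp add: sum_negf eq_neg_iff_add_eq_0)
  define R' where "R' = {\<Sum>i<n. r i * x ^ i | r. \<forall>i. r i \<in> R}"
  have R'I: "(\<Sum>i<n. r i * x ^ i) \<in> R'" if "\<And>i. r i \<in> R" for r using that unfolding R'_def by auto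
  have RR': "r \<in> R'" if "r \<in> R" for r
  proof -
    have "(\<Sum>i<n. (if i = 0 then r else 0) * x ^ i) = (\<Sum>i<n. (if i = 0 then r else 0))"
      by (intro sum.cong) auto
    also have "\<dots> = r" using n0 by (simp add: sum.delta)
    finally show ?thesis using R'I[of "\<lambda>i. if i = 0 then r else 0"] that fin_ring_zero[OF R] by auto
  qed
  have diff: "y - z \<in> R'" if yz: "y \<in> R'" "z \<in> R'" for y z
  proof -
    obtain r s where "y = (\<Sum>i<n. r i * x ^ i)" "z = (\<Sum>i<n. s i * x ^ i)" and rs: "\<forall>i. r i \<in> R" "\<forall>i. s i \<in> R"
      using yz unfolding R'_def by blast
    then have "y - z = (\<Sum>i<n. (r i - s i) * x ^ i)" by (simp add: left_diff_distrib sum_subtractf)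
    then show ?thesis using R'I[of "\<lambda>i. r i - s i"] rs fin_ring_diff[OF R] by simp
  qed
  have add: "y + z \<in> R'" if "y \<in> R'" "z \<in> R'" for y z
    using diff[OF that(1) diff[OF RR'[OF fin_ring_zero[OF R]] that(2)]] by simp
  have smult: "c * y \<in> R'" if cy: "c \<in> R" "y \<in> R'" for c y
  proof -
    obtain r where "y = (\<Sum>i<n. r i * x ^ i)" and r: "\<forall>i. r i \<in> R"
      using cy unfolding R'_def by blast
    then have "c * y = (\<Sum>i<n. (c * r i) * x ^ i)" by (simp add: sum_distrib_left mult.assoc)
    then show ?thesis using R'I[of "\<lambda>i. c * r i"] r fin_ring_mult[OF R cy(1)] by simp
  qed
  have sum: "sum f I \<in> R'" if "\<And>i. i \<in> I \<Longrightarrow> f i \<in> R'" for f :: "nat \<Rightarrow> 'a" and I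
    using that by (induction I rule: infinite_finite_induct) (auto intro: add RR' fin_ring_zero[OF R])
  have xpow: "x ^ i \<in> R'" if "i \<le> n" for i
  proof (cases "i < n")
    case True
    have "(\<Sum>j<n. (if j = i then 1 else 0) * x ^ j) = x ^ i"
      using True by (simp add: if_distrib[of "\<lambda>a. a * _"] sum.delta cong: if_cong)
    then show ?thesis using R'I[of "\<lambda>j. if j = i then 1 else 0"] fin_ring_zero[OF R] fin_ring_one[OF R] by auto
  next
    case False
    then have "i = n" using that by simp
    have "- Polynomial.coeff p j \<in> R" for j using p(2) fin_ring_of_int[OF R] fin_ring_uminus[OF R] by (metis Ints_cases)
    then show ?thesis unfolding \<open>i = n\<close> xn by (intro R'I)
  qed
  have multx: "x * y \<in> R'" if y: "y \<in> R'" for y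
  proof -
    obtain r where "y = (\<Sum>i<n. r i * x ^ i)" and r: "\<forall>i. r i \<in> R"
      using y unfolding R'_def by blast
    then have "x * y = (\<Sum>i<n. r i * x ^ Suc i)" by (simp add: sum_distrib_left mult.left_commute)
    moreover have "(\<Sum>i<n. r i * x ^ Suc i) \<in> R'"
    proof (rule sum)
      fix i assume "i \<in> {..<n}"
      then show "r i * x ^ Suc i \<in> R'" using smult[OF r[rule_format] xpow[of "Suc i"]] by simp
    qed
    ultimately show ?thesis by simp
  qed
  have multxpow: "x ^ i * y \<in> R'" if "y \<in> R'" for y i
    using that by (induction i) (auto simp: mult.assoc intro: multx)
  have mult: "z * y \<in> R'" if zy: "z \<in> R'" "y \<in> R'" for y z
  proof -
    obtain r where "z = (\<Sum>i<n. r i * x ^ i)" and r: "\<forall>i. r i \<in> R"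
      using zy(1) unfolding R'_def by blast
    then have "z * y = (\<Sum>i<n. r i * (x ^ i * y))" by (simp add: sum_distrib_right mult.assoc)
    then show ?thesis using r zy(2) by (auto intro!: sum smult multxpow)
  qed
  obtain F where F: "finite F" "R \<subseteq> zspan F" using R unfolding fin_ring_def by auto
  let ?F = "(\<lambda>(f, i). f * x ^ i) ` (F \<times> {..<n})"
  have "r * x ^ i \<in> zspan ?F" if "r \<in> zspan F" "i < n" for r i
    using that(1)
  proof (induction rule: zspan.induct)
    case (add r f)
    then have "f * x ^ i \<in> ?F" using that(2) by auto
    from zspan.add[OF add.IH this] show ?case by (simp add: algebra_simps)
  next
    case (diff r f)
    then have "f * x ^ i \<in> ?F" using that(2) by auto
    from zspan.diff[OF diff.IH this] show ?case by (simp add: algebra_simps)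
  qed (simp add: zspan.zero)
  then have "R' \<subseteq> zspan ?F" using F(2) unfolding R'_def by (auto intro!: zspan_sum)
  moreover have "finite ?F" using F(1) by simp
  ultimately have "fin_ring R'" unfolding fin_ring_def
    using diff mult RR'[OF fin_ring_one[OF R]] by blast
  moreover have "x \<in> R'" using xpow[of 1] n0 by simp
  ultimately show thesis using that RR' by blast
qed

lemma fin_ring_algebraic_ints:
  assumes "finite X" "\<And>x. x \<in> X \<Longrightarrow> algebraic_int x"
  shows "\<exists>R. fin_ring R \<and> X \<subseteq> R"
  using assms
proof (induction X rule: finite_induct)
  case empty then show ?case using fin_ring_Ints by auto
next
  case (insert x X)
  then obtain R where R: "fin_ring R" "X \<subseteq> R" by auto
  obtain R' where "fin_ring R'" "R \<subseteq> R'" "x \<in> R'"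
    by (rule fin_ring_adjoin[OF R(1), of x]) (use insert in auto)
  then show ?case using R by (intro exI[of _ R']) auto
qed

text \<open>Extend \<open>z\<close> to a basis over the rationals and take the coordinate at
  \<open>z\<close>. Such a functional reads off rational information from arbitrary elements of the
  field.\<close>

lemma rat_functional:
  fixes z :: "'a :: field_char_0"
  assumes "z \<noteq> 0"
  shows "\<exists>\<phi> :: 'a \<Rightarrow> rat. (\<forall>x y. \<phi> (x + y) = \<phi> x + \<phi> y) \<and> (\<forall>q x. \<phi> (of_rat q * x) = q * \<phi> x) \<and> \<phi> z = 1"
proof -
  let ?B = "over_rat.extend_basis {z}"
  have i: "over_rat.independent {z}" using assms by (simp add: over_rat.dependent_single)
  have B: "over_rat.independent ?B" "over_rat.span ?B = UNIV" "{z} \<subseteq> ?B"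
    using over_rat.independent_extend_basis[OF i] over_rat.span_extend_basis[OF i] over_rat.extend_basis_superset[OF i] by auto
  let ?\<phi> = "\<lambda>x. over_rat.representation ?B x z"
  show ?thesis
  proof (intro exI[of _ ?\<phi>] conjI allI)
    show "?\<phi> (x + y) = ?\<phi> x + ?\<phi> y" for x y using over_rat.representation_add[OF B(1), of y x] B(2) by simp
    show "?\<phi> (of_rat q * x) = q * ?\<phi> x" for q x using over_rat.representation_scale[OF B(1), of x q] B(2) by simp
    show "?\<phi> z = 1" using over_rat.representation_basis[OF B(1), of z] B(3) by simp
  qed
qed

lemma common_denominator:
  assumes "finite F"
  shows "\<exists>N>0. \<forall>q\<in>F. of_int N * (q :: rat) \<in> \<int>"
  using assms
proof induction
  case empty show ?case by (intro exI[of _ 1]) simp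
next
  case (insert q F)
  then obtain N where N: "N > 0" "\<forall>q\<in>F. of_int N * q \<in> \<int>" by auto
  obtain a b where ab: "q = of_int a / of_int b" "b > 0" by (metis Fract_of_int_quotient Rat_cases)
  have "of_int (b * N) * q = of_int (a * N)" using ab by simp
  then have "of_int (b * N) * q \<in> \<int>" by (simp only: Ints_of_int)
  moreover have "of_int (b * N) * p \<in> \<int>" if "p \<in> F" for p
  proof -
    have "of_int (b * N) * p = of_int b * (of_int N * p)" by simp
    also have "\<dots> \<in> \<int>" by (rule Ints_mult[OF Ints_of_int]) (use N(2) that in simp)
    finally show ?thesis .
  qed
  ultimately show ?case using ab(2) N(1) by (intro exI[of _ "b * N"]) auto
qed

text \<open>A common denominator for the finitely many values on generators works for the whole
  additive span.\<close>

lemma zspan_bounded_denominator: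
  fixes \<phi> :: "'i \<Rightarrow> 'a :: ab_group_add \<Rightarrow> rat"
  assumes add: "\<And>i x y. \<phi> i (x + y) = \<phi> i x + \<phi> i y" and fin: "finite I" "finite F"
  shows "\<exists>N > (0 :: int). \<forall>i \<in> I. \<forall>y \<in> zspan F. of_int N * \<phi> i y \<in> \<int>"
proof -
  obtain N where N: "N > (0::int)" "\<forall>q \<in> (\<lambda>(i, f). \<phi> i f) ` (I \<times> F). of_int N * q \<in> \<int>"
    using common_denominator[of "(\<lambda>(i, f). \<phi> i f) ` (I \<times> F)"] fin by auto
  have \<phi>0: "\<phi> i 0 = 0" for i using add[of i 0 0] by simp
  have \<phi>_diff: "\<phi> i (x - y) = \<phi> i x - \<phi> i y" for i x y using add[of i "x - y" y] by simp
  have "of_int N * \<phi> i y \<in> \<int>" if "y \<in> zspan F" "i \<in> I" for i y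
    using that(1)
  proof (induction rule: zspan.induct)
    case (add x f)
    have "of_int N * \<phi> i f \<in> \<int>" using N(2) that(2) add.hyps by auto
    then show ?case using Ints_add[OF add.IH] by (simp add: assms(1) distrib_left)
  next
    case (diff x f)
    have "of_int N * \<phi> i f \<in> \<int>" using N(2) that(2) diff.hyps by auto
    then show ?case using Ints_diff[OF diff.IH] by (simp add: \<phi>_diff right_diff_distrib)
  qed (simp add: \<phi>0)
  with N(1) show ?thesis by blast
qed

lemma third_eq: "1 = 3 * X \<Longrightarrow> 1 / 3 = (X :: 'a :: field_char_0)"
  by (simp add: divide_eq_eq mult.commute)

text \<open>Otherwise all powers of 1 / 3 would lie in \<open>R\<close>, and a rational functional
  with value 1 at 1 would take the values 1 / 3 ^ k there, against bounded denominators.\<close>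

lemma third_notin_fin_ring:
  assumes "fin_ring (R :: 'a :: field_char_0 set)"
  shows "1 / 3 \<notin> R"
proof
  assume 3: "1 / 3 \<in> R"
  obtain \<phi> :: "'a \<Rightarrow> rat" where \<phi>: "\<forall>x y. \<phi> (x + y) = \<phi> x + \<phi> y" "\<forall>q x. \<phi> (of_rat q * x) = q * \<phi> x" "\<phi> 1 = 1"
    using rat_functional[of "1 :: 'a", OF one_neq_zero] by (elim exE conjE) (rule that)
  obtain F where F: "finite F" "R \<subseteq> zspan F" using assms unfolding fin_ring_def by auto
  obtain N where N: "N > (0::int)" "\<forall>y \<in> zspan F. of_int N * \<phi> y \<in> \<int>"
    using zspan_bounded_denominator[of "\<lambda>_ :: unit. \<phi>" UNIV, OF _ _ F(1)] \<phi>(1) by auto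
  obtain k :: nat where k: "N < 3 ^ k"
    using real_arch_pow[of 3 "of_int N"] by (metis of_int_less_iff of_int_numeral of_int_power one_less_numeral_iff semiring_norm(77))
  have "(1 / 3) ^ k \<in> R" by (rule fin_ring_power[OF assms 3])
  then have "of_int N * \<phi> ((1 / 3) ^ k) \<in> \<int>" using N(2) F(2) by auto
  moreover have "\<phi> ((1 / 3) ^ k) = (1 / 3) ^ k"
    using \<phi>(2)[rule_format, of "(1 / 3) ^ k" 1] \<phi>(3) by (simp add: of_rat_power of_rat_divide)
  ultimately obtain z where z: "of_int N * (1 / 3 :: rat) ^ k = of_int z" by (auto elim: Ints_cases)
  then have "(of_int N :: rat) = of_int (z * 3 ^ k)" by (simp add: power_one_over field_simps)
  then have "N = z * 3 ^ k" by (simp only: of_int_eq_iff)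
  then have "z > 0" using N(1) by (simp add: zero_less_mult_iff)
  then have "z * 3 ^ k \<ge> 3 ^ k" by simp
  then show False using k \<open>N = z * 3 ^ k\<close> by simp
qed

text \<open>The reason why congruence subgroups of level 3 are torsion-free. If 3 divides the
  exponent, the identity (1 + 3 \<delta>) ^ 3 - 1 = 9 \<delta> (1 + 3 (\<delta> + \<delta> ^ 2))
  lowers it; otherwise the first-order term makes the exponent divisible by 3 in \<open>R\<close>.
  Every other outcome puts 1 / 3 into \<open>R\<close>.\<close>

lemma fin_ring_root_of_unity:
  fixes \<gamma> :: "'a :: field_char_0"
  assumes R: "fin_ring R"
  shows "\<gamma> \<in> R \<Longrightarrow> t > 0 \<Longrightarrow> (1 + 3 * \<gamma>) ^ t = 1 \<Longrightarrow> \<gamma> = 0"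
proof (induction t arbitrary: \<gamma> rule: less_induct)
  case (less t)
  note RI = fin_ring_add[OF R] fin_ring_mult[OF R] fin_ring_one[OF R] fin_ring_zero[OF R] fin_ring_of_nat[OF R]
    fin_ring_uminus[OF R]
  have n3: "(3 :: 'a) \<in> R" using fin_ring_of_nat[OF R, of 3] by simp
  \<comment> \<open>Binomial expansion to first order, with the cofactor of the remainder kept in
    \<open>R\<close>.\<close>
  have ex: "\<exists>r\<in>R. (1 + 3 * \<gamma>) ^ k = 1 + of_nat k * (3 * \<gamma>) + 9 * \<gamma>^2 * r" for k
  proof (induction k)
    case 0 show ?case by (rule bexI[OF _ fin_ring_zero[OF R]]) simp
  next
    case (Suc k)
    then obtain r where r: "r \<in> R" "(1 + 3 * \<gamma>) ^ k = 1 + of_nat k * (3 * \<gamma>) + 9 * \<gamma>^2 * r" by auto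
    have "(1 + 3 * \<gamma>) ^ Suc k = 1 + of_nat (Suc k) * (3 * \<gamma>) + 9 * \<gamma>^2 * (of_nat k + r + 3 * \<gamma> * r)"
      unfolding power_Suc r(2) by (simp add: algebra_simps power2_eq_square)
    moreover have "of_nat k + r + 3 * \<gamma> * r \<in> R" using r(1) less.prems(1) n3 by (intro RI)
    ultimately show ?case by blast
  qed
  show ?case
  proof (rule ccontr)
    assume \<gamma>: "\<gamma> \<noteq> 0"
    show False
    proof (cases "3 dvd t")
      case True
      then obtain s where s: "t = 3 * s" by auto
      obtain r where r: "r \<in> R" "(1 + 3 * \<gamma>) ^ s = 1 + of_nat s * (3 * \<gamma>) + 9 * \<gamma>^2 * r" using ex by blast
      define \<delta> where "\<delta> = of_nat s * \<gamma> + 3 * \<gamma>^2 * r"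
      have \<delta>R: "\<delta> \<in> R" unfolding \<delta>_def power2_eq_square using r(1) less.prems(1) n3 by (intro RI)
      have \<delta>: "(1 + 3 * \<gamma>) ^ s = 1 + 3 * \<delta>" unfolding r(2) \<delta>_def by (simp add: algebra_simps)
      then have "(1 + 3 * \<delta>) ^ 3 = 1" using less.prems(3) unfolding s by (simp add: power_mult power_mult[symmetric] mult.commute)
      then have "9 * (\<delta> * (1 + 3 * (\<delta> + \<delta>^2))) = 0"
        by (simp add: power3_eq_cube power2_eq_square algebra_simps)
      then have "\<delta> = 0 \<or> 1 + 3 * (\<delta> + \<delta>^2) = 0" by auto
      moreover have "1 + 3 * (\<delta> + \<delta>^2) \<noteq> 0"
      proof
        assume "1 + 3 * (\<delta> + \<delta>^2) = 0"
        then have "1 = - (3 * (\<delta> + \<delta>^2))" by (rule eq_neg_iff_add_eq_0[THEN iffD2])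
        also have "\<dots> = 3 * - (\<delta> + \<delta> * \<delta>)" by (simp add: power2_eq_square)
        finally have "1 / 3 = - (\<delta> + \<delta> * \<delta>)" by (rule third_eq)
        moreover have "- (\<delta> + \<delta> * \<delta>) \<in> R" using \<delta>R by (intro RI)
        ultimately show False using third_notin_fin_ring[OF R] by metis
      qed
      ultimately have "(1 + 3 * \<gamma>) ^ s = 1" using \<delta> by simp
      then show False using less.IH[of s \<gamma>] less.prems s \<gamma> by auto
    next
      case False
      obtain r where r: "r \<in> R" "(1 + 3 * \<gamma>) ^ t = 1 + of_nat t * (3 * \<gamma>) + 9 * \<gamma>^2 * r" using ex by blast
      then have "3 * \<gamma> * (of_nat t + 3 * (\<gamma> * r)) = 0" using less.prems(3) by (simp add: algebra_simps power2_eq_square)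
      then have t: "of_nat t = - 3 * (\<gamma> * r)" using \<gamma> by (simp add: eq_neg_iff_add_eq_0)
      have "t mod 3 = 1 \<or> t mod 3 = 2" using False by presburger
      \<comment> \<open>\<open>a\<close> inverts \<open>t\<close> modulo 3, so divisibility of
        \<open>t\<close> by 3 in \<open>R\<close> becomes divisibility of 1.\<close>
      then obtain a b :: nat where ab: "a * t = 3 * b + 1"
      proof
        assume "t mod 3 = 1"
        then have "1 * t = 3 * (t div 3) + 1" by presburger
        then show thesis by (rule that)
      next
        assume "t mod 3 = 2"
        then have "2 * t = 3 * (2 * (t div 3) + 1) + 1" by presburger
        then show thesis by (rule that)
      qed
      have "of_nat a * (of_nat t :: 'a) = 3 * of_nat b + 1" using arg_cong[OF ab, of "of_nat :: nat \<Rightarrow> 'a"] by simp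
      then have "1 = of_nat a * (- 3 * (\<gamma> * r)) - 3 * of_nat b" unfolding t by (simp add: eq_diff_eq add.commute)
      also have "\<dots> = 3 * (- (of_nat a * (\<gamma> * r)) + - of_nat b)" by (simp add: algebra_simps)
      finally have "1 / 3 = - (of_nat a * (\<gamma> * r)) + - of_nat b" by (rule third_eq)
      moreover have "- (of_nat a * (\<gamma> * r)) + - of_nat b \<in> R" using r(1) less.prems(1) by (intro RI)
      ultimately show False using third_notin_fin_ring[OF R] by metis
    qed
  qed
qed

section \<open>Linear algebra on functions with finite support\<close>

text \<open>Vectors are functions on all natural numbers that vanish from \<open>n\<close> on: zero,
  sums and finite sums are then those of the type, for every dimension.\<close>

definition Vn :: "nat \<Rightarrow> (nat \<Rightarrow> 'k :: zero) set" where
  "Vn n = {f. \<forall>r\<ge>n. f r = 0}"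

definition scal :: "'k :: times \<Rightarrow> (nat \<Rightarrow> 'k) \<Rightarrow> nat \<Rightarrow> 'k" where
  "scal c f = (\<lambda>r. c * f r)"

text \<open>The matrix is integral but the vectors are over any commutative ring: the same matrices
  act on complex vectors for eigenvalues and on rational ones for irreducibility.\<close>

definition act :: "nat \<Rightarrow> int mat \<Rightarrow> (nat \<Rightarrow> 'k :: comm_ring_1) \<Rightarrow> nat \<Rightarrow> 'k" where
  "act n A f = (\<lambda>r. if r < n then \<Sum>j<n. of_int (A $$ (r, j)) * f j else 0)"

lemma act_Vn: "act n A f \<in> Vn n"
  unfolding act_def Vn_def by simp

lemma act_add: "act n A (f + g) = act n A f + act n A g"
  unfolding act_def by (auto simp: fun_eq_iff distrib_left sum.distrib)

lemma act_scal: "act n A (scal c f) = scal c (act n A f)"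
  unfolding act_def scal_def by (auto simp: fun_eq_iff sum_distrib_left mult_ac intro!: sum.cong)

lemma act_zero [simp]: "act n A 0 = 0"
  unfolding act_def by (auto simp: fun_eq_iff)

lemma act_mult:
  assumes "A \<in> carrier_mat n n" "B \<in> carrier_mat n n"
  shows "act n (A * B) f = act n A (act n B f)"
proof
  fix r
  show "act n (A * B) f r = act n A (act n B f) r"
  proof (cases "r < n")
    case True
    have "act n (A * B) f r = (\<Sum>j<n. (\<Sum>k<n. of_int (A $$ (r, k)) * of_int (B $$ (k, j))) * f j)"
      unfolding act_def using True assms
      by (auto simp: scalar_prod_def atLeast0LessThan intro!: sum.cong)
    also have "\<dots> = (\<Sum>j<n. \<Sum>k<n. of_int (A $$ (r, k)) * (of_int (B $$ (k, j)) * f j))"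
      by (simp add: sum_distrib_right mult.assoc)
    also have "\<dots> = (\<Sum>k<n. \<Sum>j<n. of_int (A $$ (r, k)) * (of_int (B $$ (k, j)) * f j))"
      by (rule sum.swap)
    also have "\<dots> = act n A (act n B f) r"
      unfolding act_def using True by (simp add: sum_distrib_left)
    finally show ?thesis .
  qed (simp add: act_def)
qed

lemma act_one: "f \<in> Vn n \<Longrightarrow> act n (1\<^sub>m n) f = f"
  unfolding act_def Vn_def
  by (auto simp: fun_eq_iff if_distrib[of of_int] if_distrib[of "\<lambda>x. x * _"] sum.delta cong: if_cong)

definition subsp :: "(nat \<Rightarrow> 'k :: comm_ring_1) set \<Rightarrow> bool" where
  "subsp S \<longleftrightarrow> 0 \<in> S \<and> (\<forall>f\<in>S. \<forall>g\<in>S. f + g \<in> S) \<and> (\<forall>c. \<forall>f\<in>S. scal c f \<in> S)"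

lemma subspD:
  assumes "subsp S"
  shows "0 \<in> S" "f \<in> S \<Longrightarrow> g \<in> S \<Longrightarrow> f + g \<in> S" "f \<in> S \<Longrightarrow> scal c f \<in> S"
  using assms unfolding subsp_def by auto

lemma scal_scal: "scal a (scal b f) = scal (a * b :: 'k :: comm_ring_1) f"
  unfolding scal_def by (simp add: mult.assoc)

lemma scal_add: "scal (a + b :: 'k :: comm_ring_1) f = scal a f + scal b f" "scal a (f + g) = scal a f + scal a g"
  unfolding scal_def by (auto simp: distrib_left distrib_right)

lemma scal_simps [simp]: "scal (0 :: 'k :: comm_ring_1) f = 0" "scal (1 :: 'k) f = f" "scal a (0 :: nat \<Rightarrow> 'k) = 0"
  unfolding scal_def by auto

lemma scal_eq_0_iff: "scal (a :: 'k :: idom) f = 0 \<longleftrightarrow> a = 0 \<or> f = 0"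
  unfolding scal_def by (auto simp: fun_eq_iff)

lemma subsp_Vn: "subsp (Vn n)"
  unfolding subsp_def Vn_def scal_def by auto

lemma sum_apply: "(\<Sum>i\<in>I. f i) r = (\<Sum>i\<in>I. f i r)" for f :: "'i \<Rightarrow> 'a \<Rightarrow> 'b :: comm_monoid_add"
  by (induction I rule: infinite_finite_induct) simp_all

text \<open>The n + 1 vectors are the columns of a square matrix whose last row vanishes, because
  members of \<open>Vn n\<close> are 0 at \<open>n\<close>; so its determinant is 0.\<close>

lemma vectors_dependent:
  fixes f :: "nat \<Rightarrow> nat \<Rightarrow> 'k :: field"
  assumes "\<And>i. i \<le> n \<Longrightarrow> f i \<in> Vn n"
  shows "\<exists>c. (\<exists>i\<le>n. c i \<noteq> 0) \<and> (\<Sum>i\<le>n. scal (c i) (f i)) = 0"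
proof -
  define M where "M = mat (Suc n) (Suc n) (\<lambda>(r, i). f i r)"
  have M: "M \<in> carrier_mat (Suc n) (Suc n)" unfolding M_def by simp
  have "transpose_mat M *\<^sub>v unit_vec (Suc n) n = 0\<^sub>v (Suc n)"
  proof (rule eq_vecI)
    fix i assume "i < dim_vec (0\<^sub>v (Suc n))"
    then have i: "i \<le> n" by simp
    have "(transpose_mat M *\<^sub>v unit_vec (Suc n) n) $ i = M $$ (n, i)"
      using i M by (simp add: row_transpose scalar_prod_right_unit)
    also have "\<dots> = 0" unfolding M_def using i assms[OF i] by (simp add: Vn_def)
    finally show "(transpose_mat M *\<^sub>v unit_vec (Suc n) n) $ i = 0\<^sub>v (Suc n) $ i" using i by simp
  qed (use M in simp)
  then have "det (transpose_mat M) = 0"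
    using det_0_iff_vec_prod_zero_field[of "transpose_mat M" "Suc n"] M
    by (metis lessI transpose_carrier_mat unit_vec_carrier unit_vec_nonzero)
  then have "det M = 0" using det_transpose[OF M] by simp
  then obtain v where v: "v \<in> carrier_vec (Suc n)" "v \<noteq> 0\<^sub>v (Suc n)" "M *\<^sub>v v = 0\<^sub>v (Suc n)"
    using det_0_iff_vec_prod_zero_field[OF M] by auto
  have "(\<Sum>i\<le>n. scal (v $ i) (f i)) r = 0" for r
  proof (cases "r < n")
    case True
    have "(\<Sum>i\<le>n. scal (v $ i) (f i)) r = (\<Sum>i\<le>n. v $ i * f i r)"
      by (simp add: scal_def sum_apply)
    also have "\<dots> = (M *\<^sub>v v) $ r"
      using True v(1) unfolding M_def
      by (auto simp: scalar_prod_def mult.commute lessThan_Suc_atMost[symmetric] atLeast0LessThan intro!: sum.cong)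
    finally show ?thesis using v(3) True by simp
  next
    case False
    then show ?thesis using assms by (auto simp: scal_def sum_apply Vn_def intro!: sum.neutral)
  qed
  then have "(\<Sum>i\<le>n. scal (v $ i) (f i)) = 0" by (simp add: fun_eq_iff)
  moreover have "\<exists>i\<le>n. v $ i \<noteq> 0"
    using v(1,2) by (metis carrier_vecD eq_vecI index_zero_vec less_Suc_eq_le)
  ultimately show ?thesis by (intro exI[of _ "\<lambda>i. v $ i"]) simp
qed

text \<open>Proof methods such as induction eta-expand function-valued terms; rewriting \<open>0 a\<close> and \<open>(f + g) a\<close>
  underneath the expansion would then destroy the group structure.\<close>

declare zero_fun_apply [simp del] plus_fun_apply [simp del]

text \<open>The polynomial \<open>p\<close> in the operator \<open>T\<close>, applied to
  \<open>f\<close> by Horner's scheme.\<close>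

definition pact :: "((nat \<Rightarrow> complex) \<Rightarrow> nat \<Rightarrow> complex) \<Rightarrow> complex poly \<Rightarrow> (nat \<Rightarrow> complex) \<Rightarrow> nat \<Rightarrow> complex" where
  "pact T p f = fold_coeffs (\<lambda>a g. scal a f + T g) p 0"

context
  fixes T :: "(nat \<Rightarrow> complex) \<Rightarrow> nat \<Rightarrow> complex"
  assumes T_add: "\<And>f g. T (f + g) = T f + T g" and T_scal: "\<And>c f. T (scal c f) = scal c (T f)"
begin

lemma T_zero: "T 0 = 0"
  using T_scal[of 0 0] by simp

lemma pact_0: "pact T 0 f = 0"
  unfolding pact_def by simp

lemma pact_pCons: "pact T (pCons a p) f = scal a f + T (pact T p f)"
  unfolding pact_def by (cases "p = 0 \<and> a = 0") (auto simp: T_zero)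

lemma pact_add: "pact T (p + q) f = pact T p f + pact T q f"
proof (induction p q rule: poly_induct2)
  case (pCons a p b q)
  then show ?case unfolding add_pCons pact_pCons T_add scal_add by (simp only: add_ac T_add)
qed (simp only: pact_0 add_0_left)

lemma pact_smult: "pact T (Polynomial.smult a p) f = scal a (pact T p f)"
proof (induction p)
  case (pCons b p)
  then show ?case unfolding smult_pCons pact_pCons scal_add by (simp only: T_scal scal_scal)
qed (simp only: pact_0 smult_0_right scal_simps)

lemma pact_mult: "pact T (p * q) f = pact T p (pact T q f)"
proof (induction p)
  case (pCons b p)
  then show ?case unfolding mult_pCons_left pact_add pact_pCons pact_smult pCons by (simp only: scal_simps add_0_left)
qed (simp only: pact_0 mult_zero_left)

lemma pact_linear: "pact T [:- a, 1:] f = scal (- a) f + T f"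
  by (simp add: pact_pCons pact_0 T_zero)

lemma pact_one: "pact T 1 f = f"
  by (simp add: one_pCons pact_pCons pact_0 T_zero)

lemma pact_monom: "pact T (Polynomial.monom c i) f = scal c ((T ^^ i) f)"
  by (induction i) (simp_all add: monom_Suc pact_pCons pact_0 T_zero T_scal monom_0)

lemma pact_sum: "pact T (\<Sum>i\<in>I. p i) f = (\<Sum>i\<in>I. pact T (p i) f)"
  by (induction I rule: infinite_finite_induct) (simp_all add: pact_0 pact_add)

lemma pact_closed:
  assumes "subsp S" "\<And>f. f \<in> S \<Longrightarrow> T f \<in> S" "f \<in> S"
  shows "pact T p f \<in> S"
  by (induction p) (use assms subspD[OF assms(1)] in \<open>simp_all add: pact_0 pact_pCons\<close>)

text \<open>Apply the linear factors one after another: the last nonzero vector before 0 is reached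
  is an eigenvector.\<close>

lemma eigenvector_of_pact_eq_0:
  assumes S: "subsp S" "\<And>f. f \<in> S \<Longrightarrow> T f \<in> S" and v: "v \<in> S" "v \<noteq> 0"
    and 0: "pact T (\<Prod>a\<leftarrow>as. [:- a, 1:]) v = 0"
  shows "\<exists>u\<in>S. u \<noteq> 0 \<and> (\<exists>a\<in>set as. T u = scal a u)"
  using 0
proof (induction as)
  case Nil then show ?case using v by (simp add: pact_one)
next
  case (Cons a as)
  define w where "w = pact T (\<Prod>a\<leftarrow>as. [:- a, 1:]) v"
  show ?case
  proof (cases "w = 0")
    case True then show ?thesis using Cons.IH unfolding w_def by auto
  next
    case False
    have "pact T [:- a, 1:] w = 0" using Cons.prems unfolding w_def list.map prod_list.Cons pact_mult .
    then have "T w = scal a w" unfolding pact_linear by (auto simp: fun_eq_iff scal_def zero_fun_apply plus_fun_apply)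
    moreover have "w \<in> S" unfolding w_def by (rule pact_closed[OF S v(1)])
    ultimately show ?thesis using False by auto
  qed
qed

text \<open>The vectors v, T v, ..., T ^ n v are dependent, which gives a nonzero polynomial
  annihilating \<open>v\<close>; over the complex numbers it splits. The eigenvector lies in
  \<open>S\<close> although no basis of \<open>S\<close> is chosen.\<close>

lemma eigenvector_in_invariant:
  assumes S: "subsp S" "\<And>f. f \<in> S \<Longrightarrow> T f \<in> S" "S \<subseteq> Vn n" and v: "v \<in> S" "v \<noteq> 0"
  shows "\<exists>u\<in>S. u \<noteq> 0 \<and> (\<exists>a. T u = scal a u)"
proof -
  have TS: "(T ^^ i) v \<in> S" for i using v(1) S(2) by (induction i) auto
  obtain c where c: "\<exists>i\<le>n. c i \<noteq> 0" "(\<Sum>i\<le>n. scal (c i) ((T ^^ i) v)) = 0"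
    using vectors_dependent[of n "\<lambda>i. (T ^^ i) v"] TS S(3) by auto
  define p where "p = (\<Sum>i\<le>n. Polynomial.monom (c i) i)"
  have "Polynomial.coeff p i = c i" if "i \<le> n" for i
    unfolding p_def coeff_sum coeff_monom using that by (simp add: sum.delta)
  then have p0: "p \<noteq> 0" using c(1) by auto
  have pv: "pact T p v = 0" unfolding p_def pact_sum pact_monom by (rule c(2))
  obtain as where as: "Polynomial.smult (lead_coeff p) (\<Prod>a\<leftarrow>as. [:- a, 1:]) = p"
    using fundamental_theorem_algebra_factorized[of p] by auto
  have "scal (lead_coeff p) (pact T (\<Prod>a\<leftarrow>as. [:- a, 1:]) v) = 0"
    using pv by (subst (asm) as[symmetric]) (simp only: pact_smult)
  then have "pact T (\<Prod>a\<leftarrow>as. [:- a, 1:]) v = 0" using p0 by (simp add: scal_eq_0_iff)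
  from eigenvector_of_pact_eq_0[OF S(1,2) v this] show ?thesis by blast
qed

text \<open>Let \<open>a\<close> be the first root and P the product for the others, with P(T) u
  nonzero. Then P(T) u is an eigenvector for \<open>a\<close>, while (T - a) u is 0 or an
  eigenvector for another root; \<open>uniq\<close> and distinctness exclude the latter.\<close>

lemma eigenvector_if_unique_root:
  assumes S: "subsp S" "\<And>f. f \<in> S \<Longrightarrow> T f \<in> S"
    and u: "u \<in> S" "pact T (\<Prod>a\<leftarrow>as. [:- a, 1:]) u = 0" and d: "distinct as"
    and uniq: "\<And>a b v w. a \<in> set as \<Longrightarrow> b \<in> set as \<Longrightarrow> v \<in> S \<Longrightarrow> w \<in> S \<Longrightarrow> v \<noteq> 0 \<Longrightarrow> w \<noteq> 0 \<Longrightarrow>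
      T v = scal a v \<Longrightarrow> T w = scal b w \<Longrightarrow> a = b"
  shows "u = 0 \<or> (\<exists>a\<in>set as. T u = scal a u)"
  using u d uniq
proof (induction as arbitrary: u)
  case Nil then show ?case by (simp add: pact_one del: not_ex)
next
  case (Cons a as)
  let ?P = "\<Prod>a\<leftarrow>as. [:- a, 1:]"
  have c: "pact T [:- a, 1:] (pact T ?P u) = 0" "pact T ?P (pact T [:- a, 1:] u) = 0"
    using Cons.prems(2) unfolding list.map prod_list.Cons pact_mult[symmetric] by (simp_all only: mult.commute)
  have S': "pact T ?P u \<in> S" "pact T [:- a, 1:] u \<in> S" using pact_closed[OF S Cons.prems(1)] by auto
  have lin: "T w = scal a w" if "pact T [:- a, 1:] w = 0" for w
    using that unfolding pact_linear by (auto simp: fun_eq_iff scal_def zero_fun_apply plus_fun_apply)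
  have uniq': "\<And>a b v w. a \<in> set as \<Longrightarrow> b \<in> set as \<Longrightarrow> v \<in> S \<Longrightarrow> w \<in> S \<Longrightarrow> v \<noteq> 0 \<Longrightarrow> w \<noteq> 0 \<Longrightarrow>
      T v = scal a v \<Longrightarrow> T w = scal b w \<Longrightarrow> a = b"
    by (rule Cons.prems(4)) auto
  have d: "distinct as" "a \<notin> set as" using Cons.prems(3) by auto
  show ?case
  proof (cases "pact T ?P u = 0")
    case True
    then show ?thesis using Cons.IH[OF Cons.prems(1) True d(1) uniq'] by auto
  next
    case False
    have "pact T [:- a, 1:] u = 0 \<or> (\<exists>b\<in>set as. T (pact T [:- a, 1:] u) = scal b (pact T [:- a, 1:] u))"
      by (rule Cons.IH[OF S'(2) c(2) d(1) uniq'])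
    moreover have "a = b" if "b \<in> set as" "pact T [:- a, 1:] u \<noteq> 0" "T (pact T [:- a, 1:] u) = scal b (pact T [:- a, 1:] u)" for b
      by (rule Cons.prems(4)[OF _ _ S' False that(2) lin[OF c(1)] that(3)]) (use that in auto)
    ultimately have "pact T [:- a, 1:] u = 0" using d(2) by blast
    then show ?thesis using lin by auto
  qed
qed

text \<open>The roots of X ^ t - \<mu> are distinct and their quotients are t-th roots of unity, so
  by \<open>uniq\<close> at most one of them is an eigenvalue of \<open>T\<close> on
  \<open>S\<close>.\<close>

lemma eigenvector_of_power:
  assumes S: "subsp S" "\<And>f. f \<in> S \<Longrightarrow> T f \<in> S"
    and u: "u \<in> S" "(T ^^ t) u = scal \<mu> u" and \<mu>: "\<mu> \<noteq> 0" and t: "t > 0"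
    and uniq: "\<And>a \<zeta> v w. v \<in> S \<Longrightarrow> w \<in> S \<Longrightarrow> v \<noteq> 0 \<Longrightarrow> w \<noteq> 0 \<Longrightarrow>
      T v = scal a v \<Longrightarrow> T w = scal (\<zeta> * a) w \<Longrightarrow> \<zeta> ^ t = 1 \<Longrightarrow> \<zeta> = 1"
  shows "\<exists>a. T u = scal a u"
proof -
  define p where "p = Polynomial.monom 1 t + [:- \<mu>:]"
  have deg: "degree p = t" "lead_coeff p = 1"
    unfolding p_def using t
    by (subst degree_add_eq_left, simp_all add: degree_monom_eq coeff_pCons split: nat.splits)+
  have roots: "poly p z = 0 \<longleftrightarrow> z ^ t = \<mu>" for z unfolding p_def by (simp add: poly_monom)
  obtain as where as: "Polynomial.smult (lead_coeff p) (\<Prod>a\<leftarrow>as. [:- a, 1:]) = p" "length as = degree p"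
    using fundamental_theorem_algebra_factorized[of p] by auto
  then have as: "p = (\<Prod>a\<leftarrow>as. [:- a, 1:])" "length as = t" using deg by simp_all
  have "poly (\<Prod>a\<leftarrow>as. [:- a, 1:]) z = 0 \<longleftrightarrow> z \<in> set as" for z :: complex
    by (induction as) auto
  then have sas: "set as = {z. z ^ t = \<mu>}" using roots as(1) by auto
  then have "distinct as" using card_nth_roots[OF \<mu> t] as(2) by (intro card_distinct) simp
  moreover have "pact T (\<Prod>a\<leftarrow>as. [:- a, 1:]) u = 0"
    unfolding as(1)[symmetric] p_def pact_add pact_monom using u(2)
    by (simp add: pact_pCons pact_0 T_zero scal_def fun_eq_iff zero_fun_apply plus_fun_apply)
  moreover have "a = b" if "a \<in> set as" "b \<in> set as" "v \<in> S" "w \<in> S" "v \<noteq> 0" "w \<noteq> 0" "T v = scal a v" "T w = scal b w" for a b v w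
  proof -
    have ab: "a ^ t = \<mu>" "b ^ t = \<mu>" using that(1,2) sas by auto
    then have a0: "a \<noteq> 0" using \<mu> t by auto
    have "(b / a) ^ t = 1" using ab \<mu> by (simp add: power_divide)
    moreover have "T w = scal (b / a * a) w" using that(8) a0 by simp
    ultimately have "b / a = 1" using uniq[OF that(3-7)] by blast
    then show ?thesis using a0 by simp
  qed
  ultimately show ?thesis using eigenvector_if_unique_root[OF S u(1)] by (metis scal_simps(3) T_zero)
qed

end

section \<open>Common eigenvectors and characters of commuting matrices\<close>

lemma act_eigenvector_in_invariant:
  assumes "subsp S" "S \<subseteq> Vn n" "\<And>f. f \<in> S \<Longrightarrow> act n A f \<in> S" "v \<in> S" "v \<noteq> (0 :: nat \<Rightarrow> complex)"
  shows "\<exists>u\<in>S. u \<noteq> 0 \<and> (\<exists>a. act n A u = scal a u)"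
  by (rule eigenvector_in_invariant[OF act_add act_scal assms(1,3,2,4,5)])

text \<open>By commutativity the joint eigenspace for the matrices treated so far is invariant under
  the next one and contains an eigenvector of it.\<close>

lemma common_eigenvector_finite:
  assumes comm: "\<And>x y. x \<in> M \<Longrightarrow> y \<in> M \<Longrightarrow> T x * T y = T y * T x"
    and T: "\<And>x. x \<in> M \<Longrightarrow> T x \<in> carrier_mat n n"
    and S: "subsp S" "S \<subseteq> Vn n" "\<And>x f. x \<in> M \<Longrightarrow> f \<in> S \<Longrightarrow> act n (T x) f \<in> S"
    and v: "v \<in> S" "v \<noteq> (0 :: nat \<Rightarrow> complex)" and F: "finite F" "F \<subseteq> M"
  shows "\<exists>\<chi>. \<exists>u\<in>S. u \<noteq> 0 \<and> (\<forall>x\<in>F. act n (T x) u = scal (\<chi> x) u)"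
  using F
proof (induction F rule: finite_induct)
  case empty then show ?case using v by auto
next
  case (insert y F)
  then obtain \<chi> u where u: "u \<in> S" "u \<noteq> 0" "\<forall>x\<in>F. act n (T x) u = scal (\<chi> x) u" by auto
  define S' where "S' = {u \<in> S. \<forall>x\<in>F. act n (T x) u = scal (\<chi> x) u}"
  have sS': "subsp S'" unfolding subsp_def
  proof (intro conjI ballI allI)
    show "0 \<in> S'" unfolding S'_def using subspD(1)[OF S(1)] by simp
    show "f + g \<in> S'" if "f \<in> S'" "g \<in> S'" for f g
      using that subspD(2)[OF S(1)] unfolding S'_def by (simp add: act_add scal_add)
    show "scal c f \<in> S'" if "f \<in> S'" for c f
      using that subspD(3)[OF S(1)] unfolding S'_def by (simp add: act_scal scal_scal mult.commute)
  qed
  have inv: "act n (T y) f \<in> S'" if f: "f \<in> S'" for f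
  proof -
    have "act n (T x) (act n (T y) f) = scal (\<chi> x) (act n (T y) f)" if x: "x \<in> F" for x
    proof -
      have xy: "x \<in> M" "y \<in> M" using x insert.prems by auto
      have "act n (T x) (act n (T y) f) = act n (T y * T x) f"
        using comm[OF xy] by (simp flip: act_mult[OF T[OF xy(1)] T[OF xy(2)]])
      also have "\<dots> = act n (T y) (act n (T x) f)" by (rule act_mult[OF T[OF xy(2)] T[OF xy(1)]])
      finally show ?thesis using f x unfolding S'_def by (simp add: act_scal)
    qed
    then show ?thesis using f insert.prems S(3) unfolding S'_def by simp
  qed
  have "u \<in> S'" using u unfolding S'_def by simp
  then obtain w a where w: "w \<in> S'" "w \<noteq> 0" "act n (T y) w = scal a w"
    using act_eigenvector_in_invariant[OF sS' _ inv _ u(2)] S(2) unfolding S'_def by blast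
  have "\<forall>x\<in>insert y F. act n (T x) w = scal ((\<chi>(y := a)) x) w"
    using w insert.hyps(2) unfolding S'_def by auto
  then show ?case using w(1,2) unfolding S'_def by blast
qed

lemma vector_space_fun: "vector_space (\<lambda>(c :: complex) (f :: 'i \<Rightarrow> complex) x. c * f x)"
  by unfold_locales (auto simp: fun_eq_iff algebra_simps plus_fun_apply)

text \<open>The matrices live in a space of dimension n * n, so finitely many of them span the
  others. This reduces common eigenvectors of an infinite family to those of a finite one.\<close>

lemma finite_spanning_matrices:
  fixes T :: "'i \<Rightarrow> int mat"
  obtains F where "finite F" "F \<subseteq> M"
    "\<And>x. x \<in> M \<Longrightarrow> \<exists>c :: 'i \<Rightarrow> complex. \<forall>i<n. \<forall>j<n. of_int (T x $$ (i, j)) = (\<Sum>y\<in>F. c y * of_int (T y $$ (i, j)))"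
proof -
  interpret V: vector_space "\<lambda>(c :: complex) (f :: nat \<times> nat \<Rightarrow> complex) x. c * f x" by (rule vector_space_fun)
  define \<phi> where "\<phi> x = (\<lambda>(i, j). if i < n \<and> j < n then of_int (T x $$ (i, j)) else 0 :: complex)" for x
  define E where "E = (\<lambda>p q. if q = p then 1 else 0 :: complex) ` ({..<n} \<times> {..<n})"
  have "\<phi> x \<in> V.span E" for x
  proof -
    have "\<phi> x = (\<Sum>p\<in>{..<n} \<times> {..<n}. (\<lambda>q. \<phi> x p * (if q = p then 1 else 0)))"
      by (auto simp: fun_eq_iff sum_apply \<phi>_def if_distrib[of "\<lambda>a. _ * a"] sum.delta' cong: if_cong)
    also have "\<dots> \<in> V.span E"
      by (intro V.span_sum V.span_scale V.span_base) (auto simp: E_def)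
    finally show ?thesis .
  qed
  then have sub: "\<phi> ` M \<subseteq> V.span E" by auto
  obtain B where B: "B \<subseteq> \<phi> ` M" "V.independent B" "\<phi> ` M \<subseteq> V.span B"
    by (rule V.maximal_independent_subset)
  have "finite E" unfolding E_def by simp
  then have finB: "finite B" using V.independent_span_bound[OF _ B(2)] B(1) sub by blast
  obtain F where F: "F \<subseteq> M" "inj_on \<phi> F" "B = \<phi> ` F" using B(1) unfolding subset_image_inj by auto
  have finF: "finite F" using finB F(2,3) by (simp add: finite_image_iff)
  show thesis
  proof (rule that[OF finF F(1)])
    fix x assume "x \<in> M"
    then have "\<phi> x \<in> V.span B" using B(3) by auto
    then obtain c where c: "\<phi> x = (\<Sum>b\<in>B. (\<lambda>q. c b * b q))" unfolding V.span_finite[OF finB] by auto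
    have eq: "\<phi> x q = (\<Sum>y\<in>F. c (\<phi> y) * \<phi> y q)" for q
      unfolding c sum_apply F(3) using F(2) by (simp add: sum.reindex)
    have "of_int (T x $$ (i, j)) = (\<Sum>y\<in>F. c (\<phi> y) * of_int (T y $$ (i, j)))" if "i < n" "j < n" for i j
      using eq[of "(i, j)"] that unfolding \<phi>_def by simp
    then show "\<exists>c. \<forall>i<n. \<forall>j<n. of_int (T x $$ (i, j)) = (\<Sum>y\<in>F. c y * of_int (T y $$ (i, j)) :: complex)"
      by (intro exI[of _ "\<lambda>y. c (\<phi> y)"]) simp
  qed
qed

lemma common_eigenvector:
  assumes comm: "\<And>x y. x \<in> M \<Longrightarrow> y \<in> M \<Longrightarrow> T x * T y = T y * T x"
    and T: "\<And>x. x \<in> M \<Longrightarrow> T x \<in> carrier_mat n n"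
    and S: "subsp S" "S \<subseteq> Vn n" "\<And>x f. x \<in> M \<Longrightarrow> f \<in> S \<Longrightarrow> act n (T x) f \<in> S"
    and v: "v \<in> S" "v \<noteq> (0 :: nat \<Rightarrow> complex)"
  shows "\<exists>\<chi>. \<exists>u\<in>S. u \<noteq> 0 \<and> (\<forall>x\<in>M. act n (T x) u = scal (\<chi> x) u)"
proof -
  obtain F where F: "finite F" "F \<subseteq> M"
    and span: "\<And>x. x \<in> M \<Longrightarrow> \<exists>c :: 'a \<Rightarrow> complex. \<forall>i<n. \<forall>j<n. of_int (T x $$ (i, j)) = (\<Sum>y\<in>F. c y * of_int (T y $$ (i, j)))"
    using finite_spanning_matrices[of M n T] by blast
  have "\<exists>\<chi>. \<exists>u\<in>S. u \<noteq> 0 \<and> (\<forall>x\<in>F. act n (T x) u = scal (\<chi> x) u)"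
    by (rule common_eigenvector_finite[where M = M, OF _ _ S(1,2) _ v F]) (simp_all add: comm T S(3))
  then obtain \<chi> u where u: "u \<in> S" "u \<noteq> 0" "\<forall>x\<in>F. act n (T x) u = scal (\<chi> x) u"
    by auto
  have "\<exists>a. act n (T x) u = scal a u" if x: "x \<in> M" for x
  proof -
    obtain c :: "'a \<Rightarrow> complex" where c: "\<forall>i<n. \<forall>j<n. of_int (T x $$ (i, j)) = (\<Sum>y\<in>F. c y * of_int (T y $$ (i, j)))"
      using span[OF x] by auto
    have "act n (T x) u r = scal (\<Sum>y\<in>F. c y * \<chi> y) u r" for r
    proof (cases "r < n")
      case True
      have "act n (T x) u r = (\<Sum>j<n. \<Sum>y\<in>F. c y * (of_int (T y $$ (r, j)) * u j))"
        unfolding act_def using True c by (simp add: sum_distrib_right mult.assoc)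
      also have "\<dots> = (\<Sum>y\<in>F. \<Sum>j<n. c y * (of_int (T y $$ (r, j)) * u j))" by (rule sum.swap)
      also have "\<dots> = (\<Sum>y\<in>F. c y * act n (T y) u r)"
        unfolding act_def using True by (simp add: sum_distrib_left)
      also have "\<dots> = (\<Sum>y\<in>F. c y * \<chi> y * u r)" using u(3) by (simp add: scal_def mult.assoc)
      finally show ?thesis by (simp add: scal_def sum_distrib_right)
    next
      case False
      then show ?thesis using u(1) S(2) by (auto simp: act_def scal_def Vn_def)
    qed
    then show ?thesis by blast
  qed
  then have "\<forall>x\<in>M. act n (T x) u = scal (SOME a. act n (T x) u = scal a u) u" by (auto intro: someI_ex)
  then show ?thesis using u(1,2) by (intro exI[of _ "\<lambda>x. SOME a. act n (T x) u = scal a u"] bexI[of _ u]) auto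
qed

text \<open>Characters vanish outside \<open>M\<close>, so that two of them are equal as soon as they agree on \<open>M\<close>.\<close>

definition chars :: "nat \<Rightarrow> 'i set \<Rightarrow> ('i \<Rightarrow> int mat) \<Rightarrow> ('i \<Rightarrow> complex) set" where
  "chars n M T = {\<chi>. (\<forall>x. x \<notin> M \<longrightarrow> \<chi> x = 0) \<and>
     (\<exists>u\<in>Vn n. u \<noteq> 0 \<and> (\<forall>x\<in>M. act n (T x) u = scal (\<chi> x) u))}"

lemma act_sum: "act n A (\<Sum>i\<in>I. f i) = (\<Sum>i\<in>I. act n A (f i))"
  by (induction I rule: infinite_finite_induct) (simp_all add: act_add)

lemma scal_sum: "scal (c :: 'k :: comm_ring_1) (\<Sum>i\<in>I. f i) = (\<Sum>i\<in>I. scal c (f i))"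
  by (induction I rule: infinite_finite_induct) (simp_all add: scal_add)

lemma scal_minus: "scal (a - b :: 'k :: comm_ring_1) f = scal a f - scal b f"
  unfolding scal_def by (auto simp: fun_eq_iff left_diff_distrib)

text \<open>Artin's argument: take \<open>x\<close> at which two characters differ and subtract
  \<open>\<chi> j x\<close> times the relation from its image under \<open>x\<close>. The summand
  \<open>j\<close> disappears, the others are multiplied by \<open>\<chi> i x - \<chi> j x\<close>,
  and the shorter relation gives \<open>u i = 0\<close>.\<close>

lemma characters_independent:
  fixes u :: "'j \<Rightarrow> nat \<Rightarrow> complex"
  assumes "finite I" and "\<And>i x. i \<in> I \<Longrightarrow> x \<in> M \<Longrightarrow> act n (T x) (u i) = scal (\<chi> i x) (u i)"
    and "\<And>i j. i \<in> I \<Longrightarrow> j \<in> I \<Longrightarrow> i \<noteq> j \<Longrightarrow> \<exists>x\<in>M. \<chi> i x \<noteq> \<chi> j x"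
    and "(\<Sum>i\<in>I. u i) = 0" and "i \<in> I"
  shows "u i = 0"
  using assms
proof (induction I arbitrary: u i rule: finite_induct)
  case (insert j I)
  have sum: "u j + (\<Sum>i\<in>I. u i) = 0" using insert.prems(3) insert.hyps by simp
  have 0: "u i = 0" if i: "i \<in> I" for i
  proof -
    obtain x where x: "x \<in> M" "\<chi> i x \<noteq> \<chi> j x" using insert.prems(2)[of i j] i insert.hyps(2) by auto
    let ?w = "\<lambda>i. scal (\<chi> i x - \<chi> j x) (u i)"
    have "0 = act n (T x) (u j + (\<Sum>i\<in>I. u i)) - scal (\<chi> j x) (u j + (\<Sum>i\<in>I. u i))" unfolding sum by simp
    also have "\<dots> = (\<Sum>i\<in>I. act n (T x) (u i)) - (\<Sum>i\<in>I. scal (\<chi> j x) (u i))"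
      using insert.prems(1)[of j x] x(1) by (simp add: act_add act_sum scal_add scal_sum)
    also have "(\<Sum>i\<in>I. act n (T x) (u i)) = (\<Sum>i\<in>I. scal (\<chi> i x) (u i))"
      using insert.prems(1) x(1) by (intro sum.cong) auto
    also have "\<dots> - (\<Sum>i\<in>I. scal (\<chi> j x) (u i)) = (\<Sum>i\<in>I. ?w i)" by (simp add: scal_minus sum_subtractf)
    finally have "(\<Sum>i\<in>I. ?w i) = 0" by simp
    moreover have "act n (T y) (?w i) = scal (\<chi> i y) (?w i)" if "i \<in> I" "y \<in> M" for i y
      using insert.prems(1)[of i y] that by (simp add: act_scal scal_scal mult.commute)
    moreover have "\<exists>x\<in>M. \<chi> i x \<noteq> \<chi> k x" if "i \<in> I" "k \<in> I" "i \<noteq> k" for i k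
      using insert.prems(2)[of i k] that by simp
    ultimately have "?w i = 0" using insert.IH[of ?w i] i by blast
    then show ?thesis using x(2) by (simp add: scal_eq_0_iff)
  qed
  then have "u j = 0" using sum by simp
  then show ?case using 0 insert.prems(4) by auto
qed simp

text \<open>Eigenvectors for n + 1 different characters would be linearly dependent for reasons of
  dimension, against their independence.\<close>

lemma chars_finite: "finite (chars n M T) \<and> card (chars n M T) \<le> n"
proof (rule ccontr)
  assume "\<not> ?thesis"
  then obtain X where X: "X \<subseteq> chars n M T" "finite X" "card X = Suc n"
    by (metis infinite_arbitrarily_large not_less_eq_eq obtain_subset_with_card_n)
  then obtain e where e: "bij_betw e {..n} X"
    by (metis card_atMost ex_bij_betw_nat_finite finite_atMost finite_same_card_bij)
  have eX: "e i \<in> chars n M T" if "i \<le> n" for i using e X(1) that by (auto simp: bij_betw_def)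
  have "\<exists>u. u \<in> Vn n \<and> u \<noteq> 0 \<and> (\<forall>x\<in>M. act n (T x) u = scal (e i x) u)" if "i \<le> n" for i
    using eX[OF that] unfolding chars_def by auto
  then obtain u where u: "\<And>i. i \<le> n \<Longrightarrow> u i \<in> Vn n \<and> u i \<noteq> 0 \<and> (\<forall>x\<in>M. act n (T x) (u i) = scal (e i x) (u i))"
    by metis
  obtain c where c: "\<exists>i\<le>n. c i \<noteq> 0" "(\<Sum>i\<le>n. scal (c i) (u i)) = 0"
    using vectors_dependent[of n u] u by blast
  then obtain i where i: "i \<le> n" "c i \<noteq> 0" by auto
  have "scal (c i) (u i) = 0"
  proof (rule characters_independent[where I = "{..n}" and M = M and n = n and T = T and \<chi> = e])
    show "act n (T x) (scal (c i) (u i)) = scal (e i x) (scal (c i) (u i))" if "i \<in> {..n}" "x \<in> M" for i x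
      using u that by (simp add: act_scal scal_scal mult.commute)
    show "\<exists>x\<in>M. e i x \<noteq> e j x" if "i \<in> {..n}" "j \<in> {..n}" "i \<noteq> j" for i j
    proof -
      have "e i \<noteq> e j" using e that by (auto simp: bij_betw_def inj_on_def)
      then obtain x where x: "e i x \<noteq> e j x" by auto
      then have "x \<in> M" using eX[of i] eX[of j] that unfolding chars_def by auto
      then show ?thesis using x by auto
    qed
  qed (use c i in auto)
  then show False using i(2) u[OF i(1)] by (simp add: scal_eq_0_iff)
qed

section \<open>Finiteness of bounded eigenvalues\<close>

lemma finite_bounded_int_polys: "finite {p :: int poly. degree p \<le> n \<and> (\<forall>i. \<bar>Polynomial.coeff p i\<bar> \<le> b)}"
proof (rule finite_subset)
  show "finite (Poly ` {xs. set xs \<subseteq> {-b..b} \<and> length xs = Suc n})"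
    by (intro finite_imageI finite_lists_length_eq) simp
  show "{p :: int poly. degree p \<le> n \<and> (\<forall>i. \<bar>Polynomial.coeff p i\<bar> \<le> b)} \<subseteq> Poly ` {xs. set xs \<subseteq> {-b..b} \<and> length xs = Suc n}"
  proof
    fix p :: "int poly" assume p: "p \<in> {p. degree p \<le> n \<and> (\<forall>i. \<bar>Polynomial.coeff p i\<bar> \<le> b)}"
    let ?xs = "map (Polynomial.coeff p) [0..<Suc n]"
    have eq: "p = Poly ?xs"
      using p by (auto simp: poly_eq_iff nth_default_def coeff_eq_0 simp del: upt_Suc)
    have "Polynomial.coeff p i \<in> {-b..b}" for i
    proof -
      have "\<bar>Polynomial.coeff p i\<bar> \<le> b" using p by simp
      then show ?thesis unfolding atLeastAtMost_iff by linarith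
    qed
    then have "set ?xs \<subseteq> {-b..b}" by auto
    then show "p \<in> Poly ` {xs. set xs \<subseteq> {-b..b} \<and> length xs = Suc n}"
      by (intro image_eqI[where f = Poly, OF eq]) (simp del: upt_Suc)
  qed
qed

text \<open>A further factor X - a replaces each coefficient by its lower neighbour minus
  \<open>a\<close> times itself, so the bound grows by the factor 1 + c.\<close>

lemma coeff_prod_linear_bound:
  fixes as :: "complex list"
  assumes "\<And>a. a \<in> set as \<Longrightarrow> cmod a \<le> c" "0 \<le> c"
  shows "cmod (Polynomial.coeff (\<Prod>a\<leftarrow>as. [:- a, 1:]) i) \<le> (1 + c) ^ length as"
  using assms(1)
proof (induction as arbitrary: i)
  case Nil then show ?case by (simp add: coeff_1)
next
  case (Cons a as)
  let ?P = "\<Prod>a\<leftarrow>as. [:- a, 1:]"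
  let ?C = "(1 + c) ^ length as"
  have IH: "cmod (Polynomial.coeff ?P i) \<le> ?C" for i using Cons by auto
  have C0: "0 \<le> ?C" using assms(2) by simp
  have "Polynomial.coeff ([:- a, 1:] * ?P) i = - a * Polynomial.coeff ?P i + (if i = 0 then 0 else Polynomial.coeff ?P (i - 1))"
    by (cases i) (simp_all add: mult_pCons_left)
  then have "cmod (Polynomial.coeff ([:- a, 1:] * ?P) i) \<le> cmod (- a * Polynomial.coeff ?P i) + cmod (if i = 0 then 0 else Polynomial.coeff ?P (i - 1))"
    by (simp only: norm_triangle_ineq)
  moreover have "cmod (- a * Polynomial.coeff ?P i) \<le> c * ?C"
    unfolding norm_mult using Cons.prems[of a] IH[of i] assms(2) by (intro mult_mono) auto
  moreover have "cmod (if i = 0 then 0 else Polynomial.coeff ?P (i - 1)) \<le> ?C" using IH C0 by simp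
  ultimately have "cmod (Polynomial.coeff ([:- a, 1:] * ?P) i) \<le> c * ?C + ?C"
    by linarith
  then show ?case by (simp add: algebra_simps)
qed

lemma eigenvalue_of_act:
  fixes A :: "int mat"
  assumes A: "A \<in> carrier_mat n n" and u: "u \<in> Vn n" "u \<noteq> (0 :: nat \<Rightarrow> complex)" "act n A u = scal a u"
  shows "poly (map_poly of_int (char_poly A)) a = 0"
proof -
  let ?A = "map_mat complex_of_int A"
  have A': "?A \<in> carrier_mat n n" using A by simp
  have "eigenvector ?A (vec n u) a" unfolding eigenvector_def
  proof (intro conjI)
    obtain r where "u r \<noteq> 0" using u(2) by (auto simp: fun_eq_iff zero_fun_apply)
    moreover from this have "r < n" using u(1) unfolding Vn_def by (metis (mono_tags) mem_Collect_eq not_le)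
    ultimately show "vec n u \<noteq> 0\<^sub>v (dim_row ?A)" using A by (auto simp: vec_eq_iff)
    show "?A *\<^sub>v vec n u = a \<cdot>\<^sub>v vec n u"
    proof (rule eq_vecI)
      fix r assume "r < dim_vec (a \<cdot>\<^sub>v vec n u)"
      then have r: "r < n" by simp
      have "(?A *\<^sub>v vec n u) $ r = act n A u r"
        using r A by (auto simp: scalar_prod_def act_def atLeast0LessThan intro!: sum.cong)
      then show "(?A *\<^sub>v vec n u) $ r = (a \<cdot>\<^sub>v vec n u) $ r" using r u(3) by (simp add: scal_def)
    qed (use A in simp)
  qed (use A in simp)
  then have "eigenvalue ?A a" unfolding eigenvalue_def by blast
  then have "poly (char_poly ?A) a = 0" using eigenvalue_root_char_poly[OF A'] by simp
  then show ?thesis using of_int_hom.char_poly_hom[OF A, where 'a=complex] by simp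
qed

lemma eigenvector_of_root:
  fixes A :: "int mat"
  assumes A: "A \<in> carrier_mat n n" and a: "poly (map_poly of_int (char_poly A)) a = (0 :: complex)"
  shows "\<exists>u\<in>Vn n. u \<noteq> 0 \<and> act n A u = scal a u"
proof -
  let ?A = "map_mat complex_of_int A"
  have A': "?A \<in> carrier_mat n n" using A by simp
  have "eigenvalue ?A a"
    using a eigenvalue_root_char_poly[OF A'] of_int_hom.char_poly_hom[OF A, where 'a=complex] by simp
  then obtain v where v: "v \<in> carrier_vec n" "v \<noteq> 0\<^sub>v n" "?A *\<^sub>v v = a \<cdot>\<^sub>v v"
    unfolding eigenvalue_def eigenvector_def using A by auto
  let ?u = "\<lambda>r. if r < n then v $ r else 0"
  have "act n A ?u r = scal a ?u r" for r
  proof (cases "r < n")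
    case True
    have "act n A ?u r = (?A *\<^sub>v v) $ r"
      using True A v(1) by (auto simp: scalar_prod_def act_def atLeast0LessThan intro!: sum.cong)
    then show ?thesis using True v by (simp add: scal_def)
  qed (simp add: act_def scal_def)
  moreover have "?u \<noteq> 0"
  proof
    assume u0: "?u = 0"
    have "v $ r = 0" if "r < n" for r using fun_cong[OF u0, of r] that by (simp add: zero_fun_apply)
    then show False using v(1,2) by (auto simp: vec_eq_iff)
  qed
  moreover have "?u \<in> Vn n" unfolding Vn_def by simp
  ultimately show ?thesis by (intro bexI[of _ ?u]) auto
qed

lemma algebraic_int_eigenvalue:
  fixes A :: "int mat"
  assumes A: "A \<in> carrier_mat n n" and u: "u \<in> Vn n" "u \<noteq> (0 :: nat \<Rightarrow> complex)" "act n A u = scal a u"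
  shows "algebraic_int a"
proof (rule algebraic_int.intros[where p = "map_poly of_int (char_poly A)"])
  show "poly (map_poly of_int (char_poly A)) a = 0" by (rule eigenvalue_of_act[OF assms])
  show "lead_coeff (map_poly of_int (char_poly A) :: complex poly) = 1"
    using degree_monic_char_poly[OF A] by simp
qed (simp add: coeff_map_poly)

text \<open>Kronecker's argument: a bound on all eigenvalues bounds the integer coefficients of the
  characteristic polynomial, which leaves finitely many polynomials and finitely many roots, over
  all matrices \<open>A\<close> together.\<close>

lemma finite_bounded_eigenvalues:
  "finite {a :: complex. \<exists>A u. A \<in> carrier_mat n n \<and> u \<in> Vn n \<and> u \<noteq> 0 \<and> act n A u = scal a u \<and>
     (\<forall>b v. v \<in> Vn n \<longrightarrow> v \<noteq> 0 \<longrightarrow> act n A v = scal b v \<longrightarrow> cmod b \<le> c)}" (is "finite ?Z")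
proof -
  define b where "b = \<lceil>(1 + \<bar>c\<bar>) ^ n\<rceil>"
  let ?P = "{p :: int poly. degree p \<le> n \<and> (\<forall>i. \<bar>Polynomial.coeff p i\<bar> \<le> b)}"
  let ?R = "\<Union>p\<in>?P - {0}. {a :: complex. poly (map_poly of_int p) a = 0}"
  have "finite ?R"
    using finite_bounded_int_polys[of n b] by (intro finite_UN_I) (auto intro!: poly_roots_finite)
  moreover have "?Z \<subseteq> ?R"
  proof
    fix a assume "a \<in> ?Z"
    then obtain A u where A: "A \<in> carrier_mat n n" and u: "u \<in> Vn n" "u \<noteq> 0" "act n A u = scal a u"
      and bd: "\<forall>b v. v \<in> Vn n \<longrightarrow> v \<noteq> 0 \<longrightarrow> act n A v = scal b v \<longrightarrow> cmod b \<le> c" by blast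
    let ?p = "char_poly A"
    have p: "degree ?p = n" "?p \<noteq> 0" using degree_monic_char_poly[OF A] by auto
    obtain as where as: "char_poly (map_mat complex_of_int A) = (\<Prod>a\<leftarrow>as. [:- a, 1:])" "length as = n"
      using char_poly_factorized[of "map_mat complex_of_int A" n] A by auto
    have as': "map_poly of_int ?p = (\<Prod>a\<leftarrow>as. [:- a, 1:])"
      using as(1) of_int_hom.char_poly_hom[OF A, where 'a=complex] by simp
    have "cmod z \<le> \<bar>c\<bar>" if "z \<in> set as" for z
    proof -
      have "poly (\<Prod>a\<leftarrow>as. [:- a, 1:]) z = 0" using that by (induction as) auto
      then obtain w where "w \<in> Vn n" "w \<noteq> 0" "act n A w = scal z w"
        using eigenvector_of_root[OF A, of z] as' by auto
      then show ?thesis using bd by force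
    qed
    then have "cmod (Polynomial.coeff (map_poly of_int ?p) i) \<le> (1 + \<bar>c\<bar>) ^ n" for i
      unfolding as' using coeff_prod_linear_bound[of as "\<bar>c\<bar>" i] as(2) by auto
    then have "\<bar>Polynomial.coeff ?p i\<bar> \<le> b" for i
      unfolding b_def by (simp add: coeff_map_poly le_ceiling_iff) (metis le_ceiling_iff le_of_int_ceiling of_int_abs order_trans of_int_le_iff)
    then have "?p \<in> ?P - {0}" using p by simp
    moreover have "poly (map_poly of_int ?p) a = 0" by (rule eigenvalue_of_act[OF A u])
    ultimately show "a \<in> ?R" by blast
  qed
  ultimately show ?thesis using finite_subset by blast
qed

section \<open>Integral representations and the level 3 congruence subgroup\<close>

text \<open>The representation belongs to a subgroup \<open>B\<close> of a group that stays fixed,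
  because the induction on the degree passes to kernels of blocks.\<close>

locale integral_rep = group G for G (structure) +
  fixes B and n :: nat and \<rho> :: "'a \<Rightarrow> int mat"
  assumes B: "subgroup B G"
    and \<rho>_carrier: "x \<in> B \<Longrightarrow> \<rho> x \<in> carrier_mat n n"
    and \<rho>_mult: "x \<in> B \<Longrightarrow> y \<in> B \<Longrightarrow> \<rho> (x \<otimes> y) = \<rho> x * \<rho> y"
    and \<rho>_one: "\<rho> \<one> = 1\<^sub>m n"
begin

lemmas B_closed = subgroup.m_closed[OF B] subgroup.m_inv_closed[OF B] subgroup.one_closed[OF B]
lemmas B_mem = subgroup.mem_carrier[OF B]
lemmas B_pow = subgroup_nat_pow_closed[OF B]

abbreviation ac :: "'a \<Rightarrow> (nat \<Rightarrow> 'k :: comm_ring_1) \<Rightarrow> nat \<Rightarrow> 'k" where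
  "ac x f \<equiv> act n (\<rho> x) f"

lemma ac_mult: "x \<in> B \<Longrightarrow> y \<in> B \<Longrightarrow> ac (x \<otimes> y) f = ac x (ac y f)"
  by (simp add: \<rho>_mult act_mult \<rho>_carrier)

lemma ac_one: "f \<in> Vn n \<Longrightarrow> ac \<one> f = f"
  by (simp add: \<rho>_one act_one)

lemma ac_inv: "x \<in> B \<Longrightarrow> f \<in> Vn n \<Longrightarrow> ac (inv x) (ac x f) = f" "x \<in> B \<Longrightarrow> f \<in> Vn n \<Longrightarrow> ac x (ac (inv x) f) = f"
  by (simp_all add: ac_one B_closed B_mem flip: ac_mult)

lemma ac_eq_0_iff: "x \<in> B \<Longrightarrow> f \<in> Vn n \<Longrightarrow> ac x f = 0 \<longleftrightarrow> f = 0"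
  using ac_inv(1)[of x f] by auto

lemma ac_pow: "x \<in> B \<Longrightarrow> f \<in> Vn n \<Longrightarrow> ac (x [^] (k::nat)) f = (act n (\<rho> x) ^^ k) f"
proof (induction k)
  case (Suc k)
  have "ac (x [^] Suc k) f = ac (x \<otimes> x [^] k) f" by (simp only: nat_pow_Suc2[OF B_mem[OF Suc.prems(1)]])
  then show ?case using Suc by (simp add: ac_mult B_pow)
qed (simp add: ac_one)

lemma eigenvalue_nonzero:
  assumes "x \<in> B" "u \<in> Vn n" "u \<noteq> (0 :: nat \<Rightarrow> complex)" "ac x u = scal a u"
  shows "a \<noteq> 0" "ac (inv x) u = scal (inverse a) u"
proof -
  show a: "a \<noteq> 0" using assms ac_eq_0_iff[OF assms(1,2)] by auto
  have "ac (inv x) (scal a u) = u" using assms ac_inv(1)[OF assms(1,2)] by simp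
  then have "scal (inverse a) (scal a (ac (inv x) u)) = scal (inverse a) u" by (simp add: act_scal)
  then show "ac (inv x) u = scal (inverse a) u" using a by (simp add: scal_scal)
qed

lemma \<rho>_eq_iff: "x \<in> B \<Longrightarrow> y \<in> B \<Longrightarrow> \<rho> x = \<rho> y \<longleftrightarrow> \<rho> (x \<otimes> inv y) = 1\<^sub>m n"
proof
  assume xy: "x \<in> B" "y \<in> B" and eq: "\<rho> x = \<rho> y"
  have "\<rho> (x \<otimes> inv y) = \<rho> y * \<rho> (inv y)" using xy eq by (simp add: \<rho>_mult B_closed)
  also have "\<dots> = 1\<^sub>m n" using xy B_mem by (simp add: \<rho>_one B_closed flip: \<rho>_mult)
  finally show "\<rho> (x \<otimes> inv y) = 1\<^sub>m n" .
next
  assume xy: "x \<in> B" "y \<in> B" and eq: "\<rho> (x \<otimes> inv y) = 1\<^sub>m n"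
  have "x = (x \<otimes> inv y) \<otimes> y" using xy B_mem by (simp add: m_assoc)
  then have "\<rho> x = \<rho> ((x \<otimes> inv y) \<otimes> y)" by simp
  also have "\<dots> = 1\<^sub>m n * \<rho> y" using xy eq by (simp add: \<rho>_mult[of "x \<otimes> inv y" y] B_closed)
  finally show "\<rho> x = \<rho> y" using \<rho>_carrier[OF xy(2)] by simp
qed

lemma \<rho>_commute_iff:
  assumes "x \<in> B" "y \<in> B"
  shows "\<rho> x * \<rho> y = \<rho> y * \<rho> x \<longleftrightarrow> \<rho> (x \<otimes> y \<otimes> inv x \<otimes> inv y) = 1\<^sub>m n"
proof -
  have "\<rho> x * \<rho> y = \<rho> y * \<rho> x \<longleftrightarrow> \<rho> (x \<otimes> y \<otimes> inv (y \<otimes> x)) = 1\<^sub>m n"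
    using \<rho>_eq_iff[of "x \<otimes> y" "y \<otimes> x"] assms by (simp add: \<rho>_mult B_closed)
  moreover have "x \<otimes> y \<otimes> inv (y \<otimes> x) = x \<otimes> y \<otimes> inv x \<otimes> inv y"
    using assms B_mem by (simp add: inv_mult_group m_assoc)
  ultimately show ?thesis by simp
qed

definition ker where "ker = {x \<in> B. \<rho> x = 1\<^sub>m n}"

definition red3 :: "'a \<Rightarrow> f3 mat" where "red3 x = map_mat of_int (\<rho> x)"

definition \<Gamma> where "\<Gamma> = {x \<in> B. red3 x = 1\<^sub>m n}"

lemma red3_carrier: "x \<in> B \<Longrightarrow> red3 x \<in> carrier_mat n n"
  unfolding red3_def using \<rho>_carrier by simp

lemma red3_mult: "x \<in> B \<Longrightarrow> y \<in> B \<Longrightarrow> red3 (x \<otimes> y) = red3 x * red3 y"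
  unfolding red3_def using \<rho>_mult of_int_hom.mat_hom_mult[OF \<rho>_carrier \<rho>_carrier] by simp

lemma red3_one: "red3 \<one> = 1\<^sub>m n"
  unfolding red3_def \<rho>_one by (rule of_int_hom.mat_hom_one)

lemma red3_r_inv: "x \<in> B \<Longrightarrow> red3 x * red3 (inv x) = 1\<^sub>m n"
  using B_mem by (simp add: red3_one B_closed flip: red3_mult)

lemma \<rho>_r_inv: "x \<in> B \<Longrightarrow> \<rho> x * \<rho> (inv x) = 1\<^sub>m n"
  using B_mem by (simp add: \<rho>_one B_closed flip: \<rho>_mult)

lemma \<Gamma>_B: "\<Gamma> \<subseteq> B"
  unfolding \<Gamma>_def by auto

lemma red3_hom: "red3 \<in> hom (G\<lparr>carrier := B\<rparr>) (GL n (UNIV :: f3 set))"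
proof (rule homI)
  fix x assume x: "x \<in> carrier (G\<lparr>carrier := B\<rparr>)"
  then have "red3 x * red3 (inv x) = 1\<^sub>m n" "red3 (inv x) * red3 x = 1\<^sub>m n"
    using B_mem by (simp_all add: red3_one B_closed flip: red3_mult)
  then show "red3 x \<in> carrier (GL n (UNIV :: f3 set))"
    using x by (intro GL_UNIV_I[of _ n "red3 (inv x)"]) (simp_all add: red3_carrier B_closed)
qed (simp add: red3_mult)

lemma subgroup_\<Gamma>: "subgroup \<Gamma> G"
proof (rule subgroupI)
  show "\<Gamma> \<subseteq> carrier G" using \<Gamma>_B B_mem by auto
  show "\<Gamma> \<noteq> {}" using red3_one B_closed(3) unfolding \<Gamma>_def by auto
  fix x assume "x \<in> \<Gamma>"
  then have x: "x \<in> B" "red3 x = 1\<^sub>m n" unfolding \<Gamma>_def by auto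
  have "red3 (inv x) = red3 x * red3 (inv x)" using x red3_carrier[of "inv x"] by (simp add: B_closed)
  also have "\<dots> = 1\<^sub>m n" by (rule red3_r_inv[OF x(1)])
  finally show "inv x \<in> \<Gamma>" using x unfolding \<Gamma>_def by (simp add: B_closed)
next
  fix x y assume "x \<in> \<Gamma>" "y \<in> \<Gamma>"
  then show "x \<otimes> y \<in> \<Gamma>" unfolding \<Gamma>_def by (simp add: red3_mult B_closed)
qed

lemma \<Gamma>_conj: "x \<in> B \<Longrightarrow> g \<in> \<Gamma> \<Longrightarrow> x \<otimes> g \<otimes> inv x \<in> \<Gamma>"
proof -
  assume x: "x \<in> B" and g: "g \<in> \<Gamma>"
  then have g': "g \<in> B" "red3 g = 1\<^sub>m n" unfolding \<Gamma>_def by auto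
  have "red3 (x \<otimes> g \<otimes> inv x) = red3 x * red3 g * red3 (inv x)"
    using x g' by (simp add: red3_mult B_closed)
  also have "\<dots> = red3 x * red3 (inv x)" using g' red3_carrier[OF x] by simp
  also have "\<dots> = 1\<^sub>m n" using x B_mem by (simp add: red3_one B_closed flip: red3_mult)
  finally show ?thesis using x g' unfolding \<Gamma>_def by (simp add: B_closed)
qed

lemma subgroup_ker: "subgroup ker G"
proof (rule subgroupI)
  show "ker \<subseteq> carrier G" using B_mem unfolding ker_def by auto
  show "ker \<noteq> {}" using \<rho>_one B_closed(3) unfolding ker_def by auto
  fix x assume "x \<in> ker"
  then have x: "x \<in> B" "\<rho> x = 1\<^sub>m n" unfolding ker_def by auto
  have "\<rho> (inv x) = \<rho> x * \<rho> (inv x)" using x \<rho>_carrier[of "inv x"] by (simp add: B_closed)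
  also have "\<dots> = 1\<^sub>m n" by (rule \<rho>_r_inv[OF x(1)])
  finally show "inv x \<in> ker" using x unfolding ker_def by (simp add: B_closed)
next
  fix x y assume "x \<in> ker" "y \<in> ker"
  then show "x \<otimes> y \<in> ker" unfolding ker_def by (simp add: \<rho>_mult B_closed)
qed

lemma ker_\<Gamma>: "ker \<subseteq> \<Gamma>"
  unfolding ker_def \<Gamma>_def red3_def by (auto intro: of_int_hom.mat_hom_one)

text \<open>The matrix of \<open>x\<close> is 1 + 3 A with \<open>A\<close> integral, and (a - 1) /
  3 is the eigenvalue of \<open>A\<close> at \<open>u\<close>.\<close>

lemma \<Gamma>_eigenvalue:
  assumes x: "x \<in> \<Gamma>" and u: "u \<in> Vn n" "u \<noteq> (0 :: nat \<Rightarrow> complex)" "ac x u = scal a u"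
  shows "algebraic_int ((a - 1) / 3)"
proof -
  let ?M = "\<rho> x"
  have M: "?M \<in> carrier_mat n n" using x \<Gamma>_B \<rho>_carrier by auto
  define A where "A = mat n n (\<lambda>(i, j). (?M $$ (i, j) - (if i = j then 1 else 0)) div 3)"
  have A: "A \<in> carrier_mat n n" unfolding A_def by simp
  have MA: "?M $$ (i, j) = (if i = j then 1 else 0) + 3 * A $$ (i, j)" if ij: "i < n" "j < n" for i j
  proof -
    have "red3 x $$ (i, j) = (1\<^sub>m n :: f3 mat) $$ (i, j)" using x unfolding \<Gamma>_def by simp
    then have "of_int (?M $$ (i, j)) = (if i = j then 1 else 0 :: f3)" unfolding red3_def using ij M by simp
    then have "(of_int (?M $$ (i, j) - (if i = j then 1 else 0)) :: f3) = 0" by simp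
    then have "3 dvd ?M $$ (i, j) - (if i = j then 1 else 0)" unfolding of_int_f3_eq_0_iff .
    then show ?thesis unfolding A_def using ij by simp
  qed
  have "ac x u r = u r + 3 * act n A u r" if r: "r < n" for r
  proof -
    have "ac x u r = (\<Sum>j<n. (if r = j then 1 else 0) * u j + 3 * (of_int (A $$ (r, j)) * u j))"
      unfolding act_def using r by (auto simp: MA algebra_simps intro!: sum.cong)
    also have "\<dots> = u r + 3 * (\<Sum>j<n. of_int (A $$ (r, j)) * u j)"
      unfolding sum.distrib sum_distrib_left[symmetric] using r
      by (simp add: if_distrib[of "\<lambda>c. c * _"] sum.delta cong: if_cong)
    finally show ?thesis using r by (simp add: act_def)
  qed
  then have "u r + 3 * act n A u r = a * u r" if "r < n" for r
    using fun_cong[OF u(3), of r] that by (simp add: scal_def)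
  then have "act n A u r = scal ((a - 1) / 3) u r" if "r < n" for r
    using that by (simp add: scal_def field_simps)
  moreover have "act n A u r = scal ((a - 1) / 3) u r" if "\<not> r < n" for r
    using u(1) that by (simp add: scal_def act_def Vn_def)
  ultimately have "act n A u r = scal ((a - 1) / 3) u r" for r by blast
  then have "act n A u = scal ((a - 1) / 3) u" by blast
  then show ?thesis using algebraic_int_eigenvalue[OF A u(1,2)] by simp
qed

lemma algebraic_int_inverse_eigenvalue:
  assumes "x \<in> B" "u \<in> Vn n" "u \<noteq> (0 :: nat \<Rightarrow> complex)" "ac x u = scal a u"
  shows "algebraic_int (inverse a)"
  using algebraic_int_eigenvalue[OF \<rho>_carrier[OF B_closed(2)[OF assms(1)]] assms(2,3) eigenvalue_nonzero(2)[OF assms]] .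

text \<open>\<zeta> = 1 + 3 \<gamma>, where \<gamma> is the difference of (\<zeta> a - 1) / 3 and (a
  - 1) / 3, divided by a. All ingredients are algebraic integers, 1 / a because it is an eigenvalue
  of the inverse of \<open>x\<close>; so \<open>fin_ring_root_of_unity\<close> applies.\<close>

lemma \<Gamma>_eigenvalue_ratio:
  assumes x: "x \<in> \<Gamma>" and u: "u \<in> Vn n" "u \<noteq> (0 :: nat \<Rightarrow> complex)" "ac x u = scal a u"
    and w: "w \<in> Vn n" "w \<noteq> (0 :: nat \<Rightarrow> complex)" "ac x w = scal (\<zeta> * a) w" and t: "\<zeta> ^ t = 1" "t > 0"
  shows "\<zeta> = 1"
proof -
  have xB: "x \<in> B" using x \<Gamma>_B by auto
  let ?X = "{(a - 1) / 3, (\<zeta> * a - 1) / 3, inverse a}"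
  have "algebraic_int z" if "z \<in> ?X" for z
    using that \<Gamma>_eigenvalue[OF x u] \<Gamma>_eigenvalue[OF x w] algebraic_int_inverse_eigenvalue[OF xB u] by blast
  then obtain R where R: "fin_ring R" "?X \<subseteq> R" using fin_ring_algebraic_ints[of ?X] by blast
  define \<gamma> where "\<gamma> = ((\<zeta> * a - 1) / 3 - (a - 1) / 3) * inverse a"
  have "\<gamma> \<in> R" unfolding \<gamma>_def using R(2) by (intro fin_ring_mult[OF R(1)] fin_ring_diff[OF R(1)]) auto
  moreover have "1 + 3 * \<gamma> = \<zeta>"
    using eigenvalue_nonzero(1)[OF xB u] unfolding \<gamma>_def by (simp add: field_simps)
  ultimately have "\<gamma> = 0" using fin_ring_root_of_unity[OF R(1)] t by simp
  then show ?thesis using \<open>1 + 3 * \<gamma> = \<zeta>\<close> by simp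
qed

lemma \<Gamma>_eigenvalue_root_of_unity:
  assumes x: "x \<in> \<Gamma>" and u: "u \<in> Vn n" "u \<noteq> (0 :: nat \<Rightarrow> complex)" "ac x u = scal a u" and t: "a ^ t = 1" "t > 0"
  shows "a = 1"
proof -
  obtain R where R: "fin_ring R" "(a - 1) / 3 \<in> R"
    using fin_ring_algebraic_ints[of "{(a - 1) / 3}"] \<Gamma>_eigenvalue[OF x u] by blast
  have "1 + 3 * ((a - 1) / 3) = a" by (simp add: field_simps)
  then have "(a - 1) / 3 = 0" by (intro fin_ring_root_of_unity[OF R t(2)]) (simp only: t(1))
  then show ?thesis by simp
qed

text \<open>\<open>\<Gamma>_eigenvalue_ratio\<close> supplies the uniqueness hypothesis of
  \<open>eigenvector_of_power\<close>.\<close>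

lemma \<Gamma>_eigenvector_of_power:
  assumes x: "x \<in> \<Gamma>" and u: "u \<in> Vn n" "u \<noteq> (0 :: nat \<Rightarrow> complex)" "ac (x [^] (t::nat)) u = scal a u" and t: "t > 0"
  shows "\<exists>b. ac x u = scal b u"
proof (rule eigenvector_of_power[OF act_add act_scal subsp_Vn act_Vn u(1)])
  have xB: "x \<in> B" using x \<Gamma>_B by auto
  show "(act n (\<rho> x) ^^ t) u = scal a u" using ac_pow[OF xB u(1)] u(3) by simp
  show "a \<noteq> 0" by (rule eigenvalue_nonzero(1)[OF B_pow[OF xB] u])
  show "\<zeta> = 1" if "v \<in> Vn n" "w \<in> Vn n" "v \<noteq> 0" "w \<noteq> 0" "ac x v = scal b v" "ac x w = scal (\<zeta> * b) w" "\<zeta> ^ t = 1"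
    for b \<zeta> and v w :: "nat \<Rightarrow> complex"
    by (rule \<Gamma>_eigenvalue_ratio[OF x that(1,3,5) that(2,4,6) that(7) t])
qed (rule t)

end

section \<open>Irreducible representations\<close>

text \<open>Irreducibility enters through the consequence that is used, whose negation hands over an
  invariant subspace in \<open>not_irreducible_block\<close>. \<open>C\<close> may be a mere subset,
  so that a set of commutators can be inserted directly.\<close>

locale irreducible_rep = integral_rep +
  assumes n: "n > 0"
    and irr: "C \<subseteq> B \<Longrightarrow> (\<And>x c. x \<in> B \<Longrightarrow> c \<in> C \<Longrightarrow> x \<otimes> c \<otimes> inv x \<in> C) \<Longrightarrow>
      f \<in> Vn n \<Longrightarrow> f \<noteq> (0 :: nat \<Rightarrow> rat) \<Longrightarrow> (\<And>c. c \<in> C \<Longrightarrow> act n (\<rho> c) f = f) \<Longrightarrow>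
      c \<in> C \<Longrightarrow> \<rho> c = 1\<^sub>m n"
begin

text \<open>A fixed vector over \<open>\<complex>\<close> yields one over \<open>\<rat>\<close> by applying a \<open>\<rat>\<close>-linear functional to its coordinates.\<close>

lemma irr_complex:
  assumes C: "C \<subseteq> B" "\<And>x c. x \<in> B \<Longrightarrow> c \<in> C \<Longrightarrow> x \<otimes> c \<otimes> inv x \<in> C"
    and f: "f \<in> Vn n" "f \<noteq> (0 :: nat \<Rightarrow> complex)" and fixed: "\<And>c. c \<in> C \<Longrightarrow> ac c f = f" and c: "c \<in> C"
  shows "\<rho> c = 1\<^sub>m n"
proof -
  obtain r where r: "f r \<noteq> 0" using f(2) by (auto simp: fun_eq_iff zero_fun_apply)
  obtain \<phi> :: "complex \<Rightarrow> rat" where \<phi>: "\<forall>x y. \<phi> (x + y) = \<phi> x + \<phi> y" "\<forall>q x. \<phi> (of_rat q * x) = q * \<phi> x" "\<phi> (f r) = 1"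
    using rat_functional[OF r] by (elim exE conjE) (rule that)
  have \<phi>0: "\<phi> 0 = 0" using \<phi>(2)[rule_format, of 0 0] by simp
  have \<phi>sum: "\<phi> (\<Sum>j\<in>J. h j) = (\<Sum>j\<in>J. \<phi> (h j))" for J :: "nat set" and h
    by (induction J rule: infinite_finite_induct) (simp_all add: \<phi>0 \<phi>(1))
  have \<phi>int: "\<phi> (of_int k * x) = of_int k * \<phi> x" for k x
    using \<phi>(2)[rule_format, of "of_int k" x] by simp
  let ?f = "\<lambda>r. \<phi> (f r)"
  \<comment> \<open>\<open>\<phi>\<close> commutes with the action because the matrices have integer
    entries.\<close>
  have act: "act n A ?f = (\<lambda>r. \<phi> (act n A f r))" for A
    unfolding act_def by (auto simp: fun_eq_iff \<phi>sum \<phi>int \<phi>0)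
  show ?thesis
  proof (rule irr[OF C _ _ _ c, of ?f])
    show "?f \<in> Vn n" using f(1) unfolding Vn_def by (simp add: \<phi>0)
    show "?f \<noteq> 0"
    proof
      assume "?f = 0"
      from fun_cong[OF this, of r] show False using \<phi>(3) by (simp add: zero_fun_apply)
    qed
    show "act n (\<rho> c) ?f = ?f" if "c \<in> C" for c unfolding act using fixed[OF that] by simp
  qed
qed

definition rho_abelian :: "'a set \<Rightarrow> bool" where
  "rho_abelian M \<longleftrightarrow> (\<forall>x\<in>M. \<forall>y\<in>M. \<rho> x * \<rho> y = \<rho> y * \<rho> x)"

definition B_normal :: "'a set \<Rightarrow> bool" where
  "B_normal M \<longleftrightarrow> subgroup M G \<and> M \<subseteq> \<Gamma> \<and> (\<forall>x\<in>B. \<forall>m\<in>M. x \<otimes> m \<otimes> inv x \<in> M)"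

lemma B_normalD:
  assumes "B_normal M"
  shows "subgroup M G" "M \<subseteq> \<Gamma>" "M \<subseteq> B" "\<And>x m. x \<in> B \<Longrightarrow> m \<in> M \<Longrightarrow> x \<otimes> m \<otimes> inv x \<in> M"
  using assms \<Gamma>_B unfolding B_normal_def by auto

definition weight :: "'a set \<Rightarrow> ('a \<Rightarrow> complex) \<Rightarrow> (nat \<Rightarrow> complex) set" where
  "weight M \<chi> = {f \<in> Vn n. \<forall>m\<in>M. ac m f = scal (\<chi> m) f}"

lemma subsp_weight: "subsp (weight M \<chi>)"
  unfolding subsp_def weight_def using subspD[OF subsp_Vn[of n]]
  by (auto simp: act_add scal_add act_scal scal_scal mult.commute)

lemma weight_nonempty:
  assumes M: "M \<subseteq> B" "rho_abelian M"
  shows "\<exists>\<chi>. \<exists>u\<in>weight M \<chi>. u \<noteq> 0"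
proof -
  let ?e = "\<lambda>r. if r = 0 then 1 else 0 :: complex"
  have e: "?e \<in> Vn n" "?e \<noteq> 0" using n unfolding Vn_def by (simp_all add: fun_eq_iff zero_fun_apply)
  have "\<exists>\<chi>. \<exists>u\<in>Vn n. u \<noteq> (0 :: nat \<Rightarrow> complex) \<and> (\<forall>x\<in>M. ac x u = scal (\<chi> x) u)"
    by (rule common_eigenvector[OF _ _ subsp_Vn order_refl _ e])
      (use M \<rho>_carrier in \<open>auto simp: rho_abelian_def act_Vn\<close>)
  then show ?thesis unfolding weight_def by auto
qed

lemma weight_unique:
  assumes "m \<in> B" "u \<noteq> (0 :: nat \<Rightarrow> complex)" "ac m u = scal a u" "ac m u = scal b u"
  shows "a = b"
proof -
  have "scal (a - b) u = 0" using assms(3,4) by (simp add: scal_minus)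
  then show ?thesis using assms(2) by (simp add: scal_eq_0_iff)
qed

lemma conj_commutator:
  assumes "x \<in> carrier G" "g \<in> carrier G" "m \<in> carrier G"
  shows "x \<otimes> (g \<otimes> m \<otimes> inv g \<otimes> inv m) \<otimes> inv x =
    (x \<otimes> g \<otimes> inv x) \<otimes> (x \<otimes> m \<otimes> inv x) \<otimes> inv (x \<otimes> g \<otimes> inv x) \<otimes> inv (x \<otimes> m \<otimes> inv x)"
  using assms by (simp add: m_assoc inv_mult_group mult_inv_cancel)

text \<open>The set of all these commutators is invariant under conjugation by \<open>B\<close>
  because \<open>K\<close> and \<open>M\<close> are; irreducibility turns a common fixed vector into
  triviality.\<close>

lemma commutators_trivial:
  assumes K: "B_normal K" and M: "B_normal M" and u: "u \<in> Vn n" "u \<noteq> (0 :: nat \<Rightarrow> complex)"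
    and fixed: "\<And>g m. g \<in> K \<Longrightarrow> m \<in> M \<Longrightarrow> ac (g \<otimes> m \<otimes> inv g \<otimes> inv m) u = u"
    and gm: "g \<in> K" "m \<in> M"
  shows "\<rho> g * \<rho> m = \<rho> m * \<rho> g"
proof -
  note K' = B_normalD[OF K] and M' = B_normalD[OF M]
  let ?C = "{g \<otimes> m \<otimes> inv g \<otimes> inv m | g m. g \<in> K \<and> m \<in> M}"
  have "\<rho> (g \<otimes> m \<otimes> inv g \<otimes> inv m) = 1\<^sub>m n"
  proof (rule irr_complex[where C = ?C and f = u])
    show "?C \<subseteq> B" using K'(3) M'(3) by (auto intro!: B_closed)
    show "x \<otimes> c \<otimes> inv x \<in> ?C" if x: "x \<in> B" and c: "c \<in> ?C" for x c
    proof -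
      obtain g m where gm: "c = g \<otimes> m \<otimes> inv g \<otimes> inv m" "g \<in> K" "m \<in> M" using c by auto
      then have "g \<in> B" "m \<in> B" using K'(3) M'(3) by auto
      then have "x \<otimes> c \<otimes> inv x = (x \<otimes> g \<otimes> inv x) \<otimes> (x \<otimes> m \<otimes> inv x) \<otimes> inv (x \<otimes> g \<otimes> inv x) \<otimes> inv (x \<otimes> m \<otimes> inv x)"
        unfolding gm(1) using x B_mem by (intro conj_commutator)
      then show ?thesis using K'(4)[OF x gm(2)] M'(4)[OF x gm(3)] by blast
    qed
    show "ac c u = u" if "c \<in> ?C" for c using that fixed by auto
    show "g \<otimes> m \<otimes> inv g \<otimes> inv m \<in> ?C" using gm by blast
  qed (rule u)+
  then show ?thesis using \<rho>_commute_iff[of g m] gm K'(3) M'(3) by auto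
qed

lemma B_normal_\<Gamma>: "B_normal \<Gamma>"
  unfolding B_normal_def using subgroup_\<Gamma> \<Gamma>_conj by simp

lemma pow_conj:
  assumes "x \<in> carrier G" "m \<in> carrier G"
  shows "inv (x [^] (i + j :: nat)) \<otimes> m \<otimes> x [^] (i + j) = inv (x [^] j) \<otimes> (inv (x [^] i) \<otimes> m \<otimes> x [^] i) \<otimes> x [^] j"
  using assms by (simp add: nat_pow_mult[symmetric] inv_mult_group m_assoc)

lemma B_normal_conj': "B_normal M \<Longrightarrow> x \<in> B \<Longrightarrow> m \<in> M \<Longrightarrow> inv x \<otimes> m \<otimes> x \<in> M"
  using B_normalD(4)[of M "inv x" m] B_closed(2)[of x] B_mem[of x] by simp

text \<open>Finitely many characters occur, so a power \<open>g ^ t\<close> fixes the character \<open>\<chi>\<close>; an eigenvector of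
  \<open>g ^ t\<close> in its weight space is an eigenvector of \<open>g\<close>, which therefore fixes \<open>\<chi>\<close> as well.\<close>

lemma weight_conj_invariant:
  assumes M: "B_normal M" "rho_abelian M" and g: "g \<in> \<Gamma>" and u: "u \<in> weight M \<chi>" "u \<noteq> 0" and m: "m \<in> M"
  shows "\<chi> (inv g \<otimes> m \<otimes> g) = \<chi> m"
proof -
  note M' = B_normalD[OF M(1)]
  have gB: "g \<in> B" using g \<Gamma>_B by auto
  have gp: "g [^] i \<in> B" for i :: nat using B_pow[OF gB] .
  have act_conj: "ac m (ac x f) = scal (\<chi> (inv x \<otimes> m \<otimes> x)) (ac x f)" if "x \<in> B" "m \<in> M" "f \<in> weight M \<chi>" for x m f
  proof -
    have mB: "m \<in> B" using M'(3) that(2) by auto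
    have "ac m (ac x f) = ac (x \<otimes> (inv x \<otimes> m \<otimes> x)) f"
      using that(1) mB B_mem by (simp add: m_assoc mult_inv_cancel flip: ac_mult)
    also have "\<dots> = ac x (ac (inv x \<otimes> m \<otimes> x) f)" using that(1) mB by (simp add: ac_mult B_closed)
    also have "ac (inv x \<otimes> m \<otimes> x) f = scal (\<chi> (inv x \<otimes> m \<otimes> x)) f"
      using B_normal_conj'[OF M(1) that(1,2)] that(3) unfolding weight_def by simp
    finally show ?thesis by (simp add: act_scal)
  qed
  \<comment> \<open>The conjugates of \<open>\<chi>\<close> under the powers of \<open>g\<close>,
    cut off outside \<open>M\<close> so that they belong to \<open>chars\<close>.\<close>
  define \<psi> where "\<psi> i m = (if m \<in> M then \<chi> (inv (g [^] i) \<otimes> m \<otimes> g [^] i) else 0)" for i :: nat and m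
  have uV: "u \<in> Vn n" using u(1) unfolding weight_def by simp
  have "\<psi> i \<in> chars n M \<rho>" for i
    unfolding chars_def
  proof (intro CollectI conjI bexI[of _ "ac (g [^] i) u"])
    show "ac (g [^] i) u \<noteq> 0" using ac_eq_0_iff[OF gp uV] u(2) by simp
    show "\<forall>x\<in>M. ac x (ac (g [^] i) u) = scal (\<psi> i x) (ac (g [^] i) u)"
      using act_conj[OF gp _ u(1)] unfolding \<psi>_def by simp
  qed (simp_all add: \<psi>_def act_Vn)
  then have "finite (range \<psi>)" using chars_finite[of n M \<rho>] finite_subset[of "range \<psi>"] by blast
  then have "\<not> inj \<psi>" using range_inj_infinite by blast
  then obtain i j where "i \<noteq> j" "\<psi> i = \<psi> j" unfolding inj_def by blast
  then have "\<exists>i j. i < j \<and> \<psi> i = \<psi> j" by (metis linorder_neqE_nat)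
  then obtain i j where ij: "i < j" "\<psi> i = \<psi> j" by blast
  define t where "t = j - i"
  have t: "t > 0" "j = i + t" unfolding t_def using ij by auto
  have \<chi>t: "\<chi> (inv (g [^] t) \<otimes> m \<otimes> g [^] t) = \<chi> m" if m: "m \<in> M" for m
  proof -
    \<comment> \<open>Evaluation at this conjugate of \<open>m\<close> cancels the common part of
      the two conjugations and leaves the one by \<open>g [^] t\<close>.\<close>
    let ?m = "g [^] i \<otimes> m \<otimes> inv (g [^] i)"
    have mM: "?m \<in> M" by (rule M'(4)[OF gp m])
    have mG: "m \<in> carrier G" "g \<in> carrier G" using m M'(3) B_mem gB by auto
    have eq: "inv (g [^] i) \<otimes> ?m \<otimes> g [^] i = m" using mG by (simp add: m_assoc mult_inv_cancel)
    have "\<psi> j ?m = \<chi> (inv (g [^] t) \<otimes> m \<otimes> g [^] t)"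
      unfolding \<psi>_def t(2) using mM pow_conj[of g ?m i t] mG eq by simp
    moreover have "\<psi> i ?m = \<chi> m" unfolding \<psi>_def using mM eq by simp
    ultimately show ?thesis using ij(2) by simp
  qed
  have inv: "ac (g [^] t) f \<in> weight M \<chi>" if "f \<in> weight M \<chi>" for f
    using act_conj[OF gp _ that] \<chi>t unfolding weight_def by (simp add: act_Vn)
  have "\<exists>w\<in>weight M \<chi>. w \<noteq> 0 \<and> (\<exists>a. ac (g [^] t) w = scal a w)"
    by (rule act_eigenvector_in_invariant[OF subsp_weight _ inv u]) (auto simp: weight_def)
  then obtain w a where w: "w \<in> weight M \<chi>" "w \<noteq> 0" "ac (g [^] t) w = scal a w" by auto
  have wV: "w \<in> Vn n" using w(1) unfolding weight_def by simp
  obtain b where b: "ac g w = scal b w" using \<Gamma>_eigenvector_of_power[OF g wV w(2,3) t(1)] by auto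
  have b0: "b \<noteq> 0" by (rule eigenvalue_nonzero(1)[OF gB wV w(2) b])
  have "scal b (ac m w) = scal b (scal (\<chi> (inv g \<otimes> m \<otimes> g)) w)"
    using act_conj[OF gB m w(1)] unfolding b by (simp add: act_scal scal_scal mult.commute)
  moreover have "ac m w = scal (\<chi> m) w" using w(1) m unfolding weight_def by simp
  ultimately have "scal (b * (\<chi> m - \<chi> (inv g \<otimes> m \<otimes> g))) w = 0" by (simp add: scal_scal scal_minus right_diff_distrib)
  then show ?thesis using b0 w(2) by (simp add: scal_eq_0_iff)
qed

lemma abelian_normal_central:
  assumes M: "B_normal M" "rho_abelian M" and g: "g \<in> \<Gamma>" and m: "m \<in> M"
  shows "\<rho> g * \<rho> m = \<rho> m * \<rho> g"
proof -
  obtain \<chi> u where u: "u \<in> weight M \<chi>" "u \<noteq> 0" using weight_nonempty[OF B_normalD(3)[OF M(1)] M(2)] by auto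
  have uV: "u \<in> Vn n" using u(1) unfolding weight_def by simp
  note M' = B_normalD[OF M(1)]
  show ?thesis
  proof (rule commutators_trivial[OF B_normal_\<Gamma> M(1) uV u(2) _ g m])
    fix g m assume gm: "g \<in> \<Gamma>" "m \<in> M"
    then have B: "g \<in> B" "m \<in> B" using \<Gamma>_B M'(3) by auto
    have c: "g \<otimes> m \<otimes> inv g \<in> M" by (rule M'(4)[OF B(1) gm(2)])
    have "\<chi> (inv g \<otimes> (g \<otimes> m \<otimes> inv g) \<otimes> g) = \<chi> (g \<otimes> m \<otimes> inv g)"
      by (rule weight_conj_invariant[OF M gm(1) u c])
    then have eq: "\<chi> (g \<otimes> m \<otimes> inv g) = \<chi> m" using B B_mem by (simp add: m_assoc mult_inv_cancel)
    have m1: "ac m u = scal (\<chi> m) u" using u(1) gm unfolding weight_def by simp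
    note inv = eigenvalue_nonzero[OF B(2) uV u(2) m1]
    have "ac (g \<otimes> m \<otimes> inv g \<otimes> inv m) u = ac (g \<otimes> m \<otimes> inv g) (ac (inv m) u)"
      using B by (simp add: ac_mult[of "g \<otimes> m \<otimes> inv g" "inv m"] B_closed)
    also have "\<dots> = u" using u(1) c eq inv unfolding weight_def by (simp add: act_scal scal_scal)
    finally show "ac (g \<otimes> m \<otimes> inv g \<otimes> inv m) u = u" .
  qed
qed

text \<open>The weight space of \<open>M\<close> is invariant under \<Gamma> because the images of
  \<open>M\<close> and \<Gamma> commute. On it the commutator \<open>c\<close> of \<open>g\<close>
  and \<open>h\<close> is the scalar \<open>\<chi> c\<close>, so \<open>g\<close> maps an
  eigenvector of \<open>h\<close> to one whose eigenvalue is multiplied by z = 1 /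
  \<open>\<chi> c\<close>. There are finitely many eigenvalues, so z is a root of unity; on \<Gamma>
  this forces z = 1, and \<open>c\<close> fixes \<open>u\<close>.\<close>

lemma abelian_extension:
  assumes M: "B_normal M" "rho_abelian M" and K: "B_normal K"
    and comm: "\<And>x y. x \<in> K \<Longrightarrow> y \<in> K \<Longrightarrow> x \<otimes> y \<otimes> inv x \<otimes> inv y \<in> M"
  shows "rho_abelian K"
proof -
  obtain \<chi> u where u: "u \<in> weight M \<chi>" "u \<noteq> 0" using weight_nonempty[OF B_normalD(3)[OF M(1)] M(2)] by auto
  have uV: "u \<in> Vn n" using u(1) unfolding weight_def by simp
  note M' = B_normalD[OF M(1)] and K' = B_normalD[OF K]
  have inv: "ac x f \<in> weight M \<chi>" if "x \<in> \<Gamma>" "f \<in> weight M \<chi>" for x f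
  proof -
    have "ac m (ac x f) = scal (\<chi> m) (ac x f)" if "m \<in> M" for m
    proof -
      have B: "x \<in> B" "m \<in> B" using \<Gamma>_B M'(3) \<open>x \<in> \<Gamma>\<close> that by auto
      have "ac m (ac x f) = act n (\<rho> x * \<rho> m) f"
        using abelian_normal_central[OF M \<open>x \<in> \<Gamma>\<close> that] B by (simp add: act_mult \<rho>_carrier)
      also have "\<dots> = scal (\<chi> m) (ac x f)"
        using B \<open>f \<in> weight M \<chi>\<close> that unfolding weight_def by (simp add: act_mult \<rho>_carrier act_scal)
      finally show ?thesis .
    qed
    then show ?thesis unfolding weight_def by (simp add: act_Vn)
  qed
  show ?thesis unfolding rho_abelian_def
  proof (intro ballI, rule commutators_trivial[OF K K uV u(2)])
    fix g h assume gh: "g \<in> K" "h \<in> K"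
    have \<Gamma>: "g \<in> \<Gamma>" "h \<in> \<Gamma>" using gh K'(2) by auto
    then have B: "g \<in> B" "h \<in> B" using \<Gamma>_B by auto
    define c where "c = g \<otimes> h \<otimes> inv g \<otimes> inv h"
    have c: "c \<in> M" unfolding c_def by (rule comm[OF gh])
    then have cB: "c \<in> B" using M'(3) by auto
    have "\<exists>w\<in>weight M \<chi>. w \<noteq> 0 \<and> (\<exists>a. ac h w = scal a w)"
      by (rule act_eigenvector_in_invariant[OF subsp_weight _ inv[OF \<Gamma>(2)] u]) (auto simp: weight_def)
    then obtain w a where w: "w \<in> weight M \<chi>" "w \<noteq> 0" "ac h w = scal a w" by auto
    define z where "z = inverse (\<chi> c)"
    have cu: "ac c u = scal (\<chi> c) u" using u(1) c unfolding weight_def by simp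
    have c0: "\<chi> c \<noteq> 0" by (rule eigenvalue_nonzero(1)[OF cB uV u(2) cu])
    have wi: "ac (g [^] i) w \<in> weight M \<chi> \<and> ac (g [^] i) w \<noteq> 0 \<and> ac h (ac (g [^] i) w) = scal (z ^ i * a) (ac (g [^] i) w)" for i :: nat
    proof (induction i)
      case 0
      have "ac (g [^] (0::nat)) w = w" using w(1) ac_one[of w] unfolding weight_def by simp
      then show ?case using w by (simp only: power_0 mult_1 simp_thms)
    next
      case (Suc i)
      let ?v = "ac (g [^] i) w"
      have v: "?v \<in> weight M \<chi>" "?v \<noteq> 0" "ac h ?v = scal (z ^ i * a) ?v" using Suc by auto
      have vV: "?v \<in> Vn n" by (rule act_Vn)
      have S: "ac (g [^] Suc i) w = ac g ?v"
        unfolding nat_pow_Suc2[OF B_mem[OF B(1)]] by (rule ac_mult[OF B(1) B_pow[OF B(1)]])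
      have gv: "ac g ?v \<in> weight M \<chi>" by (rule inv[OF \<Gamma>(1) v(1)])
      have "ac c (ac h (ac g ?v)) = ac (c \<otimes> h \<otimes> g) ?v" using B cB by (simp add: ac_mult B_closed)
      also have "c \<otimes> h \<otimes> g = g \<otimes> h" unfolding c_def using B B_mem by (simp add: m_assoc)
      also have "ac (g \<otimes> h) ?v = scal (z ^ i * a) (ac g ?v)" using B v(3) by (simp add: ac_mult act_scal)
      finally have 1: "ac c (ac h (ac g ?v)) = scal (z ^ i * a) (ac g ?v)" .
      have "ac h (ac g ?v) \<in> weight M \<chi>" by (rule inv[OF \<Gamma>(2) gv])
      then have "ac c (ac h (ac g ?v)) = scal (\<chi> c) (ac h (ac g ?v))" using c unfolding weight_def by simp
      then have "scal z (scal (\<chi> c) (ac h (ac g ?v))) = scal z (scal (z ^ i * a) (ac g ?v))" using 1 by simp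
      then have "ac h (ac g ?v) = scal (z ^ Suc i * a) (ac g ?v)" using c0 unfolding z_def by (simp add: scal_scal mult.assoc)
      moreover have "ac g ?v \<noteq> 0" using ac_eq_0_iff[OF B(1) vV] v(2) by (simp only: simp_thms)
      ultimately show ?case unfolding S using gv by (simp only: simp_thms)
    qed
    have a0: "a \<noteq> 0" using eigenvalue_nonzero(1)[OF B(2) _ w(2,3)] w(1) unfolding weight_def by simp
    let ?P = "map_poly complex_of_int (char_poly (\<rho> h))"
    have "poly ?P (z ^ i * a) = 0" for i :: nat
    proof (rule eigenvalue_of_act[OF \<rho>_carrier[OF B(2)]])
      show "ac (g [^] i) w \<in> Vn n" by (rule act_Vn)
    qed (use wi[of i] in \<open>simp_all only: simp_thms\<close>)
    then have "range (\<lambda>i. z ^ i * a) \<subseteq> {x. poly ?P x = 0}" by auto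
    moreover have "?P \<noteq> 0" using degree_monic_char_poly[OF \<rho>_carrier[OF B(2)]] by auto
    ultimately have "finite (range (\<lambda>i::nat. z ^ i * a))" using poly_roots_finite finite_subset by blast
    then have "\<not> inj (\<lambda>i::nat. z ^ i * a)" using range_inj_infinite by blast
    then obtain i j :: nat where "i \<noteq> j" "z ^ i = z ^ j" using a0 unfolding inj_def by auto
    then have "\<exists>i j :: nat. i < j \<and> z ^ i = z ^ j" by (metis linorder_neqE_nat)
    then obtain i j :: nat where ij: "i < j" "z ^ i = z ^ j" by blast
    have z0: "z \<noteq> 0" using c0 unfolding z_def by simp
    have "z ^ j = z ^ i * z ^ (j - i)" using ij(1) by (simp flip: power_add)
    then have "z ^ (j - i) = 1" using ij(2) z0 by simp
    \<comment> \<open>\<open>w\<close> and its image under \<open>g\<close> are eigenvectors of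
      \<open>h\<close> whose eigenvalues have ratio \<open>z\<close>.\<close>
    then have "z = 1"
      using \<Gamma>_eigenvalue_ratio[OF \<Gamma>(2), of w a "ac (g [^] (1::nat)) w" z "j - i"] wi[of 1] w ij(1)
      by (auto simp: weight_def)
    then have "\<chi> c = 1" unfolding z_def by simp
    then show "ac (g \<otimes> h \<otimes> inv g \<otimes> inv h) u = u" using cu unfolding c_def by simp
  qed
qed

text \<open>A weight vector of \<open>N\<close> is an eigenvector of a positive power of each
  element of \<Gamma>, hence of the element itself, and is fixed by all commutators.\<close>

lemma \<Gamma>_abelian:
  assumes N: "B_normal N" "rho_abelian N" and per: "\<And>g. g \<in> \<Gamma> \<Longrightarrow> \<exists>t>0. g [^] (t::nat) \<in> N"
  shows "rho_abelian \<Gamma>"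
proof -
  obtain \<chi> u where u: "u \<in> weight N \<chi>" "u \<noteq> 0" using weight_nonempty[OF B_normalD(3)[OF N(1)] N(2)] by auto
  have uV: "u \<in> Vn n" using u(1) unfolding weight_def by simp
  have ev: "\<exists>b. ac g u = scal b u" if g: "g \<in> \<Gamma>" for g
  proof -
    obtain t where t: "t > 0" "g [^] (t::nat) \<in> N" using per[OF g] by auto
    then have "ac (g [^] t) u = scal (\<chi> (g [^] t)) u" using u(1) unfolding weight_def by simp
    then show ?thesis using \<Gamma>_eigenvector_of_power[OF g uV u(2) _ t(1)] by blast
  qed
  show ?thesis unfolding rho_abelian_def
  proof (intro ballI, rule commutators_trivial[OF B_normal_\<Gamma> B_normal_\<Gamma> uV u(2)])
    fix g h assume gh: "g \<in> \<Gamma>" "h \<in> \<Gamma>"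
    then have B: "g \<in> B" "h \<in> B" using \<Gamma>_B by auto
    obtain a b where ab: "ac g u = scal a u" "ac h u = scal b u" using ev gh by blast
    note ga = eigenvalue_nonzero[OF B(1) uV u(2) ab(1)] and hb = eigenvalue_nonzero[OF B(2) uV u(2) ab(2)]
    have "ac (g \<otimes> h \<otimes> inv g \<otimes> inv h) u = ac g (ac h (ac (inv g) (ac (inv h) u)))"
      using B by (simp add: ac_mult B_closed)
    also have "\<dots> = u" using ab ga hb by (simp add: act_scal scal_scal field_simps)
    finally show "ac (g \<otimes> h \<otimes> inv g \<otimes> inv h) u = u" .
  qed
qed

end

context group begin

text \<open>Models a derived series read upwards, with finite index of its top replaced by powers;
  both conditions survive intersection with \<Gamma>. The terms are normal in the whole group, so
  one chain serves every subgroup \<open>B\<close>.\<close>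

definition solvable_chain :: "(nat \<Rightarrow> 'a set) \<Rightarrow> nat \<Rightarrow> bool" where
  "solvable_chain D k \<longleftrightarrow> D 0 = {\<one>} \<and> (\<forall>i. subgroup (D i) G) \<and>
     (\<forall>i. \<forall>g\<in>carrier G. \<forall>x\<in>D i. g \<otimes> x \<otimes> inv g \<in> D i) \<and>
     (\<forall>i. \<forall>x\<in>D (Suc i). \<forall>y\<in>D (Suc i). x \<otimes> y \<otimes> inv x \<otimes> inv y \<in> D i) \<and>
     (\<forall>g\<in>carrier G. \<exists>t>0. g [^] (t::nat) \<in> D k)"

lemma solvable_chainD:
  assumes "solvable_chain D k"
  shows "D 0 = {\<one>}" "subgroup (D i) G" "g \<in> carrier G \<Longrightarrow> x \<in> D i \<Longrightarrow> g \<otimes> x \<otimes> inv g \<in> D i"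
    "x \<in> D (Suc i) \<Longrightarrow> y \<in> D (Suc i) \<Longrightarrow> x \<otimes> y \<otimes> inv x \<otimes> inv y \<in> D i"
    "g \<in> carrier G \<Longrightarrow> \<exists>t>0. g [^] (t::nat) \<in> D k"
  using assms unfolding solvable_chain_def by simp_all

end

context irreducible_rep begin

abbreviation X where "X \<equiv> chars n \<Gamma> \<rho>"

lemma char_eigenvector:
  assumes "\<chi> \<in> X"
  shows "\<exists>u. u \<in> Vn n \<and> u \<noteq> 0 \<and> (\<forall>x\<in>\<Gamma>. ac x u = scal (\<chi> x) u)"
  using assms unfolding chars_def by auto

lemma char_mult:
  assumes \<chi>: "\<chi> \<in> X" and x: "x \<in> \<Gamma>" "y \<in> \<Gamma>"
  shows "\<chi> (x \<otimes> y) = \<chi> x * \<chi> y"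
proof -
  obtain u where u: "u \<in> Vn n" "u \<noteq> 0" "\<forall>x\<in>\<Gamma>. ac x u = scal (\<chi> x) u" using char_eigenvector[OF \<chi>] by auto
  have xy: "x \<otimes> y \<in> \<Gamma>" by (rule subgroup.m_closed[OF subgroup_\<Gamma> x])
  have B: "x \<in> B" "y \<in> B" using x \<Gamma>_B by auto
  have "ac (x \<otimes> y) u = scal (\<chi> x * \<chi> y) u"
    using u(3) x B by (simp add: ac_mult act_scal scal_scal mult.commute)
  then show ?thesis using u(2,3) xy B by (intro weight_unique[of "x \<otimes> y" u]) (auto intro: B_closed)
qed

lemma char_nonzero: "\<chi> \<in> X \<Longrightarrow> x \<in> \<Gamma> \<Longrightarrow> \<chi> x \<noteq> 0"
  using char_eigenvector[of \<chi>] eigenvalue_nonzero(1)[of x _ "\<chi> x"] \<Gamma>_B by blast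

lemma char_ker:
  assumes \<chi>: "\<chi> \<in> X" and x: "x \<in> ker"
  shows "\<chi> x = 1"
proof -
  obtain u where u: "u \<in> Vn n" "u \<noteq> 0" "\<forall>x\<in>\<Gamma>. ac x u = scal (\<chi> x) u" using char_eigenvector[OF \<chi>] by auto
  have xB: "x \<in> B" "\<rho> x = 1\<^sub>m n" using x unfolding ker_def by auto
  have "ac x u = scal 1 u" using u(1) xB(2) by (simp add: act_one)
  moreover have "ac x u = scal (\<chi> x) u" using u(3) x ker_\<Gamma> by auto
  ultimately show ?thesis using weight_unique[OF xB(1) u(2)] by metis
qed

lemma char_one: "\<chi> \<in> X \<Longrightarrow> \<chi> \<one> = 1"
  by (rule char_ker) (simp_all add: ker_def \<rho>_one B_closed)

lemma char_inv: "\<chi> \<in> X \<Longrightarrow> x \<in> \<Gamma> \<Longrightarrow> \<chi> (inv x) = inverse (\<chi> x)"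
  using char_mult[of \<chi> x "inv x"] char_one[of \<chi>] subgroup.m_inv_closed[OF subgroup_\<Gamma>, of x]
    subgroup.mem_carrier[OF subgroup_\<Gamma>, of x] by (simp add: inverse_unique)

lemma char_pow: "\<chi> \<in> X \<Longrightarrow> x \<in> \<Gamma> \<Longrightarrow> \<chi> (x [^] (k::nat)) = \<chi> x ^ k"
  by (induction k) (simp_all add: char_one char_mult subgroup_nat_pow_closed[OF subgroup_\<Gamma>])

text \<open>\<open>inv x\<close> carries an eigenvector for \<open>\<chi>\<close> to one for the
  conjugate character. Thus \<open>B\<close> permutes the characters, and their joint kernel is
  invariant.\<close>

lemma char_conj:
  assumes \<chi>: "\<chi> \<in> X" and x: "x \<in> B"
  shows "(\<lambda>g. if g \<in> \<Gamma> then \<chi> (x \<otimes> g \<otimes> inv x) else 0) \<in> X"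
proof -
  obtain u where u: "u \<in> Vn n" "u \<noteq> 0" "\<forall>x\<in>\<Gamma>. ac x u = scal (\<chi> x) u" using char_eigenvector[OF \<chi>] by auto
  have "ac g (ac (inv x) u) = scal (\<chi> (x \<otimes> g \<otimes> inv x)) (ac (inv x) u)" if g: "g \<in> \<Gamma>" for g
  proof -
    have B: "g \<in> B" "inv x \<in> B" using g \<Gamma>_B x B_closed by auto
    have c: "x \<otimes> g \<otimes> inv x \<in> \<Gamma>" by (rule \<Gamma>_conj[OF x g])
    have "ac g (ac (inv x) u) = ac (inv x \<otimes> (x \<otimes> g \<otimes> inv x)) u"
      using B x B_mem by (simp add: m_assoc mult_inv_cancel flip: ac_mult)
    also have "\<dots> = ac (inv x) (ac (x \<otimes> g \<otimes> inv x) u)" using B c \<Gamma>_B by (auto intro: ac_mult)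
    finally show ?thesis using u(3) c by (simp add: act_scal)
  qed
  then show ?thesis unfolding chars_def
    using ac_eq_0_iff[OF B_closed(2)[OF x] u(1)] u(2) by (auto intro!: bexI[of _ "ac (inv x) u"] simp: act_Vn)
qed

lemma X_nonempty:
  assumes "rho_abelian \<Gamma>"
  shows "\<exists>\<chi> u. \<chi> \<in> X \<and> u \<in> Vn n \<and> u \<noteq> 0 \<and> (\<forall>x\<in>\<Gamma>. ac x u = scal (\<chi> x) u)"
proof -
  obtain \<chi> u where u: "u \<in> weight \<Gamma> \<chi>" "u \<noteq> 0" using weight_nonempty[OF \<Gamma>_B assms] by auto
  let ?\<chi> = "\<lambda>g. if g \<in> \<Gamma> then \<chi> g else 0"
  have "u \<in> Vn n" "\<forall>x\<in>\<Gamma>. ac x u = scal (?\<chi> x) u" using u(1) unfolding weight_def by auto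
  moreover from this u(2) have "?\<chi> \<in> X" unfolding chars_def by auto
  ultimately show ?thesis using u(2) by blast
qed

text \<open>The joint kernel of the characters is invariant under conjugation and fixes an
  eigenvector, so irreducibility makes it act trivially. Hence the characters separate elements of
  \<Gamma> modulo \<open>ker\<close>.\<close>

lemma joint_kernel:
  assumes ab: "rho_abelian \<Gamma>" and c: "c \<in> \<Gamma>" "\<And>\<chi>. \<chi> \<in> X \<Longrightarrow> \<chi> c = 1"
  shows "c \<in> ker"
proof -
  obtain \<chi> u where u: "\<chi> \<in> X" "u \<in> Vn n" "u \<noteq> 0" "\<forall>x\<in>\<Gamma>. ac x u = scal (\<chi> x) u"
    using X_nonempty[OF ab] by auto
  let ?L = "{x \<in> \<Gamma>. \<forall>\<chi>\<in>X. \<chi> x = 1}"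
  have "\<rho> c = 1\<^sub>m n"
  proof (rule irr_complex[where C = ?L, OF _ _ u(2,3)])
    show "?L \<subseteq> B" using \<Gamma>_B by auto
    show "x \<otimes> g \<otimes> inv x \<in> ?L" if "x \<in> B" "g \<in> ?L" for x g
    proof -
      have g: "g \<in> \<Gamma>" using that(2) by auto
      have "\<chi> (x \<otimes> g \<otimes> inv x) = 1" if \<chi>: "\<chi> \<in> X" for \<chi>
        using char_conj[OF \<chi> \<open>x \<in> B\<close>] \<open>g \<in> ?L\<close> by fastforce
      then show ?thesis using \<Gamma>_conj[OF \<open>x \<in> B\<close> g] by auto
    qed
    show "ac x u = u" if "x \<in> ?L" for x using that u(1,4) by auto
  qed (use c in auto)
  then show ?thesis unfolding ker_def using c(1) \<Gamma>_B by auto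
qed

text \<open>The eigenspace of \<open>x\<close> for \<open>b\<close> is invariant under the commuting
  matrices of \<Gamma> and contains a common eigenvector. So a bound on the characters at
  \<open>x\<close> bounds all eigenvalues of \<open>x\<close>, as
  \<open>finite_bounded_eigenvalues\<close> demands.\<close>

lemma eigenvalue_char:
  assumes ab: "rho_abelian \<Gamma>" and x: "x \<in> \<Gamma>" and v: "v \<in> Vn n" "v \<noteq> 0" "ac x v = scal b v"
  shows "\<exists>\<chi>\<in>X. \<chi> x = b"
proof -
  let ?S = "{f \<in> Vn n. ac x f = scal b f}"
  have S: "subsp ?S" unfolding subsp_def using subspD[OF subsp_Vn[of n]]
    by (auto simp: act_add scal_add act_scal scal_scal mult.commute)
  have B: "y \<in> B" if "y \<in> \<Gamma>" for y using that \<Gamma>_B by auto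
  have "ac y f \<in> ?S" if "y \<in> \<Gamma>" "f \<in> ?S" for y f
  proof -
    have "ac x (ac y f) = act n (\<rho> x * \<rho> y) f" using B x that by (simp add: act_mult \<rho>_carrier)
    also have "\<dots> = act n (\<rho> y * \<rho> x) f" using ab x that unfolding rho_abelian_def by simp
    also have "\<dots> = ac y (ac x f)" using B x that by (simp add: act_mult \<rho>_carrier)
    also have "\<dots> = scal b (ac y f)" using that by (simp add: act_scal)
    finally show ?thesis by (simp add: act_Vn)
  qed
  then have "\<exists>\<chi>. \<exists>u\<in>?S. u \<noteq> 0 \<and> (\<forall>x\<in>\<Gamma>. ac x u = scal (\<chi> x) u)"
    by (intro common_eigenvector[OF _ _ S]) (use ab v B \<rho>_carrier in \<open>auto simp: rho_abelian_def\<close>)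
  then obtain \<chi> u where u: "u \<in> ?S" "u \<noteq> 0" "\<forall>x\<in>\<Gamma>. ac x u = scal (\<chi> x) u" by auto
  let ?\<chi> = "\<lambda>g. if g \<in> \<Gamma> then \<chi> g else 0"
  have "?\<chi> \<in> X" unfolding chars_def using u by auto
  moreover have "?\<chi> x = b" using u x weight_unique[of x u "\<chi> x" b] B by auto
  ultimately show ?thesis by (intro bexI[of _ ?\<chi>])
qed

text \<open>Labels are the lists of character values, coordinates the logarithms of their absolute
  values. Labels determine cosets by \<open>joint_kernel\<close>; torsion is excluded since no
  character takes a root of unity other than 1 as value; a box bounds all eigenvalues and so leaves
  finitely many labels.\<close>

lemma \<Gamma>_discrete:
  assumes ab: "rho_abelian \<Gamma>"
  shows "\<exists>s\<le>n. \<exists>\<phi>. \<exists>\<kappa> :: 'a \<Rightarrow> complex list. discrete_mod s ker \<Gamma> \<phi> \<kappa>"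
proof -
  obtain e where "bij_betw e {0..<card X} X" using chars_finite[of n \<Gamma> \<rho>] ex_bij_betw_nat_finite by blast
  then obtain d where d: "d = card X" and e: "e ` {0..<d} = X" using bij_betw_imp_surj_on by blast
  have eX: "e i \<in> X" if "i < d" for i unfolding e[symmetric] using that by simp
  have Xe: "\<exists>i<d. \<chi> = e i" if "\<chi> \<in> X" for \<chi> using that unfolding e[symmetric] by auto
  let ?\<phi> = "\<lambda>i x. ln (cmod (e i x))" and ?\<kappa> = "\<lambda>x. map (\<lambda>i. e i x) [0..<d]"
  have "discrete_mod (d) ker \<Gamma> ?\<phi> ?\<kappa>"
    unfolding discrete_mod_def
  proof (intro conjI allI impI ballI)
    show "ln (cmod (e i (x \<otimes> y))) = ln (cmod (e i x)) + ln (cmod (e i y))"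
      if "i < d" "x \<in> \<Gamma>" "y \<in> \<Gamma>" for i x y
      using char_mult[OF eX[OF that(1)] that(2,3)] char_nonzero[OF eX[OF that(1)]] that
      by (simp add: norm_mult ln_mult)
    show "ln (cmod (e i x)) = 0" if "i < d" "x \<in> ker" for i x
      using char_ker[OF eX[OF that(1)] that(2)] by simp
    show "x \<in> ker" if x: "x \<in> \<Gamma>" and k: "0 < k" "x [^] (k::nat) \<in> ker" for x k
    proof (rule joint_kernel[OF ab x])
      fix \<chi> assume \<chi>: "\<chi> \<in> X"
      obtain u where u: "u \<in> Vn n" "u \<noteq> 0" "\<forall>x\<in>\<Gamma>. ac x u = scal (\<chi> x) u" using char_eigenvector[OF \<chi>] by auto
      have "\<chi> x ^ k = 1" using char_pow[OF \<chi> x, of k] char_ker[OF \<chi> k(2)] by simp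
      then show "\<chi> x = 1" using \<Gamma>_eigenvalue_root_of_unity[OF x u(1,2), of "\<chi> x" k] u(3) x k(1) by simp
    qed
    show "x \<otimes> inv y \<in> ker" if "x \<in> \<Gamma>" "y \<in> \<Gamma>" "?\<kappa> x = ?\<kappa> y" for x y
    proof (rule joint_kernel[OF ab])
      have iy: "inv y \<in> \<Gamma>" by (rule subgroup.m_inv_closed[OF subgroup_\<Gamma> that(2)])
      show "x \<otimes> inv y \<in> \<Gamma>" by (rule subgroup.m_closed[OF subgroup_\<Gamma> that(1) iy])
      fix \<chi> assume \<chi>: "\<chi> \<in> X"
      then obtain i where "i < d" "\<chi> = e i" using Xe by blast
      then have "\<chi> x = \<chi> y" using that(3) by simp
      then show "\<chi> (x \<otimes> inv y) = 1"
        using char_mult[OF \<chi> that(1) iy] char_inv[OF \<chi> that(2)] char_nonzero[OF \<chi> that(2)] by simp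
    qed
    fix c :: real
    let ?Z = "{a :: complex. \<exists>A u. A \<in> carrier_mat n n \<and> u \<in> Vn n \<and> u \<noteq> 0 \<and> act n A u = scal a u \<and>
     (\<forall>b v. v \<in> Vn n \<longrightarrow> v \<noteq> 0 \<longrightarrow> act n A v = scal b v \<longrightarrow> cmod b \<le> exp c)}"
    show "finite (?\<kappa> ` {x \<in> \<Gamma>. \<forall>i<d. \<bar>?\<phi> i x\<bar> \<le> c})"
    proof (rule finite_subset)
      show "finite {xs. set xs \<subseteq> ?Z \<and> length xs = d}"
        using finite_bounded_eigenvalues by (rule finite_lists_length_eq)
      have "e i x \<in> ?Z" if x: "x \<in> \<Gamma>" "\<forall>i<d. \<bar>?\<phi> i x\<bar> \<le> c" and i: "i < d" for x i
      proof -
        obtain u where u: "u \<in> Vn n" "u \<noteq> 0" "\<forall>x\<in>\<Gamma>. ac x u = scal (e i x) u" using char_eigenvector[OF eX[OF i]] by auto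
        have bound: "cmod b \<le> exp c" if v: "v \<in> Vn n" "v \<noteq> 0" "ac x v = scal b v" for b v
        proof -
          obtain j where j: "j < d" "e j x = b" using eigenvalue_char[OF ab x(1) v] Xe by metis
          have "ln (cmod b) \<le> c" using x(2) j by fastforce
          moreover have "cmod b > 0" using char_nonzero[OF eX[OF j(1)] x(1)] j(2) by simp
          ultimately show ?thesis by (metis exp_le_cancel_iff exp_ln)
        qed
        show ?thesis
        proof (intro CollectI exI[of _ "\<rho> x"] exI[of _ u] conjI allI impI)
          show "\<rho> x \<in> carrier_mat n n" by (rule \<rho>_carrier) (use x(1) \<Gamma>_B in blast)
          show "ac x u = scal (e i x) u" using u(3) x(1) by blast
        qed (fact u(1) u(2) | rule bound; assumption)+
      qed
      then have "set (?\<kappa> x) \<subseteq> ?Z" if "x \<in> {x \<in> \<Gamma>. \<forall>i<d. \<bar>?\<phi> i x\<bar> \<le> c}" for x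
        using that unfolding set_map by (intro image_subsetI) simp
      then show "?\<kappa> ` {x \<in> \<Gamma>. \<forall>i<d. \<bar>?\<phi> i x\<bar> \<le> c} \<subseteq> {xs. set xs \<subseteq> ?Z \<and> length xs = d}"
        by (intro image_subsetI CollectI conjI) simp_all
    qed
  qed (use subgroup_ker ker_\<Gamma> in auto)
  then show ?thesis using chars_finite[of n \<Gamma> \<rho>] d by blast
qed

text \<open>\<open>abelian_extension\<close> climbs the chain intersected with \<Gamma>, and
  \<open>\<Gamma>_abelian\<close> covers the periodic top.\<close>

lemma \<Gamma>_abelian_of_chain:
  assumes D: "solvable_chain D k"
  shows "rho_abelian \<Gamma>"
proof -
  note D' = solvable_chainD[OF D]
  have N: "B_normal (D i \<inter> \<Gamma>)" for i
    unfolding B_normal_def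
    using subgroups_Inter_pair[OF D'(2) subgroup_\<Gamma>] D'(3) \<Gamma>_conj B_mem by auto
  have "rho_abelian (D i \<inter> \<Gamma>)" for i
  proof (induction i)
    case 0 show ?case unfolding D'(1) rho_abelian_def by auto
  next
    case (Suc i)
    show ?case
    proof (rule abelian_extension[OF N Suc N])
      fix x y assume xy: "x \<in> D (Suc i) \<inter> \<Gamma>" "y \<in> D (Suc i) \<inter> \<Gamma>"
      have "x \<otimes> y \<otimes> inv x \<otimes> inv y \<in> \<Gamma>"
        using xy by (intro subgroup.m_closed[OF subgroup_\<Gamma>] subgroup.m_inv_closed[OF subgroup_\<Gamma>]) auto
      then show "x \<otimes> y \<otimes> inv x \<otimes> inv y \<in> D i \<inter> \<Gamma>" using xy D'(4) by auto
    qed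
  qed
  then show ?thesis
  proof (rule \<Gamma>_abelian[OF N])
    fix g assume g: "g \<in> \<Gamma>"
    then obtain t where "t > 0" "g [^] (t::nat) \<in> D k" using D'(5)[of g] subgroup.mem_carrier[OF subgroup_\<Gamma>] by auto
    then show "\<exists>t>0. g [^] (t::nat) \<in> D k \<inter> \<Gamma>" using subgroup_nat_pow_closed[OF subgroup_\<Gamma> g] by auto
  qed
qed

lemma power_in_\<Gamma>:
  assumes x: "x \<in> B"
  shows "\<exists>k>0. x [^] (k::nat) \<in> \<Gamma>"
proof -
  interpret F: group "GL n (UNIV :: f3 set)" by (rule GL_group)
  have c: "red3 y \<in> carrier (GL n (UNIV :: f3 set))" if "y \<in> B" for y
    using red3_hom that unfolding hom_def by auto
  have "red3 (x [^] k) = red3 x [^]\<^bsub>GL n (UNIV :: f3 set)\<^esub> k" for k :: nat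
    by (induction k) (simp_all add: red3_one red3_mult B_pow x)
  then have "red3 (x [^] Coset.order (GL n (UNIV :: f3 set))) = 1\<^sub>m n"
    using group.pow_order_eq_1[OF GL_group c[OF x]] by simp
  moreover have "Coset.order (GL n (UNIV :: f3 set)) > 0" using F.order_gt_0_iff_finite GL_f3_finite by simp
  ultimately show ?thesis using B_pow[OF x] unfolding \<Gamma>_def by blast
qed

text \<open>\<Gamma> modulo \<open>ker\<close> contributes at most \<open>n\<close> to both numbers.
  The finite quotient adds \<open>n * n + n div 2\<close> to the rank and, being periodic, nothing
  to the Hirsch number.\<close>

theorem irreducible_bounds:
  assumes "solvable_chain D k"
  shows "relgen ker B (n * n + (3 * n) div 2) \<and> (\<exists>h\<le>n. ser ker B h)"
proof -
  obtain s \<phi> and \<kappa> :: "'a \<Rightarrow> complex list" where s: "s \<le> n" "discrete_mod s ker \<Gamma> \<phi> \<kappa>"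
    using \<Gamma>_discrete[OF \<Gamma>_abelian_of_chain[OF assms]] by blast
  have "relgen ker \<Gamma> s" by (rule discrete_relgen[OF subgroup_\<Gamma> s(2)])
  then have "relgen ker \<Gamma> n" by (rule relgen_mono[OF _ s(1)])
  moreover have "\<Gamma> = {b \<in> B. red3 b = \<one>\<^bsub>GL n (UNIV :: f3 set)\<^esub>}" unfolding \<Gamma>_def by simp
  then have "relgen \<Gamma> B (n * n + n div 2)"
    by (intro relgen_mono[OF relgen_finite[OF GL_group GL_f3_finite B red3_hom] GL_f3_order])
  ultimately have "relgen ker B (n + (n * n + n div 2))" by (rule relgen_trans[OF _ _ subgroup_\<Gamma>])
  then have "relgen ker B (n * n + (3 * n) div 2)" by (rule relgen_mono) simp
  moreover obtain h where h: "h \<le> s" "ser ker \<Gamma> h" using discrete_rank[OF subgroup_\<Gamma> s(2)] by blast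
  have "ser ker B h" by (intro ser.per[OF h(2) B \<Gamma>_B \<Gamma>_conj power_in_\<Gamma>])
  then have "\<exists>h\<le>n. ser ker B h" using order_trans[OF h(1) s(1)] by (intro exI[of _ h] conjI)
  ultimately show ?thesis by (rule conjI)
qed

end

section \<open>Rational representations with bounded denominators\<close>

lemma mat_inverse_exists:
  fixes A :: "'k :: field mat"
  assumes "A \<in> carrier_mat n n" "det A \<noteq> 0"
  shows "\<exists>B\<in>carrier_mat n n. A * B = 1\<^sub>m n \<and> B * A = 1\<^sub>m n"
  using det_non_zero_imp_unit[OF assms, of "()"] unfolding Units_def ring_mat_def by auto

lemma upper_triangular_det_nonzero:
  fixes A :: "'k :: field mat"
  assumes "A \<in> carrier_mat n n" "upper_triangular A" "\<And>i. i < n \<Longrightarrow> A $$ (i, i) \<noteq> 0"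
  shows "det A \<noteq> 0"
  using assms by (auto simp: det_upper_triangular[OF assms(2,1)] prod_list_zero_iff diag_mat_def)

text \<open>Hermite normal form: the pivot \<open>m j\<close> is the least positive entry at
  \<open>j\<close> among lattice vectors that vanish beyond \<open>j\<close>, and it exists because
  of the multiples of unit vectors. Division with remainder by the pivots, from the highest index
  downwards, gives integral coordinates.\<close>

lemma triangular_lattice_basis:
  fixes L :: "rat vec set"
  assumes L: "L \<subseteq> carrier_vec d" and int: "\<And>v i. v \<in> L \<Longrightarrow> i < d \<Longrightarrow> v $ i \<in> \<int>"
    and diff: "\<And>v w k. v \<in> L \<Longrightarrow> w \<in> L \<Longrightarrow> v - of_int k \<cdot>\<^sub>v w \<in> L"
    and N: "N > 0" "\<And>j. j < d \<Longrightarrow> of_int N \<cdot>\<^sub>v unit_vec d j \<in> L"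
  shows "\<exists>P\<in>carrier_mat d d. \<exists>Q\<in>carrier_mat d d. P * Q = 1\<^sub>m d \<and> Q * P = 1\<^sub>m d \<and>
    (\<forall>j<d. col P j \<in> L) \<and> (\<forall>v\<in>L. \<forall>i<d. (Q *\<^sub>v v) $ i \<in> \<int>)"
proof -
  define S where "S j a \<longleftrightarrow> a > 0 \<and> (\<exists>v\<in>L. (\<forall>i. j < i \<and> i < d \<longrightarrow> v $ i = 0) \<and> v $ j = rat_of_nat a)" for j a
  define m where "m j = (LEAST a. S j a)" for j
  have S: "S j (m j)" if j: "j < d" for j
  proof -
    have "S j (nat N)"
      unfolding S_def using N(1) j by (auto intro!: bexI[OF _ N(2)[OF j]])
    then show ?thesis unfolding m_def by (rule LeastI)
  qed
  then have "\<forall>j. \<exists>v. j < d \<longrightarrow> v \<in> L \<and> (\<forall>i. j < i \<and> i < d \<longrightarrow> v $ i = 0) \<and> v $ j = rat_of_nat (m j)"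
    unfolding S_def by blast
  then obtain b where b: "\<And>j. j < d \<Longrightarrow> b j \<in> L \<and> (\<forall>i. j < i \<and> i < d \<longrightarrow> b j $ i = 0) \<and> b j $ j = rat_of_nat (m j)"
    by metis
  have m0: "m j > 0" if "j < d" for j using S[OF that] unfolding S_def by simp
  have min: "m j \<le> a" if "j < d" "v \<in> L" "\<forall>i. j < i \<and> i < d \<longrightarrow> v $ i = 0" "v $ j = rat_of_nat a" "a > 0" for j a v
    unfolding m_def using that by (intro Least_le) (auto simp: S_def)
  define P where "P = mat d d (\<lambda>(i, j). b j $ i)"
  have P: "P \<in> carrier_mat d d" unfolding P_def by simp
  have colP: "col P j = b j" if "j < d" for j
    using b[OF that] L that unfolding P_def by (intro eq_vecI) auto
  have "det P \<noteq> 0"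
  proof (rule upper_triangular_det_nonzero[OF P])
    show "upper_triangular P" using b unfolding P_def upper_triangular_def by auto
    show "P $$ (i, i) \<noteq> 0" if "i < d" for i using b[OF that] m0[OF that] that unfolding P_def by simp
  qed
  then obtain Q where Q: "Q \<in> carrier_mat d d" "P * Q = 1\<^sub>m d" "Q * P = 1\<^sub>m d"
    using mat_inverse_exists[OF P] by blast
  have Qb: "(Q *\<^sub>v b j) $ i = (if i = j then 1 else 0)" if "i < d" "j < d" for i j
  proof -
    have "Q *\<^sub>v b j = col (Q * P) j" using Q(1) P that colP by simp
    then show ?thesis unfolding Q(3) using that by simp
  qed
  have "\<forall>i<d. (Q *\<^sub>v v) $ i \<in> \<int>" if "k \<le> d" "v \<in> L" "\<forall>i. k \<le> i \<and> i < d \<longrightarrow> v $ i = 0" for k v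
    using that
  proof (induction k arbitrary: v)
    case 0
    then have "v = 0\<^sub>v d" using L by (intro eq_vecI) auto
    then show ?case using Q(1) by simp
  next
    case (Suc k)
    have k: "k < d" using Suc.prems(1) by simp
    obtain c where c: "v $ k = of_int c" using int[OF Suc.prems(2) k] by (auto elim: Ints_cases)
    \<comment> \<open>The remainder at \<open>k\<close> is smaller than the pivot, so by minimality
      it vanishes.\<close>
    define q where "q = c div int (m k)"
    define w where "w = v - of_int q \<cdot>\<^sub>v b k"
    have bL: "b k \<in> L" "b k \<in> carrier_vec d" "v \<in> carrier_vec d" using b[OF k] Suc.prems(2) L by auto
    have wL: "w \<in> L" unfolding w_def by (rule diff[OF Suc.prems(2) bL(1)])
    have wi: "w $ i = v $ i - of_int q * b k $ i" if "i < d" for i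
      unfolding w_def using that bL by simp
    have w0: "\<forall>i. k < i \<and> i < d \<longrightarrow> w $ i = 0" using wi Suc.prems(3) b[OF k] by auto
    have "w $ k = of_int (c - q * int (m k))" using wi[OF k] c b[OF k] by simp
    also have "c - q * int (m k) = int (nat (c mod int (m k)))"
      unfolding q_def using m0[OF k] by (simp add: minus_div_mult_eq_mod)
    finally have wk: "w $ k = rat_of_nat (nat (c mod int (m k)))" by simp
    have "nat (c mod int (m k)) < m k" using m0[OF k] by (simp add: nat_less_iff)
    then have "nat (c mod int (m k)) = 0" using min[OF k wL w0 wk] by linarith
    then have "w $ k = 0" using wk by simp
    then have "\<forall>i. k \<le> i \<and> i < d \<longrightarrow> w $ i = 0" using w0 by (metis le_neq_implies_less)
    then have IH: "\<forall>i<d. (Q *\<^sub>v w) $ i \<in> \<int>" using Suc.IH[of w] k wL by simp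
    have "v = w + of_int q \<cdot>\<^sub>v b k" unfolding w_def using bL by (intro eq_vecI) auto
    then have "Q *\<^sub>v v = Q *\<^sub>v w + of_int q \<cdot>\<^sub>v (Q *\<^sub>v b k)"
      using Q(1) bL wL L by (auto simp: mult_add_distrib_mat_vec mult_mat_vec)
    then have "(Q *\<^sub>v v) $ i = (Q *\<^sub>v w) $ i + of_int q * (Q *\<^sub>v b k) $ i" if "i < d" for i
      using that Q(1) bL by simp
    then show ?case using IH Qb[OF _ k] by auto
  qed
  from this[of d] have "\<forall>v\<in>L. \<forall>i<d. (Q *\<^sub>v v) $ i \<in> \<int>" by auto
  then show ?thesis using P Q colP b by (intro bexI[of _ P] bexI[of _ Q] conjI) auto
qed

text \<open>Serves to move the pivot columns of \<open>adapted_basis\<close> to the front.\<close>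

lemma enumerate_subset:
  assumes "J \<subseteq> {..<d}"
  shows "\<exists>\<sigma>. inj_on \<sigma> {..<d} \<and> \<sigma> ` {..<d} = {..<d} \<and> (\<forall>i<card J. \<sigma> i \<in> J) \<and> (\<forall>i. card J \<le> i \<and> i < d \<longrightarrow> \<sigma> i \<notin> J)"
proof -
  have fin: "finite J" using assms finite_subset by blast
  define xs where "xs = sorted_list_of_set J @ sorted_list_of_set ({..<d} - J)"
  have len: "length (sorted_list_of_set J) = card J" using fin by simp
  have xs: "distinct xs" "set xs = {..<d}" using fin assms unfolding xs_def by auto
  have l: "length xs = d" using distinct_card[OF xs(1)] xs(2) by simp
  have 1: "xs ! i \<in> J" if "i < card J" for i
    using that len nth_mem[of i "sorted_list_of_set J"] fin unfolding xs_def by (simp add: nth_append)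
  have 2: "xs ! i \<notin> J" if "card J \<le> i" "i < d" for i
  proof -
    have "i - card J < length (sorted_list_of_set ({..<d} - J))" using that l len unfolding xs_def by simp
    from nth_mem[OF this] have "sorted_list_of_set ({..<d} - J) ! (i - card J) \<in> {..<d} - J"
      by (simp only: set_sorted_list_of_set finite_Diff finite_lessThan)
    then show ?thesis using that len unfolding xs_def by (simp add: nth_append)
  qed
  have "inj_on (\<lambda>i. xs ! i) {..<d}" using xs(1) l by (auto simp: inj_on_def nth_eq_iff_index_eq)
  moreover have "(\<lambda>i. xs ! i) ` {..<d} = {..<d}" using xs(2) l by (auto simp: set_conv_nth)
  ultimately show ?thesis using 1 2 by (intro exI[of _ "\<lambda>i. xs ! i"]) auto
qed

text \<open>Echelon form over a field: \<open>J\<close> collects the positions at which a vector of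
  \<open>W\<close> can have its last nonzero entry. Basis vectors are taken from \<open>W\<close> at
  these positions and are unit vectors elsewhere; a permutation puts the former first.\<close>

lemma adapted_basis:
  fixes W :: "'k :: field vec set"
  assumes W: "W \<subseteq> carrier_vec d" and smult: "\<And>v k. v \<in> W \<Longrightarrow> k \<cdot>\<^sub>v v \<in> W"
    and diff: "\<And>v w. v \<in> W \<Longrightarrow> w \<in> W \<Longrightarrow> v - w \<in> W"
  shows "\<exists>a\<le>d. \<exists>P\<in>carrier_mat d d. \<exists>Q\<in>carrier_mat d d. P * Q = 1\<^sub>m d \<and> Q * P = 1\<^sub>m d \<and>
    (\<forall>j<a. col P j \<in> W) \<and> (\<forall>v\<in>W. \<forall>i. a \<le> i \<and> i < d \<longrightarrow> (Q *\<^sub>v v) $ i = 0)"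
proof -
  define J where "J = {j. j < d \<and> (\<exists>v\<in>W. (\<forall>i. j < i \<and> i < d \<longrightarrow> v $ i = 0) \<and> v $ j = 1)}"
  have "\<forall>j. \<exists>v. j < d \<longrightarrow> v \<in> carrier_vec d \<and> (\<forall>i. j < i \<and> i < d \<longrightarrow> v $ i = 0) \<and> v $ j = 1 \<and> (j \<in> J \<longrightarrow> v \<in> W)"
  proof
    fix j show "\<exists>v. j < d \<longrightarrow> v \<in> carrier_vec d \<and> (\<forall>i. j < i \<and> i < d \<longrightarrow> v $ i = 0) \<and> v $ j = 1 \<and> (j \<in> J \<longrightarrow> v \<in> W)"
    proof (cases "j \<in> J")
      case True then show ?thesis using W unfolding J_def by blast
    next
      case False then show ?thesis by (intro exI[of _ "unit_vec d j"]) simp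
    qed
  qed
  then obtain b where b: "\<And>j. j < d \<Longrightarrow> b j \<in> carrier_vec d \<and> (\<forall>i. j < i \<and> i < d \<longrightarrow> b j $ i = 0) \<and> b j $ j = 1 \<and> (j \<in> J \<longrightarrow> b j \<in> W)"
    by metis
  define P where "P = mat d d (\<lambda>(i, j). b j $ i)"
  have P: "P \<in> carrier_mat d d" unfolding P_def by simp
  have colP: "col P j = b j" if "j < d" for j
    using b[OF that] that unfolding P_def by (intro eq_vecI) auto
  have "det P \<noteq> 0"
  proof (rule upper_triangular_det_nonzero[OF P])
    show "upper_triangular P" using b unfolding P_def upper_triangular_def by auto
    show "P $$ (i, i) \<noteq> 0" if "i < d" for i using b[OF that] that unfolding P_def by simp
  qed
  then obtain Q where Q: "Q \<in> carrier_mat d d" "P * Q = 1\<^sub>m d" "Q * P = 1\<^sub>m d"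
    using mat_inverse_exists[OF P] by blast
  have Qb: "(Q *\<^sub>v b j) $ i = (if i = j then 1 else 0)" if "i < d" "j < d" for i j
  proof -
    have "Q *\<^sub>v b j = col (Q * P) j" using Q(1) P that colP by simp
    then show ?thesis unfolding Q(3) using that by simp
  qed
  have key: "\<forall>i<d. i \<notin> J \<longrightarrow> (Q *\<^sub>v v) $ i = 0" if "k \<le> d" "v \<in> W" "\<forall>i. k \<le> i \<and> i < d \<longrightarrow> v $ i = 0" for k v
    using that
  proof (induction k arbitrary: v)
    case 0
    then have "v = 0\<^sub>v d" using W by (intro eq_vecI) auto
    then show ?case using Q(1) by simp
  next
    case (Suc k)
    have k: "k < d" using Suc.prems(1) by simp
    show ?case
    proof (cases "v $ k = 0")
      case True
      then have "\<forall>i. k \<le> i \<and> i < d \<longrightarrow> v $ i = 0" using Suc.prems(3) by (metis le_neq_implies_less Suc_leI)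
      then show ?thesis using Suc.IH[of v] k Suc.prems(2) by simp
    next
      case False
      have vd: "v \<in> carrier_vec d" using Suc.prems(2) W by auto
      have "inverse (v $ k) \<cdot>\<^sub>v v \<in> W" by (rule smult[OF Suc.prems(2)])
      then have kJ: "k \<in> J" unfolding J_def using k False Suc.prems(3) vd
        by (intro CollectI conjI bexI[of _ "inverse (v $ k) \<cdot>\<^sub>v v"]) (auto simp: Suc_le_eq)
      have bk: "b k \<in> W" "b k \<in> carrier_vec d" using b[OF k] kJ by auto
      define w where "w = v - v $ k \<cdot>\<^sub>v b k"
      have wW: "w \<in> W" unfolding w_def by (rule diff[OF Suc.prems(2) smult[OF bk(1)]])
      have wi: "w $ i = v $ i - v $ k * b k $ i" if "i < d" for i
        unfolding w_def using that bk vd by simp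
      have "w $ i = 0" if "k \<le> i" "i < d" for i
        using wi[OF that(2)] b[OF k] Suc.prems(3) that by (cases "i = k") (auto simp: Suc_le_eq)
      then have IH: "\<forall>i<d. i \<notin> J \<longrightarrow> (Q *\<^sub>v w) $ i = 0" using Suc.IH[of w] k wW by simp
      have "v = w + v $ k \<cdot>\<^sub>v b k" unfolding w_def using bk vd by (intro eq_vecI) auto
      then have "Q *\<^sub>v v = Q *\<^sub>v (w + v $ k \<cdot>\<^sub>v b k)" by simp
      also have "\<dots> = Q *\<^sub>v w + v $ k \<cdot>\<^sub>v (Q *\<^sub>v b k)"
        using Q(1) bk wW W by (auto simp: mult_add_distrib_mat_vec mult_mat_vec)
      finally have "(Q *\<^sub>v v) $ i = (Q *\<^sub>v w) $ i + v $ k * (Q *\<^sub>v b k) $ i" if "i < d" for i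
        using that Q(1) bk by simp
      then show ?thesis using IH Qb[OF _ k] kJ by auto
    qed
  qed
  have QW: "(Q *\<^sub>v v) $ i = 0" if "v \<in> W" "i < d" "i \<notin> J" for v i
  proof -
    have "\<forall>i. d \<le> i \<and> i < d \<longrightarrow> v $ i = 0" by auto
    from key[OF order_refl that(1) this] show ?thesis using that(2,3) by simp
  qed
  have "J \<subseteq> {..<d}" unfolding J_def by auto
  then obtain \<sigma> where \<sigma>: "inj_on \<sigma> {..<d}" "\<sigma> ` {..<d} = {..<d}" "\<forall>i<card J. \<sigma> i \<in> J" "\<forall>i. card J \<le> i \<and> i < d \<longrightarrow> \<sigma> i \<notin> J"
    using enumerate_subset[of J d] by blast
  have \<sigma>d: "\<sigma> i < d" if "i < d" for i using \<sigma>(2) that by auto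
  have ad: "card J \<le> d" using card_mono[OF _ \<open>J \<subseteq> {..<d}\<close>] by simp
  define P' where "P' = mat d d (\<lambda>(i, j). P $$ (i, \<sigma> j))"
  define Q' where "Q' = mat d d (\<lambda>(i, j). Q $$ (\<sigma> i, j))"
  have P': "P' \<in> carrier_mat d d" and Q': "Q' \<in> carrier_mat d d" unfolding P'_def Q'_def by auto
  have colP': "col P' j = b (\<sigma> j)" if "j < d" for j
  proof -
    have "col P' j = col P (\<sigma> j)" using that \<sigma>d[OF that] P unfolding P'_def by (intro eq_vecI) auto
    then show ?thesis using colP[OF \<sigma>d[OF that]] by simp
  qed
  have rowQ': "row Q' i = row Q (\<sigma> i)" if "i < d" for i
    using that \<sigma>d[OF that] Q(1) unfolding Q'_def by (intro eq_vecI) auto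
  have "Q' * P' = 1\<^sub>m d"
  proof (rule eq_matI)
    fix i j assume "i < dim_row (1\<^sub>m d :: 'k mat)" "j < dim_col (1\<^sub>m d :: 'k mat)"
    then have ij: "i < d" "j < d" by auto
    have "(Q' * P') $$ (i, j) = (Q *\<^sub>v b (\<sigma> j)) $ \<sigma> i"
      using ij P' Q' Q(1) \<sigma>d colP' rowQ' by simp
    also have "\<dots> = (if i = j then 1 else 0)"
      using Qb[OF \<sigma>d[OF ij(1)] \<sigma>d[OF ij(2)]] \<sigma>(1) ij by (simp add: inj_on_eq_iff)
    finally show "(Q' * P') $$ (i, j) = 1\<^sub>m d $$ (i, j)" using ij by simp
  qed (use P' Q' in auto)
  moreover from this have "P' * Q' = 1\<^sub>m d" by (rule mat_mult_left_right_inverse[OF Q' P'])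
  moreover have "col P' j \<in> W" if j: "j < card J" for j
    using colP'[of j] b[OF \<sigma>d[of j]] \<sigma>(3) j ad by simp
  moreover have "(Q' *\<^sub>v v) $ i = 0" if "v \<in> W" "card J \<le> i" "i < d" for v i
  proof -
    have "(Q' *\<^sub>v v) $ i = (Q *\<^sub>v v) $ \<sigma> i" using that Q' Q(1) \<sigma>d rowQ' by simp
    then show ?thesis using QW[OF that(1) \<sigma>d[OF that(3)]] \<sigma>(4) that by simp
  qed
  ultimately show ?thesis using P' Q' ad by (intro exI[of _ "card J"] bexI[of _ P'] bexI[of _ Q'] conjI) auto
qed

definition denom :: "int \<Rightarrow> rat mat \<Rightarrow> bool" where
  "denom N A \<longleftrightarrow> (\<forall>i<dim_row A. \<forall>j<dim_col A. of_int N * A $$ (i, j) \<in> \<int>)"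

lemma denom_exists: "\<exists>N>0. denom N A"
  using common_denominator[of "(\<lambda>(i, j). A $$ (i, j)) ` ({..<dim_row A} \<times> {..<dim_col A})"]
  unfolding denom_def by fastforce

lemma mat_mult_entry:
  assumes "A \<in> carrier_mat n m" "B \<in> carrier_mat m l" "i < n" "j < l"
  shows "(A * B) $$ (i, j) = (\<Sum>k<m. A $$ (i, k) * B $$ (k, j))"
  using assms by (simp add: scalar_prod_def atLeast0LessThan)

lemma denom_mult:
  assumes "A \<in> carrier_mat n m" "B \<in> carrier_mat m l" "denom M A" "denom N B"
  shows "denom (M * N) (A * B)"
  unfolding denom_def
proof (intro allI impI)
  fix i j assume "i < dim_row (A * B)" "j < dim_col (A * B)"
  then have ij: "i < n" "j < l" using assms by auto
  have "of_int (M * N) * (A * B) $$ (i, j) = (\<Sum>k<m. (of_int M * A $$ (i, k)) * (of_int N * B $$ (k, j)))"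
    unfolding mat_mult_entry[OF assms(1,2) ij] by (simp add: sum_distrib_left mult_ac)
  also have "\<dots> \<in> \<int>"
    using assms ij unfolding denom_def by (intro Ints_sum, intro Ints_mult[of "of_int M * _" "of_int N * _"]) auto
  finally show "of_int (M * N) * (A * B) $$ (i, j) \<in> \<int>" .
qed

context group begin

text \<open>One denominator for all of \<open>B\<close> replaces integrality: it survives a rational
  change of basis and the passage to diagonal blocks, and \<open>integral_form\<close> converts it
  back into integral matrices.\<close>

definition rat_rep :: "'a set \<Rightarrow> nat \<Rightarrow> ('a \<Rightarrow> rat mat) \<Rightarrow> bool" where
  "rat_rep B d \<rho> \<longleftrightarrow> (\<forall>x\<in>B. \<rho> x \<in> carrier_mat d d) \<and> (\<forall>x\<in>B. \<forall>y\<in>B. \<rho> (x \<otimes> y) = \<rho> x * \<rho> y) \<and>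
     \<rho> \<one> = 1\<^sub>m d \<and> (\<exists>N>0. \<forall>x\<in>B. denom N (\<rho> x))"

lemma rat_repD:
  assumes "rat_rep B d \<rho>"
  shows "x \<in> B \<Longrightarrow> \<rho> x \<in> carrier_mat d d" "x \<in> B \<Longrightarrow> y \<in> B \<Longrightarrow> \<rho> (x \<otimes> y) = \<rho> x * \<rho> y" "\<rho> \<one> = 1\<^sub>m d"
    "\<exists>N>0. \<forall>x\<in>B. denom N (\<rho> x)"
  using assms unfolding rat_rep_def by auto

definition rker :: "'a set \<Rightarrow> nat \<Rightarrow> ('a \<Rightarrow> rat mat) \<Rightarrow> 'a set" where
  "rker B d \<rho> = {x \<in> B. \<rho> x = 1\<^sub>m d}"

lemma rat_rep_subset: "rat_rep B d \<rho> \<Longrightarrow> C \<subseteq> B \<Longrightarrow> rat_rep C d \<rho>"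
  unfolding rat_rep_def by (meson subsetD)

lemma rat_rep_conj:
  assumes R: "rat_rep B d \<rho>" and P: "P \<in> carrier_mat d d" "Q \<in> carrier_mat d d" "P * Q = 1\<^sub>m d" "Q * P = 1\<^sub>m d"
  shows "rat_rep B d (\<lambda>x. Q * \<rho> x * P)"
proof -
  note R' = rat_repD[OF R]
  obtain N where N: "N > 0" "\<forall>x\<in>B. denom N (\<rho> x)" using R'(4) by blast
  obtain p q where pq: "p > 0" "denom p P" "q > 0" "denom q Q" using denom_exists by blast
  have c: "Q * \<rho> x * P \<in> carrier_mat d d" if "x \<in> B" for x using P R'(1)[OF that] by auto
  have m: "Q * \<rho> (x \<otimes> y) * P = (Q * \<rho> x * P) * (Q * \<rho> y * P)" if "x \<in> B" "y \<in> B" for x y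
  proof -
    note xy = R'(1)[OF that(1)] R'(1)[OF that(2)]
    have "(Q * \<rho> x * P) * (Q * \<rho> y * P) = Q * \<rho> x * (P * (Q * (\<rho> y * P)))"
      using P xy by (simp add: assoc_mult_mat[of _ d d _ d _ d])
    also have "P * (Q * (\<rho> y * P)) = (P * Q) * (\<rho> y * P)"
      by (rule assoc_mult_mat[symmetric, of _ d d _ d _ d]) (use P xy in auto)
    also have "\<dots> = \<rho> y * P" unfolding P(3) using P xy by simp
    finally show ?thesis using P xy by (simp add: R'(2)[OF that] assoc_mult_mat[of _ d d _ d _ d])
  qed
  have dn: "denom (q * N * p) (Q * \<rho> x * P)" if "x \<in> B" for x
    using P R'(1)[OF that] pq N(2) that by (intro denom_mult[of _ d d _ d]) auto
  have "q * N * p > 0" using pq N(1) by simp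
  moreover have "Q * \<rho> \<one> * P = 1\<^sub>m d" using P R'(3) by simp
  ultimately show ?thesis unfolding rat_rep_def using c m dn by blast
qed

lemma rker_conj:
  assumes R: "rat_rep B d \<rho>" and P: "P \<in> carrier_mat d d" "Q \<in> carrier_mat d d" "P * Q = 1\<^sub>m d" "Q * P = 1\<^sub>m d"
  shows "rker B d (\<lambda>x. Q * \<rho> x * P) = rker B d \<rho>"
proof -
  have "Q * \<rho> x * P = 1\<^sub>m d \<longleftrightarrow> \<rho> x = 1\<^sub>m d" if x: "x \<in> B" for x
  proof
    note xd = rat_repD(1)[OF R x]
    assume "Q * \<rho> x * P = 1\<^sub>m d"
    then have "P * (Q * \<rho> x * P) * Q = 1\<^sub>m d" using P by simp
    moreover have "P * (Q * \<rho> x * P) * Q = (P * (Q * \<rho> x)) * (P * Q)"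
      using P(1,2) xd by (simp add: assoc_mult_mat[of _ d d _ d _ d])
    moreover have "P * (Q * \<rho> x) = (P * Q) * \<rho> x"
      by (rule assoc_mult_mat[symmetric, of _ d d _ d _ d]) (use P xd in auto)
    ultimately show "\<rho> x = 1\<^sub>m d" using P xd by simp
  qed (use P in simp)
  then show ?thesis unfolding rker_def by auto
qed

lemma subgroup_rker:
  assumes B: "subgroup B G" and R: "rat_rep B d \<rho>"
  shows "subgroup (rker B d \<rho>) G"
proof (rule subgroupI)
  note R' = rat_repD[OF R] and cl = subgroup.m_closed[OF B] subgroup.m_inv_closed[OF B] subgroup.one_closed[OF B]
  note mem = subgroup.mem_carrier[OF B]
  show "rker B d \<rho> \<subseteq> carrier G" using mem unfolding rker_def by auto
  show "rker B d \<rho> \<noteq> {}" using R'(3) cl(3) unfolding rker_def by auto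
  fix x assume "x \<in> rker B d \<rho>"
  then have x: "x \<in> B" "\<rho> x = 1\<^sub>m d" unfolding rker_def by auto
  have "\<rho> (inv x) = \<rho> x * \<rho> (inv x)" using x R'(1)[of "inv x"] by (simp add: cl)
  also have "\<dots> = \<rho> (x \<otimes> inv x)" by (rule R'(2)[symmetric]) (use x cl in auto)
  also have "\<dots> = 1\<^sub>m d" using x mem R'(3) by simp
  finally show "inv x \<in> rker B d \<rho>" using x unfolding rker_def by (simp add: cl)
next
  note R' = rat_repD[OF R] and cl = subgroup.m_closed[OF B]
  fix x y assume "x \<in> rker B d \<rho>" "y \<in> rker B d \<rho>"
  then show "x \<otimes> y \<in> rker B d \<rho>" unfolding rker_def by (simp add: R'(2) cl)
qed

text \<open>The lattice of all \<open>v\<close> with \<open>\<rho>(x) v\<close> integral for every \<open>x\<close> is invariant.\<close>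

lemma integral_form:
  assumes B: "subgroup B G" and R: "rat_rep B d \<rho>"
  shows "\<exists>M. integral_rep G B d M \<and> (\<forall>x\<in>B. M x = 1\<^sub>m d \<longleftrightarrow> \<rho> x = 1\<^sub>m d)"
proof -
  note R' = rat_repD[OF R] and cl = subgroup.m_closed[OF B] subgroup.one_closed[OF B]
  obtain N where N: "N > 0" "\<forall>x\<in>B. denom N (\<rho> x)" using R'(4) by blast
  define L where "L = {v \<in> carrier_vec d. \<forall>x\<in>B. \<forall>i<d. (\<rho> x *\<^sub>v v) $ i \<in> \<int>}"
  have "\<exists>P\<in>carrier_mat d d. \<exists>Q\<in>carrier_mat d d. P * Q = 1\<^sub>m d \<and> Q * P = 1\<^sub>m d \<and>
    (\<forall>j<d. col P j \<in> L) \<and> (\<forall>v\<in>L. \<forall>i<d. (Q *\<^sub>v v) $ i \<in> \<int>)"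
  proof (rule triangular_lattice_basis)
    show "L \<subseteq> carrier_vec d" unfolding L_def by auto
    show "v $ i \<in> \<int>" if "v \<in> L" "i < d" for v i
    proof -
      have v: "v \<in> carrier_vec d" "(\<rho> \<one> *\<^sub>v v) $ i \<in> \<int>" using that cl(2) unfolding L_def by auto
      then show ?thesis unfolding R'(3) by simp
    qed
    show "v - of_int k \<cdot>\<^sub>v w \<in> L" if vw: "v \<in> L" "w \<in> L" for v w k
    proof -
      have d: "v \<in> carrier_vec d" "w \<in> carrier_vec d" using vw unfolding L_def by auto
      have "(\<rho> x *\<^sub>v (v - of_int k \<cdot>\<^sub>v w)) $ i \<in> \<int>" if x: "x \<in> B" and i: "i < d" for x i
      proof -
        have "(\<rho> x *\<^sub>v (v - of_int k \<cdot>\<^sub>v w)) $ i = (\<rho> x *\<^sub>v v) $ i - of_int k * (\<rho> x *\<^sub>v w) $ i"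
          using d R'(1)[OF x] i by (simp add: mult_minus_distrib_mat_vec[of _ d d] mult_mat_vec[of _ d d])
        also have "\<dots> \<in> \<int>" using vw x i unfolding L_def by (intro Ints_diff Ints_mult Ints_of_int) auto
        finally show ?thesis .
      qed
      then show ?thesis unfolding L_def using d by auto
    qed
    \<comment> \<open>The uniform denominator is what gives the lattice full rank.\<close>
    show "of_int N \<cdot>\<^sub>v unit_vec d j \<in> L" if j: "j < d" for j
    proof -
      have "(\<rho> x *\<^sub>v (of_int N \<cdot>\<^sub>v unit_vec d j)) $ i \<in> \<int>" if x: "x \<in> B" and i: "i < d" for x i
      proof -
        have "(\<rho> x *\<^sub>v (of_int N \<cdot>\<^sub>v unit_vec d j)) $ i = of_int N * \<rho> x $$ (i, j)"
          using R'(1)[OF x] i j by (simp add: mult_mat_vec[of _ d d] scalar_prod_right_unit)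
        then show ?thesis using N(2) x i j R'(1)[OF x] unfolding denom_def by auto
      qed
      then show ?thesis unfolding L_def by auto
    qed
  qed (rule N(1))
  then obtain P Q where P: "P \<in> carrier_mat d d" "Q \<in> carrier_mat d d" "P * Q = 1\<^sub>m d" "Q * P = 1\<^sub>m d"
    and L: "\<forall>j<d. col P j \<in> L" "\<forall>v\<in>L. \<forall>i<d. (Q *\<^sub>v v) $ i \<in> \<int>" by (elim bexE conjE) (rule that)
  let ?\<sigma> = "\<lambda>x. Q * \<rho> x * P"
  note S = rat_rep_conj[OF R P] and S' = rat_repD[OF rat_rep_conj[OF R P]]
  have int: "?\<sigma> x $$ (i, j) \<in> \<int>" if x: "x \<in> B" and ij: "i < d" "j < d" for x i j
  proof -
    note xd = R'(1)[OF x]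
    have c: "col P j \<in> L" "col P j \<in> carrier_vec d" using L(1) ij P by auto
    have "\<rho> y *\<^sub>v (\<rho> x *\<^sub>v col P j) = \<rho> (y \<otimes> x) *\<^sub>v col P j" if "y \<in> B" for y
      using R'(1)[OF that] xd c by (simp add: R'(2)[OF that x] assoc_mult_mat_vec[of _ d d _ d])
    then have "\<rho> x *\<^sub>v col P j \<in> L" using c xd x unfolding L_def by (auto simp: cl)
    then have "(Q *\<^sub>v (\<rho> x *\<^sub>v col P j)) $ i \<in> \<int>" using L(2) ij by simp
    moreover have "?\<sigma> x $$ (i, j) = (Q *\<^sub>v (\<rho> x *\<^sub>v col P j)) $ i"
    proof -
      have "?\<sigma> x $$ (i, j) = col (Q * \<rho> x * P) j $ i" using P xd ij by simp
      also have "col (Q * \<rho> x * P) j = (Q * \<rho> x) *\<^sub>v col P j" using P xd ij by (intro col_mult2[of _ d d _ d]) auto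
      also have "\<dots> = Q *\<^sub>v (\<rho> x *\<^sub>v col P j)" using P xd c by (intro assoc_mult_mat_vec[of _ d d _ d]) auto
      finally show ?thesis .
    qed
    ultimately show ?thesis by simp
  qed
  \<comment> \<open>The floor only changes the type, since the entries are integers by
    \<open>int\<close>.\<close>
  define M where "M x = mat d d (\<lambda>(i, j). \<lfloor>?\<sigma> x $$ (i, j)\<rfloor>)" for x
  have Mc: "M x \<in> carrier_mat d d" for x unfolding M_def by simp
  have MS: "map_mat of_int (M x) = ?\<sigma> x" if "x \<in> B" for x
  proof (rule eq_matI)
    fix i j assume "i < dim_row (?\<sigma> x)" "j < dim_col (?\<sigma> x)"
    then have ij: "i < d" "j < d" using S'(1)[OF that] by auto
    show "map_mat of_int (M x) $$ (i, j) = ?\<sigma> x $$ (i, j)"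
      unfolding M_def using ij int[OF that ij] by (auto elim: Ints_cases)
  qed (use S'(1)[OF that] Mc[of x] in auto)
  have inj: "A = A'" if "map_mat rat_of_int A = map_mat rat_of_int A'" for A A' :: "int mat"
    using of_int_hom.mat_hom_inj[OF that] .
  have one: "map_mat rat_of_int (1\<^sub>m d) = 1\<^sub>m d" by (rule of_int_hom.mat_hom_one)
  have "integral_rep G B d M"
  proof (intro integral_rep.intro integral_rep_axioms.intro)
    show "M (x \<otimes> y) = M x * M y" if "x \<in> B" "y \<in> B" for x y
    proof (rule inj)
      show "map_mat rat_of_int (M (x \<otimes> y)) = map_mat rat_of_int (M x * M y)"
        unfolding of_int_hom.mat_hom_mult[OF Mc Mc] MS[OF that(1)] MS[OF that(2)] MS[OF cl(1)[OF that]]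
        by (rule S'(2)[OF that])
    qed
    show "M \<one> = 1\<^sub>m d" by (rule inj) (simp only: MS[OF cl(2)] one S'(3))
  qed (rule group_axioms B Mc)+
  moreover have "M x = 1\<^sub>m d \<longleftrightarrow> \<rho> x = 1\<^sub>m d" if x: "x \<in> B" for x
  proof -
    have "M x = 1\<^sub>m d \<longleftrightarrow> ?\<sigma> x = 1\<^sub>m d" using inj[of "M x" "1\<^sub>m d"] one MS[OF x] by auto
    then show ?thesis using rker_conj[OF R P] x unfolding rker_def by auto
  qed
  ultimately show ?thesis by blast
qed

end

lemma sum_lessThan_add: "(\<Sum>k<a + b. f k) = (\<Sum>k<a. f k) + (\<Sum>k<b. f (a + k))" for f :: "nat \<Rightarrow> 'k :: comm_monoid_add"
  by (induction b) (simp_all add: add.assoc)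

lemma finite_bounded_denominator:
  assumes "N > 0"
  shows "finite {q :: rat. of_int N * q \<in> \<int> \<and> \<bar>real_of_rat q\<bar> \<le> c}"
proof (rule finite_surj)
  show "finite {- \<lceil>of_int N * c\<rceil>..\<lceil>of_int N * c\<rceil>}" by simp
  show "{q :: rat. of_int N * q \<in> \<int> \<and> \<bar>real_of_rat q\<bar> \<le> c} \<subseteq> (\<lambda>z. of_int z / of_int N) ` {- \<lceil>of_int N * c\<rceil>..\<lceil>of_int N * c\<rceil>}"
  proof
    fix q assume "q \<in> {q :: rat. of_int N * q \<in> \<int> \<and> \<bar>real_of_rat q\<bar> \<le> c}"
    then obtain z where z: "of_int N * q = of_int z" and q: "\<bar>real_of_rat q\<bar> \<le> c" by (auto elim: Ints_cases)
    have "real_of_int z = of_int N * real_of_rat q"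
      using arg_cong[OF z, of real_of_rat] by (simp add: of_rat_mult)
    then have "\<bar>real_of_int z\<bar> \<le> of_int N * c" using q assms by (simp add: abs_mult)
    then have "z \<in> {- \<lceil>of_int N * c\<rceil>..\<lceil>of_int N * c\<rceil>}" by (simp add: abs_le_iff) linarith
    moreover have "q = of_int z / of_int N" using z assms by (simp add: field_simps)
    ultimately show "q \<in> (\<lambda>z. of_int z / of_int N) ` {- \<lceil>of_int N * c\<rceil>..\<lceil>of_int N * c\<rceil>}" by blast
  qed
qed

context group begin

definition bounds :: "'a set \<Rightarrow> 'a set \<Rightarrow> nat \<Rightarrow> bool" where
  "bounds A B d \<longleftrightarrow> relgen A B (d * d + (3 * d) div 2) \<and> (\<exists>h. 2 * h \<le> d * (d + 1) \<and> ser A B h)"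

text \<open>In the chain A \<le> L \<le> K \<le> B the unipotent part is at the bottom, with the two
  diagonal blocks above it. For the rank, a * a + b * b + a * b is at most (a + b) * (a + b), and
  the floors of 3 a / 2 and 3 b / 2 add up to at most the floor of 3 (a + b) / 2.\<close>

lemma bounds_block:
  assumes 1: "bounds K B a" and 2: "bounds L K b" and 3: "relgen A L (a * b)" "ser A L h" "h \<le> a * b"
    and sub: "subgroup K G" "subgroup L G"
  shows "bounds A B (a + b)"
proof -
  have r1: "relgen K B (a * a + (3 * a) div 2)" and r2: "relgen L K (b * b + (3 * b) div 2)"
    using 1 2 unfolding bounds_def by simp_all
  have "relgen A B (a * b + (b * b + (3 * b) div 2) + (a * a + (3 * a) div 2))"
    by (rule relgen_trans[OF relgen_trans[OF 3(1) r2 sub(2)] r1 sub(1)])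
  then have r: "relgen A B ((a + b) * (a + b) + (3 * (a + b)) div 2)"
    by (rule relgen_mono) (simp add: algebra_simps)
  obtain i j where i: "2 * i \<le> a * (a + 1)" "ser K B i" and j: "2 * j \<le> b * (b + 1)" "ser L K j"
    using 1 2 unfolding bounds_def by (elim conjE exE) (rule that)
  have "ser A B (h + j + i)" by (rule ser_trans[OF i(2) ser_trans[OF j(2) 3(2)]])
  moreover have "2 * (h + j + i) \<le> (a + b) * (a + b + 1)" using i(1) j(1) 3(3) by (simp add: algebra_simps)
  ultimately have "\<exists>h. 2 * h \<le> (a + b) * (a + b + 1) \<and> ser A B h" by (intro exI conjI)
  then show ?thesis unfolding bounds_def using r by (intro conjI)
qed

text \<open>\<open>e\<close> selects the rows and columns of a diagonal block, and
  \<open>sum\<close> says that indices outside the block contribute nothing to products.\<close>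

lemma rat_rep_block:
  assumes R: "rat_rep B d \<rho>" and e: "\<And>i. i < n \<Longrightarrow> e i < d" "inj_on e {..<n}"
    and sum: "\<And>x y i j. x \<in> B \<Longrightarrow> y \<in> B \<Longrightarrow> i < n \<Longrightarrow> j < n \<Longrightarrow>
      (\<Sum>k<d. \<rho> x $$ (e i, k) * \<rho> y $$ (k, e j)) = (\<Sum>k<n. \<rho> x $$ (e i, e k) * \<rho> y $$ (e k, e j))"
  shows "rat_rep B n (\<lambda>x. mat n n (\<lambda>(i, j). \<rho> x $$ (e i, e j)))"
proof -
  let ?\<sigma> = "\<lambda>x. mat n n (\<lambda>(i, j). \<rho> x $$ (e i, e j))"
  note R' = rat_repD[OF R]
  obtain N where N: "N > 0" "\<forall>x\<in>B. denom N (\<rho> x)" using R'(4) by blast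
  have "?\<sigma> (x \<otimes> y) = ?\<sigma> x * ?\<sigma> y" if xy: "x \<in> B" "y \<in> B" for x y
  proof (rule eq_matI)
    fix i j assume "i < dim_row (?\<sigma> x * ?\<sigma> y)" "j < dim_col (?\<sigma> x * ?\<sigma> y)"
    then have ij: "i < n" "j < n" by auto
    have "?\<sigma> (x \<otimes> y) $$ (i, j) = (\<Sum>k<d. \<rho> x $$ (e i, k) * \<rho> y $$ (k, e j))"
      using ij R'(2)[OF xy] mat_mult_entry[OF R'(1)[OF xy(1)] R'(1)[OF xy(2)] e(1)[OF ij(1)] e(1)[OF ij(2)]] by simp
    also have "\<dots> = (\<Sum>k<n. ?\<sigma> x $$ (i, k) * ?\<sigma> y $$ (k, j))" unfolding sum[OF xy ij] using ij by simp
    also have "\<dots> = (?\<sigma> x * ?\<sigma> y) $$ (i, j)" using ij by (intro mat_mult_entry[symmetric]) auto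
    finally show "?\<sigma> (x \<otimes> y) $$ (i, j) = (?\<sigma> x * ?\<sigma> y) $$ (i, j)" .
  qed auto
  moreover have "?\<sigma> \<one> = 1\<^sub>m n"
    unfolding R'(3) by (rule eq_matI) (use e in \<open>auto simp: inj_on_eq_iff\<close>)
  moreover have "denom N (?\<sigma> x)" if "x \<in> B" for x
    using N(2) that e(1) R'(1)[OF that] unfolding denom_def by auto
  ultimately show ?thesis unfolding rat_rep_def using N(1) by auto
qed

text \<open>On the subgroup acting trivially on both diagonal blocks, the upper right block is additive.\<close>

lemma block_triangular:
  assumes B: "subgroup B G" and R: "rat_rep B (a + b) \<rho>"
    and zero: "\<And>x i j. x \<in> B \<Longrightarrow> i < b \<Longrightarrow> j < a \<Longrightarrow> \<rho> x $$ (a + i, j) = 0"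
    and IH1: "\<And>\<sigma>. rat_rep B a \<sigma> \<Longrightarrow> bounds (rker B a \<sigma>) B a"
    and IH2: "\<And>C \<sigma>. subgroup C G \<Longrightarrow> rat_rep C b \<sigma> \<Longrightarrow> bounds (rker C b \<sigma>) C b"
  shows "bounds (rker B (a + b) \<rho>) B (a + b)"
proof -
  note R' = rat_repD[OF R] and cl = subgroup.m_closed[OF B] subgroup.m_inv_closed[OF B] subgroup.one_closed[OF B]
  define \<rho>1 where "\<rho>1 x = mat a a (\<lambda>(i, j). \<rho> x $$ (i, j))" for x
  define \<rho>2 where "\<rho>2 x = mat b b (\<lambda>(i, j). \<rho> x $$ (a + i, a + j))" for x
  have R1: "rat_rep B a \<rho>1" unfolding \<rho>1_def
    by (rule rat_rep_block[OF R]) (use zero in \<open>auto simp: sum_lessThan_add\<close>)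
  have R2: "rat_rep B b \<rho>2" unfolding \<rho>2_def
    by (rule rat_rep_block[OF R]) (use zero in \<open>auto simp: sum_lessThan_add\<close>)
  define K where "K = rker B a \<rho>1"
  have KB: "K \<subseteq> B" unfolding K_def rker_def by auto
  have K: "subgroup K G" unfolding K_def by (rule subgroup_rker[OF B R1])
  \<comment> \<open>The second block is considered only on the kernel of the first, which is why
    \<open>IH2\<close> allows another subgroup.\<close>
  have R2K: "rat_rep K b \<rho>2" by (rule rat_rep_subset[OF R2 KB])
  define L where "L = rker K b \<rho>2"
  have LK: "L \<subseteq> K" unfolding L_def rker_def by auto
  have LB: "x \<in> B" if "x \<in> L" for x using that LK KB by auto
  have L: "subgroup L G" unfolding L_def by (rule subgroup_rker[OF K R2K])
  have b1: "bounds K B a" unfolding K_def by (rule IH1[OF R1])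
  have b2: "bounds L K b" unfolding L_def by (rule IH2[OF K R2K])
  have e1: "\<rho> x $$ (i, j) = (if i = j then 1 else 0)" if "x \<in> L" "i < a" "j < a" for x i j
  proof -
    have "\<rho>1 x = 1\<^sub>m a" using that(1) LK unfolding K_def rker_def by auto
    then have "\<rho>1 x $$ (i, j) = 1\<^sub>m a $$ (i, j)" by simp
    then show ?thesis unfolding \<rho>1_def using that by simp
  qed
  have e2: "\<rho> x $$ (a + i, a + j) = (if i = j then 1 else 0)" if "x \<in> L" "i < b" "j < b" for x i j
  proof -
    have "\<rho>2 x = 1\<^sub>m b" using that(1) unfolding L_def rker_def by auto
    then have "\<rho>2 x $$ (i, j) = 1\<^sub>m b $$ (i, j)" by simp
    then show ?thesis unfolding \<rho>2_def using that by simp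
  qed
  let ?A = "rker B (a + b) \<rho>"
  have AL: "?A \<subseteq> L"
  proof
    fix x assume "x \<in> ?A"
    then have x: "x \<in> B" "\<rho> x = 1\<^sub>m (a + b)" unfolding rker_def by auto
    have "\<rho>1 x = 1\<^sub>m a" "\<rho>2 x = 1\<^sub>m b" unfolding \<rho>1_def \<rho>2_def x(2) by (auto intro!: eq_matI)
    then show "x \<in> L" using x(1) unfolding L_def K_def rker_def by auto
  qed
  \<comment> \<open>The number \<open>t\<close> below \<open>a * b\<close> codes the position (t div
    b, t mod b) in the upper right block.\<close>
  define \<phi> where "\<phi> t x = real_of_rat (\<rho> x $$ (t div b, a + t mod b))" for t x
  have tb: "t div b < a" "t mod b < b" if "t < a * b" for t
    using that by (auto simp: less_mult_imp_div_less intro!: mod_less_divisor Nat.gr0I)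
  have add: "\<phi> t (x \<otimes> y) = \<phi> t x + \<phi> t y" if t: "t < a * b" and xy: "x \<in> L" "y \<in> L" for t x y
  proof -
    let ?i = "t div b" and ?j = "t mod b"
    have "\<rho> (x \<otimes> y) $$ (?i, a + ?j) = (\<Sum>k<a + b. \<rho> x $$ (?i, k) * \<rho> y $$ (k, a + ?j))"
      unfolding R'(2)[OF LB[OF xy(1)] LB[OF xy(2)]]
      by (rule mat_mult_entry[OF R'(1)[OF LB[OF xy(1)]] R'(1)[OF LB[OF xy(2)]]]) (use tb[OF t] in auto)
    also have "\<dots> = (\<Sum>k<a. (if k = ?i then \<rho> y $$ (k, a + ?j) else 0)) + (\<Sum>k<b. (if k = ?j then \<rho> x $$ (?i, a + k) else 0))"
      unfolding sum_lessThan_add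
      by (intro arg_cong2[where f = "(+)"] sum.cong) (use e1[OF xy(1)] e2[OF xy(2)] tb[OF t] in auto)
    also have "\<dots> = \<rho> y $$ (?i, a + ?j) + \<rho> x $$ (?i, a + ?j)"
      using tb[OF t] by (simp add: sum.delta)
    finally show ?thesis unfolding \<phi>_def by (simp add: of_rat_add)
  qed
  have ker: "x \<in> ?A" if x: "x \<in> L" "\<And>t. t < a * b \<Longrightarrow> \<phi> t x = 0" for x
  proof -
    have z: "\<rho> x $$ (i, a + j) = 0" if "i < a" "j < b" for i j
    proof -
      have "Suc i * b \<le> a * b" using that by (intro mult_right_mono) auto
      then have "i * b + j < a * b" using that by simp
      from x(2)[OF this] show ?thesis unfolding \<phi>_def using that by simp
    qed
    have "\<rho> x = 1\<^sub>m (a + b)"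
    proof (rule eq_matI)
      fix i j assume "i < dim_row (1\<^sub>m (a + b) :: rat mat)" "j < dim_col (1\<^sub>m (a + b) :: rat mat)"
      then have ij: "i < a \<or> (\<exists>k<b. i = a + k)" "j < a \<or> (\<exists>k<b. j = a + k)" 
        by (auto simp: not_less intro: exI[of _ "i - a"] exI[of _ "j - a"])
      then show "\<rho> x $$ (i, j) = 1\<^sub>m (a + b) $$ (i, j)"
        using e1[OF x(1)] e2[OF x(1)] z zero[OF LB[OF x(1)]] by auto
    qed (use R'(1)[OF LB[OF x(1)]] in auto)
    then show ?thesis using LB[OF x(1)] unfolding rker_def by simp
  qed
  have A0: "\<phi> t x = 0" if "t < a * b" "x \<in> ?A" for t x
    using that tb[OF that(1)] unfolding \<phi>_def rker_def by auto
  \<comment> \<open>Here the labels are the matrix entries themselves; the common denominator leaves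
    finitely many in each box.\<close>
  let ?\<kappa> = "\<lambda>x. map (\<lambda>t. \<rho> x $$ (t div b, a + t mod b)) [0..<a * b]"
  obtain N where N: "N > 0" "\<forall>x\<in>B. denom N (\<rho> x)" using R'(4) by blast
  have D: "discrete_mod (a * b) ?A L \<phi> ?\<kappa>"
    unfolding discrete_mod_def
  proof (intro conjI allI impI ballI)
    show "x \<in> ?A" if x: "x \<in> L" and k: "0 < k" "x [^] (k::nat) \<in> ?A" for x k
    proof (rule ker[OF x])
      fix t assume t: "t < a * b"
      have "\<phi> t (x [^] k) = real k * \<phi> t x"
        by (rule additive_nat_pow[OF L _ x]) (rule add[OF t])
      then show "\<phi> t x = 0" using A0[OF t k(2)] k(1) by simp
    qed
    show "x \<otimes> inv y \<in> ?A" if xy: "x \<in> L" "y \<in> L" "?\<kappa> x = ?\<kappa> y" for x y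
    proof -
      have iy: "inv y \<in> L" by (rule subgroup.m_inv_closed[OF L xy(2)])
      show ?thesis
      proof (rule ker)
        show "x \<otimes> inv y \<in> L" by (rule subgroup.m_closed[OF L xy(1) iy])
        fix t assume t: "t < a * b"
        have "\<phi> t (inv y) = - \<phi> t y" by (rule additive_inv[OF L _ xy(2)]) (rule add[OF t])
        moreover have "\<phi> t x = \<phi> t y" using xy(3) t unfolding \<phi>_def by simp
        ultimately show "\<phi> t (x \<otimes> inv y) = 0" using add[OF t xy(1) iy] by simp
      qed
    qed
    fix c :: real
    let ?Z = "{q :: rat. of_int N * q \<in> \<int> \<and> \<bar>real_of_rat q\<bar> \<le> c}"
    show "finite (?\<kappa> ` {x \<in> L. \<forall>i<a * b. \<bar>\<phi> i x\<bar> \<le> c})"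
    proof (rule finite_subset)
      show "finite {xs. set xs \<subseteq> ?Z \<and> length xs = a * b}"
        by (rule finite_lists_length_eq[OF finite_bounded_denominator[OF N(1)]])
      show "?\<kappa> ` {x \<in> L. \<forall>i<a * b. \<bar>\<phi> i x\<bar> \<le> c} \<subseteq> {xs. set xs \<subseteq> ?Z \<and> length xs = a * b}"
      proof (intro image_subsetI CollectI conjI)
        fix x assume x: "x \<in> {x \<in> L. \<forall>i<a * b. \<bar>\<phi> i x\<bar> \<le> c}"
        have "\<rho> x $$ (t div b, a + t mod b) \<in> ?Z" if t: "t < a * b" for t
        proof -
          have "of_int N * \<rho> x $$ (t div b, a + t mod b) \<in> \<int>"
            using N(2) LB[of x] x R'(1)[of x] tb[OF t] unfolding denom_def by auto
          then show ?thesis using x t unfolding \<phi>_def by auto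
        qed
        then show "set (?\<kappa> x) \<subseteq> ?Z" unfolding set_map by (intro image_subsetI) simp
      qed simp
    qed
  qed (use AL A0 add subgroup_rker[OF B R] in auto)
  obtain h where h: "h \<le> a * b" "ser ?A L h" using discrete_rank[OF L D] by blast
  show ?thesis by (rule bounds_block[OF b1 b2 discrete_relgen[OF L D] h(2,1) K L])
qed

end

section \<open>Reducible representations and the induction on the degree\<close>

context group begin

text \<open>The fixed space \<open>W\<close> of \<open>C\<close> is invariant under \<open>B\<close>
  because \<open>C\<close> is closed under conjugation; it is nonzero because of \<open>f\<close>
  and proper because of \<open>c\<close>. A basis adapted to \<open>W\<close> makes the matrices
  block triangular.\<close>

lemma not_irreducible_block:
  assumes I: "integral_rep G B d M"
    and C: "C \<subseteq> B" "\<And>x c. x \<in> B \<Longrightarrow> c \<in> C \<Longrightarrow> x \<otimes> c \<otimes> inv x \<in> C"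
    and f: "f \<in> Vn d" "f \<noteq> (0 :: nat \<Rightarrow> rat)" "\<And>c. c \<in> C \<Longrightarrow> act d (M c) f = f" and c: "c \<in> C" "M c \<noteq> 1\<^sub>m d"
  shows "\<exists>a>0. \<exists>b>0. \<exists>\<rho>. d = a + b \<and> rat_rep B (a + b) \<rho> \<and> rker B (a + b) \<rho> = {x \<in> B. M x = 1\<^sub>m d} \<and>
    (\<forall>x\<in>B. \<forall>i<b. \<forall>j<a. \<rho> x $$ (a + i, j) = 0)"
proof -
  interpret I: integral_rep G B d M by (rule I)
  define R where "R x = map_mat rat_of_int (M x)" for x
  have Rc: "R x \<in> carrier_mat d d" if "x \<in> B" for x unfolding R_def using I.\<rho>_carrier[OF that] by simp
  have Rm: "R (x \<otimes> y) = R x * R y" if "x \<in> B" "y \<in> B" for x y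
    unfolding R_def I.\<rho>_mult[OF that] by (rule of_int_hom.mat_hom_mult[OF I.\<rho>_carrier I.\<rho>_carrier]) (use that in auto)
  have R1: "R x = 1\<^sub>m d \<longleftrightarrow> M x = 1\<^sub>m d" for x
    unfolding R_def using of_int_hom.mat_hom_inj[of "M x" "1\<^sub>m d", where 'a = rat] of_int_hom.mat_hom_one[of d, where 'a = rat]
    by auto
  have "denom 1 (R x)" for x unfolding denom_def R_def by simp
  then have R: "rat_rep B d R"
    unfolding rat_rep_def using Rc Rm R1 I.\<rho>_one by (auto intro!: exI[of _ 1])
  define W where "W = {v \<in> carrier_vec d. \<forall>c\<in>C. R c *\<^sub>v v = v}"
  have CB: "x \<in> B" if "x \<in> C" for x using C(1) that by auto
  have "\<exists>a\<le>d. \<exists>P\<in>carrier_mat d d. \<exists>Q\<in>carrier_mat d d. P * Q = 1\<^sub>m d \<and> Q * P = 1\<^sub>m d \<and>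
    (\<forall>j<a. col P j \<in> W) \<and> (\<forall>v\<in>W. \<forall>i. a \<le> i \<and> i < d \<longrightarrow> (Q *\<^sub>v v) $ i = 0)"
  proof (rule adapted_basis)
    show "k \<cdot>\<^sub>v v \<in> W" if "v \<in> W" for v k
      using that Rc CB unfolding W_def by (auto simp: mult_mat_vec[of _ d d])
    show "v - w \<in> W" if "v \<in> W" "w \<in> W" for v w
      using that Rc CB unfolding W_def by (auto simp: mult_minus_distrib_mat_vec[of _ d d])
  qed (auto simp: W_def)
  then obtain a P Q where a: "a \<le> d" and P: "P \<in> carrier_mat d d" "Q \<in> carrier_mat d d" "P * Q = 1\<^sub>m d" "Q * P = 1\<^sub>m d"
    and W: "\<forall>j<a. col P j \<in> W" "\<forall>v\<in>W. \<forall>i. a \<le> i \<and> i < d \<longrightarrow> (Q *\<^sub>v v) $ i = 0"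
    by (elim exE bexE conjE) (rule that)
  have "a \<noteq> 0"
  proof
    assume a0: "a = 0"
    let ?v = "vec d f"
    have "R c *\<^sub>v ?v = ?v" if c: "c \<in> C" for c
    proof (rule eq_vecI)
      fix i assume "i < dim_vec ?v"
      then have i: "i < d" by simp
      have "(R c *\<^sub>v ?v) $ i = act d (M c) f i"
        using i I.\<rho>_carrier[OF CB[OF c]] unfolding R_def act_def by (simp add: scalar_prod_def atLeast0LessThan)
      then show "(R c *\<^sub>v ?v) $ i = ?v $ i" using f(3)[OF c] i by simp
    qed (use Rc[OF CB[OF c]] in simp)
    then have "?v \<in> W" unfolding W_def by simp
    then have Qv: "Q *\<^sub>v ?v = 0\<^sub>v d" using W(2) a0 P(2) by (intro eq_vecI) auto
    have "(P * Q) *\<^sub>v ?v = P *\<^sub>v (Q *\<^sub>v ?v)" by (rule assoc_mult_mat_vec[OF P(1,2)]) simp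
    also have "\<dots> = 0\<^sub>v d" unfolding Qv using P(1) by (intro eq_vecI) auto
    finally have v0: "?v = 0\<^sub>v d" unfolding P(3) by simp
    have "f r = 0" for r
    proof (cases "r < d")
      case True
      then have "f r = ?v $ r" by simp
      then show ?thesis unfolding v0 using True by simp
    qed (use f(1) in \<open>simp add: Vn_def\<close>)
    then show False using f(2) by (auto simp: fun_eq_iff zero_fun_apply)
  qed
  moreover have "a \<noteq> d"
  proof
    assume ad: "a = d"
    have "R c * P = P"
    proof (rule eq_matI)
      fix i j assume "i < dim_row P" "j < dim_col P"
      then have ij: "i < d" "j < d" using P(1) by auto
      have "(R c * P) $$ (i, j) = (R c *\<^sub>v col P j) $ i" using ij P(1) Rc[OF CB[OF c(1)]] by simp
      also have "\<dots> = P $$ (i, j)" using W(1) ad ij c(1) P(1) unfolding W_def by simp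
      finally show "(R c * P) $$ (i, j) = P $$ (i, j)" .
    qed (use P(1) Rc[OF CB[OF c(1)]] in auto)
    then have "R c * P * Q = 1\<^sub>m d" using P(3) by simp
    moreover have "R c * P * Q = R c" using P Rc[OF CB[OF c(1)]] by (simp add: assoc_mult_mat[of _ d d _ d _ d])
    ultimately show False using c(2) R1 by simp
  qed
  ultimately obtain b where b: "d = a + b" "a > 0" "b > 0" using a by (metis le_iff_add add_0_right gr0I)
  have inv: "R x *\<^sub>v v \<in> W" if x: "x \<in> B" and v: "v \<in> W" for x v
  proof -
    have vd: "v \<in> carrier_vec d" using v unfolding W_def by auto
    have "R c *\<^sub>v (R x *\<^sub>v v) = R x *\<^sub>v v" if c: "c \<in> C" for c
    proof -
      have cx: "inv x \<otimes> c \<otimes> x \<in> C" using C(2)[of "inv x" c] c x I.B_closed(2)[OF x] I.B_mem by simp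
      have "R c *\<^sub>v (R x *\<^sub>v v) = R (c \<otimes> x) *\<^sub>v v"
        using Rc[OF CB[OF c]] Rc[OF x] vd CB[OF c] x by (simp add: Rm assoc_mult_mat_vec[of _ d d _ d])
      also have "c \<otimes> x = x \<otimes> (inv x \<otimes> c \<otimes> x)"
        using I.B_mem x CB[OF c] by (simp add: m_assoc mult_inv_cancel)
      also have "R (x \<otimes> (inv x \<otimes> c \<otimes> x)) *\<^sub>v v = R x *\<^sub>v (R (inv x \<otimes> c \<otimes> x) *\<^sub>v v)"
        using Rc[OF CB[OF cx]] Rc[OF x] vd CB[OF cx] x by (simp add: Rm assoc_mult_mat_vec[of _ d d _ d])
      also have "R (inv x \<otimes> c \<otimes> x) *\<^sub>v v = v" using v cx unfolding W_def by auto
      finally show ?thesis .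
    qed
    then show ?thesis using Rc[OF x] vd unfolding W_def by auto
  qed
  let ?\<rho> = "\<lambda>x. Q * R x * P"
  have zero: "?\<rho> x $$ (a + i, j) = 0" if x: "x \<in> B" and ij: "i < b" "j < a" for x i j
  proof -
    have j: "j < d" "a + i < d" using ij b by auto
    note xd = Rc[OF x]
    have "?\<rho> x $$ (a + i, j) = col (Q * R x * P) j $ (a + i)" using P xd j by simp
    also have "col (Q * R x * P) j = (Q * R x) *\<^sub>v col P j" using P xd j by (intro col_mult2[of _ d d _ d]) auto
    also have "\<dots> = Q *\<^sub>v (R x *\<^sub>v col P j)" using P xd j by (intro assoc_mult_mat_vec[of _ d d _ d]) auto
    finally show ?thesis using W(2) inv[OF x] W(1) ij(2) j(2) by simp
  qed
  have "rker B d ?\<rho> = {x \<in> B. M x = 1\<^sub>m d}"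
    unfolding rker_conj[OF R P] unfolding rker_def R1 ..
  then show ?thesis using zero b rat_rep_conj[OF R P]
    by (intro exI[of _ a] exI[of _ b] exI[of _ ?\<rho>] conjI) auto
qed

text \<open>Strong induction on the degree. The subgroup varies because the second block lives on
  the kernel of the first; the chain \<open>D\<close> belongs to the whole group and stays
  fixed.\<close>

theorem rational_bounds:
  assumes D: "solvable_chain D k"
  shows "subgroup B G \<Longrightarrow> rat_rep B d \<rho> \<Longrightarrow> bounds (rker B d \<rho>) B d"
proof (induction d arbitrary: B \<rho> rule: less_induct)
  case (less d)
  note B = less.prems(1) and R = less.prems(2)
  show ?case
  proof (cases "d = 0")
    case True
    have "\<rho> x = 1\<^sub>m d" if "x \<in> B" for x using rat_repD(1)[OF R that] True by (intro eq_matI) auto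
    then have "rker B d \<rho> = B" unfolding rker_def by auto
    then show ?thesis unfolding bounds_def using relgen_refl ser.base[OF B]
      by (auto intro!: exI[of _ 0])
  next
    case False
    then have d: "d > 0" by simp
    obtain M where M: "integral_rep G B d M" "\<forall>x\<in>B. M x = 1\<^sub>m d \<longleftrightarrow> \<rho> x = 1\<^sub>m d"
      using integral_form[OF B R] by blast
    have ker: "rker B d \<rho> = {x \<in> B. M x = 1\<^sub>m d}" unfolding rker_def using M(2) by auto
    show ?thesis
    proof (cases "irreducible_rep G B d M")
      case True
      interpret I: irreducible_rep G B d M by (rule True)
      have k: "rker B d \<rho> = I.ker" unfolding ker I.ker_def ..
      note b = I.irreducible_bounds[OF D]
      obtain h where h: "h \<le> d" "ser I.ker B h" using b by blast
      \<comment> \<open>The irreducible case has \<open>h \<le> d\<close>, which is within d (d + 1)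
        / 2 because \<open>d\<close> is positive.\<close>
      have "2 * h \<le> d * 2" using h by simp
      also have "\<dots> \<le> d * (d + 1)" using d by (intro mult_left_mono) auto
      finally have "\<exists>h. 2 * h \<le> d * (d + 1) \<and> ser I.ker B h" using h(2) by (intro exI conjI)
      then show ?thesis unfolding bounds_def k using conjunct1[OF b] by (intro conjI)
    next
      case irr: False
      \<comment> \<open>Failure of the locale predicate supplies a conjugation-invariant set with a
        nonzero fixed vector and a member acting nontrivially.\<close>
      have "\<exists>C f c. C \<subseteq> B \<and> (\<forall>x\<in>B. \<forall>c\<in>C. x \<otimes> c \<otimes> inv x \<in> C) \<and> f \<in> Vn d \<and> f \<noteq> (0 :: nat \<Rightarrow> rat) \<and>
        (\<forall>c\<in>C. act d (M c) f = f) \<and> c \<in> C \<and> M c \<noteq> 1\<^sub>m d"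
      proof (rule ccontr)
        assume "\<not> ?thesis"
        then have "irreducible_rep G B d M"
          by (intro irreducible_rep.intro[OF M(1)] irreducible_rep_axioms.intro[OF d]) meson
        then show False using irr by simp
      qed
      then obtain C f c where C: "C \<subseteq> B" "\<forall>x\<in>B. \<forall>c\<in>C. x \<otimes> c \<otimes> inv x \<in> C" "f \<in> Vn d" "f \<noteq> (0 :: nat \<Rightarrow> rat)"
        "\<forall>c\<in>C. act d (M c) f = f" "c \<in> C" "M c \<noteq> 1\<^sub>m d" by (elim exE conjE) (rule that)
      have "\<exists>a>0. \<exists>b>0. \<exists>\<rho>. d = a + b \<and> rat_rep B (a + b) \<rho> \<and> rker B (a + b) \<rho> = {x \<in> B. M x = 1\<^sub>m d} \<and>
        (\<forall>x\<in>B. \<forall>i<b. \<forall>j<a. \<rho> x $$ (a + i, j) = 0)"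
        by (rule not_irreducible_block[OF M(1) C(1) _ C(3,4) _ C(6,7)]) (use C(2,5) in auto)
      then obtain a b \<sigma> where ab: "a > 0" "b > 0" "d = a + b" "rat_rep B (a + b) \<sigma>"
        "rker B (a + b) \<sigma> = {x \<in> B. M x = 1\<^sub>m d}" "\<forall>x\<in>B. \<forall>i<b. \<forall>j<a. \<sigma> x $$ (a + i, j) = 0"
        by (elim exE conjE) (rule that)
      have "bounds (rker B (a + b) \<sigma>) B (a + b)"
      proof (rule block_triangular[OF B ab(4)])
        show "bounds (rker B a \<tau>) B a" if "rat_rep B a \<tau>" for \<tau> by (rule less.IH[OF _ B that]) (use ab in simp)
        show "bounds (rker C b \<tau>) C b" if "subgroup C G" "rat_rep C b \<tau>" for C \<tau>
          by (rule less.IH[OF _ that]) (use ab in simp)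
      qed (use ab(6) in simp)
      then show ?thesis unfolding ker ab(5) unfolding ab(3)[symmetric] .
    qed
  qed
qed

end

section \<open>Restriction of scalars\<close>

text \<open>The finite spanning set makes every basis finite, so the library dimension is the true
  degree and the basis can be indexed by numbers below \<open>m\<close>.\<close>

lemma number_field_coordinates:
  assumes "number_field TYPE('a :: field_char_0)" and m: "m = number_field_degree TYPE('a)"
  shows "\<exists>(\<beta> :: nat \<Rightarrow> 'a) c. (\<forall>k x y. c k (x + y) = c k x + c k y) \<and> (\<forall>k q x. c k (of_rat q * x) = q * c k x) \<and>
    (\<forall>x. x = (\<Sum>k<m. of_rat (c k x) * \<beta> k)) \<and> (\<forall>k<m. \<forall>l<m. c k (\<beta> l) = (if k = l then 1 else 0))"
proof -
  obtain S :: "'a set" where S: "finite S" "over_rat.span S = UNIV" using assms(1) unfolding number_field_def by auto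
  obtain B :: "'a set" where B: "over_rat.independent B" "UNIV \<subseteq> over_rat.span B" "card B = over_rat.dim (UNIV :: 'a set)"
    using over_rat.basis_exists[of "UNIV :: 'a set"] by metis
  have fin: "finite B" using over_rat.independent_span_bound[OF S(1) B(1)] S(2) by simp
  have sp: "x \<in> over_rat.span B" for x using B(2) by auto
  obtain \<beta> where "bij_betw \<beta> {0..<card B} B" using ex_bij_betw_nat_finite[OF fin] by blast
  then have \<beta>: "inj_on \<beta> {..<m}" "\<beta> ` {..<m} = B"
    using B(3) m unfolding number_field_degree_def bij_betw_def atLeast0LessThan by auto
  let ?c = "\<lambda>k x. over_rat.representation B x (\<beta> k)"
  have "x = (\<Sum>k<m. of_rat (?c k x) * \<beta> k)" for x
  proof -
    have "x = (\<Sum>b\<in>\<beta> ` {..<m}. of_rat (over_rat.representation B x b) * b)"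
      unfolding \<beta>(2) using over_rat.sum_representation_eq[OF B(1) sp fin order_refl] by simp
    then show ?thesis by (simp add: sum.reindex[OF \<beta>(1)])
  qed
  moreover have "?c k (\<beta> l) = (if k = l then 1 else 0)" if "k < m" "l < m" for k l
  proof -
    have "\<beta> l \<in> B" using \<beta>(2) that by auto
    then have "?c k (\<beta> l) = (if \<beta> k = \<beta> l then 1 else 0)" by (simp add: over_rat.representation_basis[OF B(1)])
    then show ?thesis using inj_on_eq_iff[OF \<beta>(1), of k l] that by simp
  qed
  moreover have "?c k (x + y) = ?c k x + ?c k y" for k x y
    using over_rat.representation_add[OF B(1) sp sp, of x y] by simp
  moreover have "?c k (of_rat q * x) = q * ?c k x" for k q x
    using over_rat.representation_scale[OF B(1) sp, of q x] by simp
  ultimately show ?thesis by (intro exI[of _ \<beta>] exI[of _ ?c]) simp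
qed

lemma sum_div_mod:
  fixes f :: "nat \<Rightarrow> nat \<Rightarrow> 'k :: comm_monoid_add"
  shows "(\<Sum>q<n * m. f (q div m) (q mod m)) = (\<Sum>r<n. \<Sum>s<m. f r s)"
proof (induction n)
  case (Suc n)
  have "(\<Sum>q<Suc n * m. f (q div m) (q mod m)) = (\<Sum>q<n * m + m. f (q div m) (q mod m))" by (simp add: add.commute)
  also have "\<dots> = (\<Sum>r<n. \<Sum>s<m. f r s) + (\<Sum>s<m. f ((n * m + s) div m) ((n * m + s) mod m))"
    unfolding sum_lessThan_add Suc ..
  also have "(\<Sum>s<m. f ((n * m + s) div m) ((n * m + s) mod m)) = (\<Sum>s<m. f n s)"
    by (intro sum.cong) auto
  finally show ?case by simp
qed simp

locale number_field_basis =
  fixes \<beta> :: "nat \<Rightarrow> 'a :: field_char_0" and c :: "nat \<Rightarrow> 'a \<Rightarrow> rat" and m :: nat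
  assumes c_add: "c k (x + y) = c k x + c k y" and c_scale: "c k (of_rat q * x) = q * c k x"
    and expand: "x = (\<Sum>k<m. of_rat (c k x) * \<beta> k)"
    and c_\<beta>: "k < m \<Longrightarrow> l < m \<Longrightarrow> c k (\<beta> l) = (if k = l then 1 else 0)"
begin

text \<open>The index \<open>p\<close> stands for the vector with entry \<open>\<beta> (p mod m)\<close> at position \<open>p div m\<close>.\<close>

definition restrict :: "nat \<Rightarrow> 'a mat \<Rightarrow> rat mat" where
  "restrict n A = mat (n * m) (n * m) (\<lambda>(p, q). c (p mod m) (A $$ (p div m, q div m) * \<beta> (q mod m)))"

lemma c_zero: "c k 0 = 0"
  using c_scale[of k 0 0] by simp

lemma c_sum: "c k (\<Sum>i\<in>I. f i) = (\<Sum>i\<in>I. c k (f i))"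
  by (induction I rule: infinite_finite_induct) (simp_all add: c_zero c_add)

lemma div_mod_bounds:
  assumes "p < n * m"
  shows "p div m < n" "p mod m < m"
  using assms by (auto simp: less_mult_imp_div_less intro!: mod_less_divisor Nat.gr0I)

text \<open>Expanding \<open>B $$ (r, j) * \<beta> l\<close> in the basis inserts the missing
  summation index; the pair of indices is then recoded as one number.\<close>

lemma restrict_mult:
  assumes A: "A \<in> carrier_mat n n" "B \<in> carrier_mat n n"
  shows "restrict n (A * B) = restrict n A * restrict n B"
proof (rule eq_matI)
  fix p q assume "p < dim_row (restrict n A * restrict n B)" "q < dim_col (restrict n A * restrict n B)"
  then have pq: "p < n * m" "q < n * m" unfolding restrict_def by auto
  note b = div_mod_bounds[OF pq(1)] div_mod_bounds[OF pq(2)]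
  define i k j l where ikjl: "i = p div m" "k = p mod m" "j = q div m" "l = q mod m"
  have "restrict n (A * B) $$ (p, q) = c k ((\<Sum>r<n. A $$ (i, r) * B $$ (r, j)) * \<beta> l)"
    using pq mat_mult_entry[OF A b(1,3)] unfolding restrict_def ikjl by simp
  also have "(\<Sum>r<n. A $$ (i, r) * B $$ (r, j)) * \<beta> l = (\<Sum>r<n. A $$ (i, r) * (B $$ (r, j) * \<beta> l))"
    by (simp add: sum_distrib_right mult.assoc)
  also have "\<dots> = (\<Sum>r<n. A $$ (i, r) * (\<Sum>s<m. of_rat (c s (B $$ (r, j) * \<beta> l)) * \<beta> s))"
    by (intro sum.cong refl arg_cong2[where f = "(*)"] expand)
  also have "\<dots> = (\<Sum>r<n. \<Sum>s<m. of_rat (c s (B $$ (r, j) * \<beta> l)) * (A $$ (i, r) * \<beta> s))"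
    by (simp add: sum_distrib_left mult_ac)
  also have "c k \<dots> = (\<Sum>r<n. \<Sum>s<m. c k (A $$ (i, r) * \<beta> s) * c s (B $$ (r, j) * \<beta> l))"
    unfolding c_sum c_scale by (simp add: mult.commute)
  also have "\<dots> = (\<Sum>x<n * m. c k (A $$ (i, x div m) * \<beta> (x mod m)) * c (x mod m) (B $$ (x div m, j) * \<beta> l))"
    by (rule sum_div_mod[symmetric])
  also have "\<dots> = (\<Sum>x<n * m. restrict n A $$ (p, x) * restrict n B $$ (x, q))"
    using pq unfolding restrict_def ikjl by simp
  also have "\<dots> = (restrict n A * restrict n B) $$ (p, q)"
    by (rule mat_mult_entry[symmetric, of _ "n * m" "n * m" _ "n * m"]) (use pq in \<open>simp_all add: restrict_def\<close>)
  finally show "restrict n (A * B) $$ (p, q) = (restrict n A * restrict n B) $$ (p, q)" .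
qed (simp_all add: restrict_def)

lemma restrict_one: "restrict n (1\<^sub>m n) = 1\<^sub>m (n * m)"
proof (rule eq_matI)
  fix p q assume "p < dim_row (1\<^sub>m (n * m) :: rat mat)" "q < dim_col (1\<^sub>m (n * m) :: rat mat)"
  then have pq: "p < n * m" "q < n * m" by auto
  note b = div_mod_bounds[OF pq(1)] div_mod_bounds[OF pq(2)]
  have "p = q \<longleftrightarrow> p div m = q div m \<and> p mod m = q mod m" by (metis div_mult_mod_eq)
  then show "restrict n (1\<^sub>m n) $$ (p, q) = 1\<^sub>m (n * m) $$ (p, q)"
    using pq b unfolding restrict_def by (simp add: c_\<beta> c_zero)
qed (simp_all add: restrict_def)

text \<open>For some nonzero \<open>\<beta> l\<close>, the products of \<open>\<beta> l\<close> with
  an entry of \<open>A\<close> and with the corresponding entry of the identity have the same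
  coordinates; cancel \<open>\<beta> l\<close>.\<close>

lemma restrict_eq_one:
  assumes A: "A \<in> carrier_mat n n" and 1: "restrict n A = 1\<^sub>m (n * m)"
  shows "A = 1\<^sub>m n"
proof (rule eq_matI)
  fix i j assume "i < dim_row (1\<^sub>m n :: 'a mat)" "j < dim_col (1\<^sub>m n :: 'a mat)"
  then have ij: "i < n" "j < n" by auto
  have "\<exists>l<m. \<beta> l \<noteq> 0"
  proof (rule ccontr)
    assume "\<not> ?thesis"
    then have "(\<Sum>k<m. of_rat (c k 1) * \<beta> k) = 0" by (intro sum.neutral) auto
    then show False using expand[of 1] by simp
  qed
  then obtain l where l: "l < m" "\<beta> l \<noteq> 0" by auto
  have "c k (A $$ (i, j) * \<beta> l) = c k ((1\<^sub>m n $$ (i, j)) * \<beta> l)" if k: "k < m" for k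
  proof -
    have lt: "i * m + k < n * m" if "i < n" "k < m" for i k
    proof -
      have "Suc i * m \<le> n * m" using that by (intro mult_right_mono) auto
      then show ?thesis using that by simp
    qed
    have "restrict n A $$ (i * m + k, j * m + l) = restrict n (1\<^sub>m n) $$ (i * m + k, j * m + l)"
      unfolding 1 restrict_one ..
    then show ?thesis unfolding restrict_def using lt[OF ij(1) k] lt[OF ij(2) l(1)] k l(1) by simp
  qed
  then have "(\<Sum>k<m. of_rat (c k (A $$ (i, j) * \<beta> l)) * \<beta> k) = (\<Sum>k<m. of_rat (c k ((1\<^sub>m n $$ (i, j)) * \<beta> l)) * \<beta> k)"
    by simp
  then have "A $$ (i, j) * \<beta> l = (1\<^sub>m n $$ (i, j)) * \<beta> l" using expand by metis
  then show "A $$ (i, j) = 1\<^sub>m n $$ (i, j)" using l(2) by simp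
qed (use A in auto)

text \<open>The entries of \<open>restrict n A\<close> are values of finitely many additive
  functionals at entries of \<open>A\<close>, which lie in one finitely generated additive
  group.\<close>

lemma restrict_denom:
  assumes "fin_ring R"
  shows "\<exists>N>0. \<forall>A\<in>carrier_mat n n. elements_mat A \<subseteq> R \<longrightarrow> denom N (restrict n A)"
proof -
  obtain F where F: "finite F" "R \<subseteq> zspan F" using assms unfolding fin_ring_def by auto
  obtain N where N: "N > 0"
    and z: "\<forall>i\<in>{..<m} \<times> {..<m}. \<forall>x\<in>zspan F. of_int N * c (fst i) (x * \<beta> (snd i)) \<in> \<int>"
    using zspan_bounded_denominator[of "\<lambda>i x. c (fst i) (x * \<beta> (snd i))" "{..<m} \<times> {..<m}" F] F(1)
    by (auto simp: c_add distrib_right)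
  have "denom N (restrict n A)" if A: "A \<in> carrier_mat n n" "elements_mat A \<subseteq> R" for A
    unfolding denom_def
  proof (intro allI impI)
    fix p q assume "p < dim_row (restrict n A)" "q < dim_col (restrict n A)"
    then have pq: "p < n * m" "q < n * m" unfolding restrict_def by auto
    note b = div_mod_bounds[OF pq(1)] div_mod_bounds[OF pq(2)]
    have "A $$ (p div m, q div m) \<in> zspan F" using A b F(2) by blast
    then have "of_int N * c (p mod m) (A $$ (p div m, q div m) * \<beta> (q mod m)) \<in> \<int>"
      using z[rule_format, of "(p mod m, q mod m)"] b by simp
    then show "of_int N * restrict n A $$ (p, q) \<in> \<int>"
      unfolding restrict_def using pq by simp
  qed
  then show ?thesis using N by blast
qed

end

context group begin

lemma solvable_chain_exists:
  assumes "solvable_by_finite G"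
  shows "\<exists>D k. solvable_chain D k"
proof -
  obtain N where N: "N \<lhd> G" "solvable (G\<lparr>carrier := N\<rparr>)" "finite (rcosets N)"
    using assms unfolding solvable_by_finite_def by auto
  interpret N: normal N G by (rule N(1))
  have sN: "subgroup N G" by (rule N.subgroup_axioms)
  interpret H: group "G\<lparr>carrier := N\<rparr>" by (rule subgroup.subgroup_is_group[OF sN is_group])
  obtain r where "(derived (G\<lparr>carrier := N\<rparr>) ^^ r) N = {\<one>}"
    using N(2) unfolding H.solvable_iff_trivial_derived_seq by auto
  moreover have "(derived (G\<lparr>carrier := N\<rparr>) ^^ i) N = (derived G ^^ i) N \<and> (derived G ^^ i) N \<subseteq> N" for i
  proof (induction i)
    case (Suc i)
    then show ?case using derived_consistent[OF _ sN, of "(derived G ^^ i) N"] derived_incl[OF _ sN] by simp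
  qed simp
  ultimately have r: "(derived G ^^ r) N = {\<one>}" by simp
  \<comment> \<open>Truncated subtraction keeps the series constant, equal to \<open>N\<close>, from
    index \<open>r\<close> on; there the commutator condition holds because \<open>N\<close> is a
    subgroup.\<close>
  define D where "D i = (derived G ^^ (r - i)) N" for i
  have norm: "(derived G ^^ i) N \<lhd> G" for i
    by (induction i) (simp_all add: N(1) derived_is_normal)
  have Dn: "D i \<lhd> G" for i unfolding D_def by (rule norm)
  \<comment> \<open>Finite index enters as periodicity of the quotient, through the order of the
    finite group.\<close>
  have "periodic_group (G Mod N)" unfolding periodic_group_def
  proof
    fix x assume x: "x \<in> carrier (G Mod N)"
    interpret Q: group "G Mod N" by (rule N.factorgroup_is_group)
    have "Coset.order (G Mod N) > 0" using Q.order_gt_0_iff_finite N(3) by (simp add: FactGroup_def)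
    then show "\<exists>k>0. x [^]\<^bsub>G Mod N\<^esub> (k::nat) = \<one>\<^bsub>G Mod N\<^esub>" using Q.pow_order_eq_1[OF x] by blast
  qed
  then have per: "\<forall>x\<in>carrier G. \<exists>k>0. x [^] (k::nat) \<in> N" unfolding N.periodic_factor_iff .
  have "x \<otimes> y \<otimes> inv x \<otimes> inv y \<in> D i" if xy: "x \<in> D (Suc i)" "y \<in> D (Suc i)" for x y i
  proof (cases "i < r")
    case True
    then have "r - i = Suc (r - Suc i)" by simp
    then have "D i = derived G (D (Suc i))" unfolding D_def by simp
    moreover have "x \<otimes> y \<otimes> inv x \<otimes> inv y \<in> derived G (D (Suc i))"
      unfolding derived_def by (rule generate.incl) (use xy in blast)
    ultimately show ?thesis by simp
  next
    case False
    then have "D i = N" "D (Suc i) = N" unfolding D_def by simp_all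
    then show ?thesis using xy sN by (simp add: subgroup.m_closed subgroup.m_inv_closed)
  qed
  moreover have "D 0 = {\<one>}" "D r = N" unfolding D_def using r by simp_all
  moreover have "subgroup (D i) G" for i using Dn[of i] by (rule normal_imp_subgroup)
  moreover have "g \<otimes> x \<otimes> inv g \<in> D i" if "g \<in> carrier G" "x \<in> D i" for g x i
    using normal.inv_op_closed2[OF Dn that] .
  ultimately have "solvable_chain D r" unfolding solvable_chain_def using per by simp
  then show ?thesis by blast
qed

end

lemma elements_mat_mult:
  assumes R: "fin_ring R" and A: "A \<in> carrier_mat n n" "elements_mat A \<subseteq> R" and B: "B \<in> carrier_mat n n" "elements_mat B \<subseteq> R"
  shows "elements_mat (A * B) \<subseteq> R"
proof
  fix x assume "x \<in> elements_mat (A * B)"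
  then obtain i j where ij: "i < n" "j < n" "x = (A * B) $$ (i, j)" using A B by (auto dest!: elements_matD)
  show "x \<in> R" unfolding ij(3) mat_mult_entry[OF A(1) B(1) ij(1,2)]
    using A B ij by (intro fin_ring_sum[OF R] fin_ring_mult[OF R]) blast+
qed

text \<open>The generators and their inverses all belong to \<open>G\<close>, so their finitely many
  entries are algebraic integers and lie in one \<open>fin_ring\<close>; it then contains the
  entries of all products.\<close>

lemma finitely_generated_integral_entries:
  assumes G: "subgroup G (GL n (UNIV :: 'a :: field_char_0 set))"
    and fg: "finitely_generated ((GL n (UNIV :: 'a set))\<lparr>carrier := G\<rparr>)"
    and int: "G \<subseteq> carrier (GL n (ring_of_integers :: 'a set))"
  shows "\<exists>R. fin_ring R \<and> (\<forall>A\<in>G. elements_mat A \<subseteq> R)"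
proof -
  let ?H = "(GL n (UNIV :: 'a set))\<lparr>carrier := G\<rparr>"
  interpret H: group ?H by (rule subgroup.subgroup_is_group[OF G GL_group])
  obtain S where S: "S \<subseteq> G" "finite S" "generate ?H S = G" using fg unfolding finitely_generated_def by auto
  have mat: "A \<in> carrier_mat n n" "elements_mat A \<subseteq> ring_of_integers" if "A \<in> G" for A
    using GL_carrier_mat[of A n ring_of_integers] int that by auto
  let ?T = "S \<union> m_inv ?H ` S"
  have T: "?T \<subseteq> G" using S(1) H.inv_closed by auto
  have "finite (\<Union>A\<in>?T. elements_mat A)" using S(2) by (auto simp: elements_mat_def)
  moreover have "algebraic_int x" if "x \<in> (\<Union>A\<in>?T. elements_mat A)" for x
    using that mat(2) T unfolding ring_of_integers_def by blast
  ultimately obtain R where R: "fin_ring R" "(\<Union>A\<in>?T. elements_mat A) \<subseteq> R"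
    using fin_ring_algebraic_ints[of "\<Union>A\<in>?T. elements_mat A"] by blast
  have "A \<in> carrier_mat n n \<and> elements_mat A \<subseteq> R" if "A \<in> generate ?H S" for A
    using that
  proof induction
    case one
    then show ?case using fin_ring_zero[OF R(1)] fin_ring_one[OF R(1)] by (auto dest!: elements_matD)
  next
    case (incl A) then show ?case using R(2) mat(1) S(1) by blast
  next
    case (inv A) then show ?case using R(2) mat(1) T by blast
  next
    case (eng A B)
    then have AB: "A \<in> carrier_mat n n" "elements_mat A \<subseteq> R" "B \<in> carrier_mat n n" "elements_mat B \<subseteq> R" by auto
    show ?case using elements_mat_mult[OF R(1) AB] mult_carrier_mat[OF AB(1,3)] by simp
  qed
  then show ?thesis using R(1) unfolding S(3) by blast
qed

theorem proposition2p9: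
  fixes G :: "'a :: field_char_0 mat set" and n m :: nat
  assumes "number_field TYPE('a)"
    and "m = number_field_degree TYPE('a)"
    and "n > 0"
    and "subgroup G (GL n (UNIV :: 'a set))"
    and "finitely_generated ((GL n (UNIV :: 'a set))\<lparr>carrier := G\<rparr>)"
    and "G \<subseteq> carrier (GL n (ring_of_integers :: 'a set))"
    and "solvable_by_finite ((GL n (UNIV :: 'a set))\<lparr>carrier := G\<rparr>)"
  shows "has_finite_torsion_free_rank ((GL n (UNIV :: 'a set))\<lparr>carrier := G\<rparr>) \<and>
         real (hirsch_number ((GL n (UNIV :: 'a set))\<lparr>carrier := G\<rparr>))
           \<le> real (n * m * (n * m + 1)) / 2 \<and>
         has_finite_prufer_rank ((GL n (UNIV :: 'a set))\<lparr>carrier := G\<rparr>) \<and>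
         real (prufer_rank ((GL n (UNIV :: 'a set))\<lparr>carrier := G\<rparr>))
           \<le> real (n * m * (2 * n * m + 3)) / 2"
proof -
  let ?H = "(GL n (UNIV :: 'a set))\<lparr>carrier := G\<rparr>"
  interpret H: group ?H by (rule subgroup.subgroup_is_group[OF assms(4) GL_group])
  have one: "\<one>\<^bsub>?H\<^esub> = 1\<^sub>m n" and mult: "A \<otimes>\<^bsub>?H\<^esub> B = A * B" for A B by simp_all
  obtain \<beta> :: "nat \<Rightarrow> 'a" and c where c: "\<forall>k x y. c k (x + y) = c k x + c k y" "\<forall>k q x. c k (of_rat q * x) = q * c k x"
    "\<forall>x. x = (\<Sum>k<m. of_rat (c k x) * \<beta> k)" "\<forall>k<m. \<forall>l<m. c k (\<beta> l) = (if k = l then 1 else 0)"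
    using number_field_coordinates[OF assms(1,2)] by (elim exE conjE) (rule that)
  interpret number_field_basis \<beta> c m
    by (rule number_field_basis.intro) (rule c[rule_format]; assumption)+
  have mat: "A \<in> carrier_mat n n" if "A \<in> G" for A
    using GL_carrier_mat[of A n UNIV] subgroup.subset[OF assms(4)] that by auto
  obtain R where R: "fin_ring R" "\<forall>A\<in>G. elements_mat A \<subseteq> R"
    using finitely_generated_integral_entries[OF assms(4,5,6)] by blast
  obtain N where "N > 0" "\<forall>A\<in>carrier_mat n n. elements_mat A \<subseteq> R \<longrightarrow> denom N (restrict n A)"
    using restrict_denom[OF R(1)] by blast
  then have N: "\<exists>N>0. \<forall>A\<in>G. denom N (restrict n A)" using mat R(2) by blast
  have rep: "H.rat_rep G (n * m) (restrict n)"
    unfolding H.rat_rep_def one mult using N mat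
    by (intro conjI ballI restrict_one restrict_mult) (auto simp: restrict_def)
  \<comment> \<open>Restriction of scalars is faithful, so the bounds relative to the kernel become
    absolute.\<close>
  have ker: "H.rker G (n * m) (restrict n) = {\<one>\<^bsub>?H\<^esub>}"
  proof -
    have "1\<^sub>m n \<in> G" using H.one_closed unfolding one by simp
    moreover have "A = 1\<^sub>m n" if "A \<in> G" "restrict n A = 1\<^sub>m (n * m)" for A
      by (rule restrict_eq_one[OF mat[OF that(1)] that(2)])
    ultimately show ?thesis unfolding H.rker_def one using restrict_one[of n] by blast
  qed
  obtain D k where "H.solvable_chain D k" using H.solvable_chain_exists[OF assms(7)] by (elim exE) (rule that)
  moreover have "subgroup G ?H" using H.subgroup_self by simp
  ultimately have "H.bounds {\<one>\<^bsub>?H\<^esub>} (carrier ?H) (n * m)" using H.rational_bounds[OF _ _ rep] unfolding ker by simp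
  then obtain d where d: "d = n * m" and b: "H.bounds {\<one>\<^bsub>?H\<^esub>} (carrier ?H) d" by blast
  have b1: "H.relgen {\<one>\<^bsub>?H\<^esub>} (carrier ?H) (d * d + (3 * d) div 2)" using b unfolding H.bounds_def by (rule conjunct1)
  obtain h where h: "2 * h \<le> d * (d + 1)" "H.ser {\<one>\<^bsub>?H\<^esub>} (carrier ?H) h"
    using b unfolding H.bounds_def by (elim conjE exE) (rule that)
  note hirsch = H.hirsch_number_le[OF h(2)]
  note rank = H.relgen_prufer[OF b1]
  have "2 * hirsch_number ?H \<le> d * (d + 1)" using hirsch(2) h(1) by linarith
  then have "real (2 * hirsch_number ?H) \<le> real (d * (d + 1))" by (rule of_nat_mono)
  then have 1: "real (hirsch_number ?H) \<le> real (d * (d + 1)) / 2" by simp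
  have "prufer_rank ?H \<le> d * d + (3 * d) div 2" unfolding prufer_rank_def by (rule Least_le) (rule rank)
  then have "2 * prufer_rank ?H \<le> 2 * (d * d + (3 * d) div 2)" by (rule mult_left_mono) simp
  \<comment> \<open>Doubling the floor of 3 d / 2 gives at most 3 d.\<close>
  also have "\<dots> \<le> d * (2 * d + 3)" unfolding distrib_left by simp
  finally have "real (2 * prufer_rank ?H) \<le> real (d * (2 * d + 3))" by (rule of_nat_mono)
  then have 2: "real (prufer_rank ?H) \<le> real (d * (2 * d + 3)) / 2" by simp
  have "has_finite_prufer_rank ?H" unfolding has_finite_prufer_rank_def using rank by (rule exI)
  then show ?thesis using hirsch(1) 1 2 unfolding d by (simp only: mult.assoc mult.left_commute[of 2] simp_thms)
qed

end
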